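(* Let $f\in\mathbb{C}[x_1,\dots,x_N]$ be an invertible polynomial and let $G$ be a subgroup of $G_f\cap\mathrm{SL}(N;\mathbb{C})$. Then the orbifold Jacobian algebra $\mathrm{Jac}(f,G)$ has a structure of a $\mathbb{Z}/2\mathbb{Z}$-graded commutative Frobenius algebra, with the bilinear form induced by the orbifold residue pairing, $\eta(X,Y)=J_{f,G}(X\vdash\zeta,Y\vdash\zeta)$, where $\zeta=[dx_1\wedge\dots\wedge dx_N]$.
   Context: A Frobenius algebra is an associative $\mathbb{C}$-algebra $(A,\circ)$ with a non-degenerate bilinear form $\eta:A\otimes A\to\mathbb{C}$ such that $\eta(X\circ Y,Z)=\eta(X,Y\circ Z)$. $\mathbb{Z}/2\mathbb{Z}$-graded commutative means $X\circ Y=(-1)^{\overline X\,\overline Y}Y\circ X$ for homogeneous $X,Y$ of degrees $\overline X,\overline Y$. **Basic notation.** $N$ is a positive integer and $\mathbf{e}[\alpha]:=\exp(2\pi\sqrt{-1}\,\alpha)$. For a polynomial $h$ in $n\ge 0$ variables, $\mathrm{Jac}(h):=\mathbb{C}[x_1,\dots,x_n]/(\partial h/\partial x_1,\dots,\partial h/\partial x_n)$ ($=\mathbb{C}$ if $n=0$). **Invertible polynomials.** A polynomial $f$ is weighted homogeneous if there are positive integers $w_1,\dots,w_N,d$ with $f(\lambda^{w_1}x_1,\dots,\lambda^{w_N}x_N)=\lambda^d f(x_1,\dots,x_N)$ for all $\lambda\in\mathbb{C}^*$; it is non-degenerate if it has at most an isolated critical point at the origin, equivalently $\dim_{\mathbb{C}}\mathrm{Jac}(f)<\infty$.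 A weighted homogeneous $f$ is *invertible* if $f=\sum_{i=1}^N c_i\prod_{j=1}^N x_j^{E_{ij}}$ with $c_i\in\mathbb{C}^*$ and $E_{ij}\in\mathbb{Z}_{\ge0}$, the matrix $E=(E_{ij})$ is invertible over $\mathbb{Q}$, and both $f$ and its transpose $\widetilde f:=\sum_i c_i\prod_j x_j^{E_{ji}}$ are non-degenerate (weighted homogeneous). **Groups.** $G_f:=\{(\lambda_1,\dots,\lambda_N)\in(\mathbb{C}^* )^N : f(\lambda_1x_1,\dots,\lambda_Nx_N)=f(x_1,\dots,x_N)\}$, identified with a group of diagonal matrices and with a group of $\mathbb{C}$-algebra automorphisms $x_i\mapsto\lambda_ix_i$ of $\mathbb{C}[x_1,\dots,x_N]$; it is finite for $f$ invertible. Each $g\in G_f$ of order $r$ is uniquely $\mathrm{diag}(\mathbf{e}[a_1/r],\dots,\mathbf{e}[a_N/r])$ with $0\le a_i<r$; $\mathrm{age}(g):=\frac1r\sum_i a_i$. Put $\mathrm{Fix}(g):=\{x\in\mathbb{C}^N: gx=x\}$, $N_g:=\dim\mathrm{Fix}(g)$, $f^g:=f|_{\mathrm{Fix}(g)}$. Restriction induces a surjection $\mathrm{Jac}(f)\to\mathrm{Jac}(f^g)$. **The module $\Omega'_{f,G}$.** $\Omega_{f^g}:=\Omega^{N_g}(\mathrm{Fix}(g))/(df^g\wedge\Omega^{N_g-1}(\mathrm{Fix}(g)))$ (regular forms; constants, spanned by the constant function $1_g$, if $\mathrm{Fix}(g)=\{0\}$), a free $\mathrm{Jac}(f^g)$-module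 of rank one, hence a $\mathrm{Jac}(f)$-module. $\Omega'_{f,g}:=\Omega_{f^g}$, $\Omega'_{f,G}:=\bigoplus_{g\in G}\Omega'_{f,g}$, with $\Omega'_{f,g}$ in $\mathbb{Z}/2\mathbb{Z}$-degree $N-N_g\bmod2$. **Orbifold residue pairing.** $J_{f,G}$ vanishes on $\Omega'_{f,g}\otimes\Omega'_{f,h}$ for $h\neq g^{-1}$, and for $\omega_1=[\phi\,dx_{i_1}\wedge\dots\wedge dx_{i_{N_g}}]\in\Omega'_{f,g}$, $\omega_2=[\psi\,dx_{i_1}\wedge\dots\wedge dx_{i_{N_g}}]\in\Omega'_{f,g^{-1}}$ ($x_{i_1},\dots$ the coordinates of $\mathrm{Fix}(g)$) $$J_{f,G}(\omega_1,\omega_2):=(-1)^{N-N_g}\,\mathbf{e}\left[-\tfrac12\mathrm{age}(g)\right]\,|G|\,\mathrm{Res}_{\mathrm{Fix}(g)}\left[\begin{matrix}\phi\psi\,dx_{i_1}\wedge\dots\wedge dx_{i_{N_g}}\\ \frac{\partial f^g}{\partial x_{i_1}}\cdots\frac{\partial f^g}{\partial x_{i_{N_g}}}\end{matrix}\right]$$ (global Grothendieck residue); if $\mathrm{Fix}(g)=\{0\}$, $J_{f,G}(1_g,1_{g^{-1}}):=(-1)^N\mathbf{e}[-\frac12\mathrm{age}(g)]\,|G|$. **Automorphisms.** $\mathrm{Aut}(f,G)$ is the group of $\mathbb{C}$-algebra automorphisms $\varphi$ of $\mathbb{C}[x_1,\dots,x_N]$ with $\varphi(f)=f$ and $\varphi\circ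 g\circ\varphi^{-1}\in G$ for all $g\in G$; it contains $G$, and acts on $\Omega'_{f,G}$ by pull-back of forms $\varphi^*:\Omega'_{f,g}\to\Omega'_{f,\varphi g\varphi^{-1}}$ (as a biregular map, $\varphi$ maps $\mathrm{Fix}(\varphi g\varphi^{-1})$ to $\mathrm{Fix}(g)$). **$G$-twisted Jacobian algebra.** It is a $\mathbb{Z}/2\mathbb{Z}$-graded (associative) $\mathbb{C}$-algebra $\mathrm{Jac}'(f,G)$, with product $\circ$, satisfying: (i) For each $g\in G$ there is a $\mathbb{C}$-module $\mathrm{Jac}'(f,g)\cong\Omega'_{f,g}$ such that $\mathrm{Jac}'(f,\mathrm{id})=\mathrm{Jac}(f)$ and $\mathrm{Jac}'(f,G)_{\bar i}=\bigoplus_{g\in G,\ N-N_g\equiv i\ (2)}\mathrm{Jac}'(f,g)$. (ii) $\mathrm{Jac}'(f,g)\circ\mathrm{Jac}'(f,h)\subset\mathrm{Jac}'(f,gh)$, and the subalgebra $\mathrm{Jac}'(f,\mathrm{id})$ coincides with the algebra $\mathrm{Jac}(f)$. (iii) $\Omega'_{f,G}$ has a $\mathrm{Jac}'(f,G)$-module structure $\vdash$ such that (a) $\mathrm{Jac}'(f,g)\vdash\Omega'_{f,h}\subset\Omega'_{f,gh}$, and the $\mathrm{Jac}'(f,\mathrm{id})$-module structure on $\Omega'_{f,g}$ is the $\mathrm{Jac}(f)$-module structure on $\Omega_{f^g}$ obtained from its $\mathrm{Jac}(f^g)$-module structure (multiplication of forms by functions) via the surjection $\mathrm{Jac}(f)\to\mathrm{Jac}(f^g)$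 induced by restriction to $\mathrm{Fix}(g)$; (b) for the class $\zeta\in\Omega'_{f,\mathrm{id}}$ of a nowhere vanishing $N$-form, $X\mapsto X\vdash\zeta$ is an isomorphism $\mathrm{Jac}'(f,G)\to\Omega'_{f,G}$. (iv) With the action of $\mathrm{Aut}(f,G)$ on $\mathrm{Jac}'(f,G)$ defined by $\varphi^*(X)\vdash\varphi^*(\zeta):=\varphi^*(X\vdash\zeta)$: (a) $\varphi^*(X)\circ\varphi^*(Y)=\varphi^*(X\circ Y)$; (b) $X\circ Y=(-1)^{(N-N_g)(N-N_h)}g^*(Y)\circ X$ for $X\in\mathrm{Jac}'(f,g)$, $Y\in\mathrm{Jac}'(f,h)$. (v) For $X\in\mathrm{Jac}'(f,g)$, $\omega\in\Omega'_{f,h}$, $\omega'\in\Omega'_{f,G}$: $J_{f,G}(X\vdash\omega,\omega')=(-1)^{(N-N_g)(N-N_h)}J_{f,G}(\omega,((h^{-1})^*X)\vdash\omega')$. (vi) For every finite subgroup $G'$ of $G_f$ with $G\subseteq G'$ there is a $G'$-twisted Jacobian algebra $\mathrm{Jac}'(f,G')$ such that, under the identifications $\mathrm{Jac}'(f,G)\cong\Omega'_{f,G}$, $\mathrm{Jac}'(f,G')\cong\Omega'_{f,G'}$ given by $\vdash\zeta$ for a common $\zeta$, the natural injection $\Omega'_{f,G}\to\Omega'_{f,G'}$ induces an injective algebra homomorphism (read by descending induction on $|G|$, the case $G'=G$ being trivial). For invertible $f$ such an algebra exists and is unique up to isomorphism. The **orbifold Jacobian algebra** is $\mathrm{Jac}(f,G):=(\mathrm{Jac}'(f,G))^G$,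 the invariants under the induced $G$-action, with the grading inherited from $\mathrm{Jac}'(f,G)$. *)

theory Defs
  imports
    "HOL-Analysis.Cartesian_Space"
    "HOL-Combinatorics.Permutations"
    "HOL-Library.Poly_Mapping"
    "HOL-Library.Function_Algebras"
    "HOL-Library.Set_Algebras"
    "HOL-Algebra.Algebraic_Closure_Type"
begin

section \<open>Polynomials\<close>

text \<open>
  The variables \<open>x\<^sub>1, \<dots>, x\<^sub>N\<close> are indexed by a finite linearly ordered type \<open>'n\<close>, so
  \<open>N = CARD('n)\<close>; the order matters only for the orientation of wedge products.
\<close>

type_synonym 'n mpoly = "('n \<Rightarrow>\<^sub>0 nat) \<Rightarrow>\<^sub>0 complex"

definition cst :: "complex \<Rightarrow> 'n mpoly" where
  "cst c = Poly_Mapping.single 0 c"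

definition var :: "'n \<Rightarrow> 'n mpoly" where
  "var i = Poly_Mapping.single (Poly_Mapping.single i 1) 1"

definition pd :: "'n \<Rightarrow> 'n mpoly \<Rightarrow> 'n mpoly" where
  "pd i p = (\<Sum>m\<in>Poly_Mapping.keys p. Poly_Mapping.single (m - Poly_Mapping.single i 1)
               (of_nat (Poly_Mapping.lookup m i) * Poly_Mapping.lookup p m))"

definition msubst :: "('n::finite \<Rightarrow> 'n mpoly) \<Rightarrow> 'n mpoly \<Rightarrow> 'n mpoly" where
  "msubst \<sigma> p = (\<Sum>m\<in>Poly_Mapping.keys p. cst (Poly_Mapping.lookup p m) *
                   (\<Prod>i\<in>UNIV. \<sigma> i ^ Poly_Mapping.lookup m i))"

definition meval :: "('n::finite \<Rightarrow> complex) \<Rightarrow> 'n mpoly \<Rightarrow> complex" where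
  "meval x p = (\<Sum>m\<in>Poly_Mapping.keys p. Poly_Mapping.lookup p m *
                  (\<Prod>i\<in>UNIV. x i ^ Poly_Mapping.lookup m i))"

text \<open>The subring of polynomials in the variables \<open>x\<^sub>i\<close>, \<open>i \<in> I\<close>, is the coordinate ring of the
  coordinate subspace \<open>{x. \<forall>i. i \<notin> I \<longrightarrow> x i = 0}\<close>; \<open>restrict_poly I\<close> is restriction to it.\<close>

definition polys :: "'n set \<Rightarrow> 'n mpoly set" where
  "polys I = {p. \<forall>m\<in>Poly_Mapping.keys p. Poly_Mapping.keys m \<subseteq> I}"

definition restrict_poly :: "'n::finite set \<Rightarrow> 'n mpoly \<Rightarrow> 'n mpoly" where
  "restrict_poly I = msubst (\<lambda>i. if i \<in> I then var i else 0)"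

abbreviation complex_field :: "complex ring" where
  "complex_field \<equiv> ring_of_type_algebra"

definition jac_ideal :: "'n mpoly \<Rightarrow> 'n mpoly set" where
  "jac_ideal f = genideal ring_of_type_algebra (range (\<lambda>i. pd i f))"

definition Jac :: "'n mpoly \<Rightarrow> 'n mpoly set ring" where
  "Jac f = ring_of_type_algebra Quot jac_ideal f"

abbreviation jac_class :: "'n mpoly \<Rightarrow> 'n mpoly \<Rightarrow> 'n mpoly set" where
  "jac_class f p \<equiv> jac_ideal f +>\<^bsub>ring_of_type_algebra\<^esub> p"


section \<open>Invertible polynomials\<close>

definition weighted_homogeneous :: "'n::finite mpoly \<Rightarrow> bool" where
  "weighted_homogeneous f \<longleftrightarrow>
     (\<exists>w d. (\<forall>i. 0 < w i) \<and> 0 < d \<and>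
        (\<forall>c. c \<noteq> 0 \<longrightarrow> msubst (\<lambda>i. cst (c ^ w i) * var i) f = cst (c ^ d) * f))"

text \<open>Non-degeneracy: the complex vector space \<open>Jac f\<close> is spanned by finitely many classes.\<close>

definition nondegenerate :: "'n mpoly \<Rightarrow> bool" where
  "nondegenerate f \<longleftrightarrow>
     (\<exists>B. finite B \<and> (\<forall>p. \<exists>c. jac_class f p = jac_class f (\<Sum>b\<in>B. cst (c b) * b)))"

definition invertible_polynomial :: "'n::finite mpoly \<Rightarrow> bool" where
  "invertible_polynomial f \<longleftrightarrow>
     (\<exists>(c :: 'n \<Rightarrow> complex) (E :: 'n \<Rightarrow> 'n \<Rightarrow> nat).
        (\<forall>i. c i \<noteq> 0) \<and>
        f = (\<Sum>i\<in>UNIV. cst (c i) * (\<Prod>j\<in>UNIV. var j ^ E i j)) \<and>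
        invertible ((\<chi> i j. of_nat (E i j)) :: rat ^ 'n ^ 'n) \<and>
        weighted_homogeneous f \<and> nondegenerate f \<and>
        (let ft = (\<Sum>i\<in>UNIV. cst (c i) * (\<Prod>j\<in>UNIV. var j ^ E j i))
         in weighted_homogeneous ft \<and> nondegenerate ft))"


section \<open>Diagonal symmetries\<close>

definition torus :: "('n \<Rightarrow> complex) monoid" where
  "torus = \<lparr>carrier = {g. \<forall>i. g i \<noteq> 0}, monoid.mult = (\<lambda>g h i. g i * h i), one = (\<lambda>_. 1)\<rparr>"

definition diag_aut :: "('n::finite \<Rightarrow> complex) \<Rightarrow> 'n mpoly \<Rightarrow> 'n mpoly" where
  "diag_aut g = msubst (\<lambda>i. cst (g i) * var i)"

definition diag_symmetries :: "'n::finite mpoly \<Rightarrow> ('n \<Rightarrow> complex) set" where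
  "diag_symmetries f = {g \<in> carrier torus. diag_aut g f = f}"

definition diag_SL :: "('n::finite \<Rightarrow> complex) set" where
  "diag_SL = {g \<in> carrier torus. (\<Prod>i\<in>UNIV. g i) = 1}"

definition ee :: "real \<Rightarrow> complex" where
  "ee \<alpha> = exp (2 * of_real pi * \<i> * of_real \<alpha>)"

definition age :: "('n::finite \<Rightarrow> complex) \<Rightarrow> real" where
  "age g = (let r = group.ord torus g;
                a = (THE a :: 'n \<Rightarrow> nat. \<forall>i. a i < r \<and> g i = ee (real (a i) / real r))
            in (\<Sum>i\<in>UNIV. real (a i)) / real r)"

text \<open>\<open>Fix(g)\<close> is the coordinate subspace with coordinates \<open>x\<^sub>i\<close>, \<open>i \<in> fix_coords g\<close>.\<close>

definition fix_coords :: "('n \<Rightarrow> complex) \<Rightarrow> 'n set" where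
  "fix_coords g = {i. g i = 1}"

definition fix_dim :: "('n \<Rightarrow> complex) \<Rightarrow> nat" where
  "fix_dim g = card (fix_coords g)"

definition codim :: "('n::finite \<Rightarrow> complex) \<Rightarrow> nat" where
  "codim g = CARD('n) - fix_dim g"

definition restrict_fix :: "'n::finite mpoly \<Rightarrow> ('n \<Rightarrow> complex) \<Rightarrow> 'n mpoly" where
  "restrict_fix f g = restrict_poly (fix_coords g) f"


section \<open>Differential forms\<close>

text \<open>
  A form \<open>\<omega>\<close> is the sum over all \<open>S\<close> of \<open>\<omega> S \<cdot> dx\<^sub>S\<close>, where \<open>dx\<^sub>S\<close> is the wedge product of the
  \<open>dx\<^sub>i\<close>, \<open>i \<in> S\<close>, in increasing order.
\<close>

type_synonym 'n form = "'n set \<Rightarrow> 'n mpoly"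

definition forms :: "'n set \<Rightarrow> nat \<Rightarrow> 'n form set" where
  "forms I k = {\<omega>. \<forall>S. \<omega> S \<in> polys I \<and> (\<not> (S \<subseteq> I \<and> card S = k) \<longrightarrow> \<omega> S = 0)}"

definition wedge :: "'n::{finite,linorder} form \<Rightarrow> 'n form \<Rightarrow> 'n form" where
  "wedge \<alpha> \<beta> = (\<lambda>S. \<Sum>T\<in>Pow S.
      (- 1) ^ card {(t, u). t \<in> T \<and> u \<in> S - T \<and> u < t} * \<alpha> T * \<beta> (S - T))"

definition dfun :: "'n::finite mpoly \<Rightarrow> 'n form" where
  "dfun p = (\<lambda>S. \<Sum>i\<in>UNIV. if S = {i} then pd i p else 0)"

definition wedge_list :: "'n::{finite,linorder} form list \<Rightarrow> 'n form" where
  "wedge_list \<omega>s = foldr wedge \<omega>s (\<lambda>S. if S = {} then 1 else 0)"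

text \<open>An algebra endomorphism \<open>\<phi>\<close> corresponds to the map \<open>x \<mapsto> (\<phi>(x\<^sub>1)(x), \<dots>, \<phi>(x\<^sub>N)(x))\<close>;
  pull-back along it replaces \<open>p dx\<^sub>T\<close> by \<open>\<phi>(p)\<close> times the wedge product of the \<open>d\<phi>(x\<^sub>i)\<close>,
  \<open>i \<in> T\<close>.\<close>

definition pullback ::
  "('n::{finite,linorder} mpoly \<Rightarrow> 'n mpoly) \<Rightarrow> 'n form \<Rightarrow> 'n form" where
  "pullback \<phi> \<omega> = (\<lambda>S. \<Sum>T\<in>UNIV.
      \<phi> (\<omega> T) * wedge_list (map (\<lambda>i. dfun (\<phi> (var i))) (sorted_list_of_set T)) S)"

definition restrict_form :: "'n::finite set \<Rightarrow> 'n form \<Rightarrow> 'n form" where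
  "restrict_form I \<omega> = (\<lambda>S. if S \<subseteq> I then restrict_poly I (\<omega> S) else 0)"

definition scale_form :: "'n mpoly \<Rightarrow> 'n form \<Rightarrow> 'n form" where
  "scale_form p \<omega> = (\<lambda>S. p * \<omega> S)"


section \<open>The module \<open>\<Omega>'\<close>\<close>

text \<open>If \<open>fix_dim g = 0\<close>, the truncated subtraction is harmless: \<open>dfun (restrict_fix f g) = 0\<close>.\<close>

definition Om_rel :: "'n::{finite,linorder} mpoly \<Rightarrow> ('n \<Rightarrow> complex) \<Rightarrow> 'n form set" where
  "Om_rel f g = wedge (dfun (restrict_fix f g)) ` forms (fix_coords g) (fix_dim g - 1)"

definition Om :: "'n::{finite,linorder} mpoly \<Rightarrow> ('n \<Rightarrow> complex) \<Rightarrow> 'n form set set" where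
  "Om f g = (\<lambda>\<omega>. \<omega> +o Om_rel f g) ` forms (fix_coords g) (fix_dim g)"

type_synonym 'n omega = "('n \<Rightarrow> complex) \<Rightarrow> 'n form set"

text \<open>The direct sum of the \<open>Om f g\<close> over \<open>g \<in> G\<close>, for finite \<open>G\<close>. The multiplicative fields
  of the record are not used.\<close>

definition Omega ::
  "'n::{finite,linorder} mpoly \<Rightarrow> ('n \<Rightarrow> complex) set \<Rightarrow> (complex, 'n omega) module" where
  "Omega f G =
     \<lparr>carrier = (\<Pi>\<^sub>E g\<in>G. Om f g),
      monoid.mult = undefined, one = undefined,
      zero = (\<lambda>g\<in>G. Om_rel f g),
      add = (\<lambda>x y. \<lambda>g\<in>G. x g + y g),
      module.smult = (\<lambda>c x. \<lambda>g\<in>G. scale_form (cst c) ` x g + Om_rel f g)\<rparr>"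

definition Omega_incl ::
  "'n::{finite,linorder} mpoly \<Rightarrow> ('n \<Rightarrow> complex) set \<Rightarrow> ('n \<Rightarrow> complex) \<Rightarrow> 'n form set \<Rightarrow> 'n omega"
  where "Omega_incl f G g C = (\<lambda>h\<in>G. if h = g then C else Om_rel f h)"

definition Omega_sector ::
  "'n::{finite,linorder} mpoly \<Rightarrow> ('n \<Rightarrow> complex) set \<Rightarrow> ('n \<Rightarrow> complex) \<Rightarrow> 'n omega set" where
  "Omega_sector f G g = Omega_incl f G g ` Om f g"

definition Omega_extend ::
  "'n::{finite,linorder} mpoly \<Rightarrow> ('n \<Rightarrow> complex) set \<Rightarrow> ('n \<Rightarrow> complex) set \<Rightarrow> 'n omega \<Rightarrow> 'n omega"
  where "Omega_extend f G G' x = (\<lambda>h\<in>G'. if h \<in> G then x h else Om_rel f h)"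

definition form_class ::
  "'n::{finite,linorder} mpoly \<Rightarrow> ('n \<Rightarrow> complex) set \<Rightarrow> ('n \<Rightarrow> complex) \<Rightarrow> 'n form \<Rightarrow> 'n omega"
  where "form_class f G g \<omega> = Omega_incl f G g (\<omega> +o Om_rel f g)"

text \<open>\<open>vol f G\<close> is the class of \<open>dx\<^sub>1 \<and> \<dots> \<and> dx\<^sub>N\<close> in the sector of the identity.\<close>

definition vol :: "'n::{finite,linorder} mpoly \<Rightarrow> ('n \<Rightarrow> complex) set \<Rightarrow> 'n omega" where
  "vol f G = form_class f G \<one>\<^bsub>torus\<^esub> (\<lambda>S. if S = UNIV then 1 else 0)"

definition vol_classes :: "'n::{finite,linorder} mpoly \<Rightarrow> ('n \<Rightarrow> complex) set \<Rightarrow> 'n omega set" where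
  "vol_classes f G = {form_class f G \<one>\<^bsub>torus\<^esub> \<omega> | \<omega>.
      \<omega> \<in> forms UNIV CARD('n) \<and> (\<forall>x. meval x (\<omega> UNIV) \<noteq> 0)}"


section \<open>The orbifold residue pairing\<close>

definition det_on :: "'i set \<Rightarrow> ('i \<Rightarrow> 'i \<Rightarrow> 'a) \<Rightarrow> 'a::comm_ring_1" where
  "det_on I A = (\<Sum>p | p permutes I. of_int (sign p) * (\<Prod>i\<in>I. A i (p i)))"

text \<open>
  The Grothendieck residue of \<open>\<phi> dx\<^sub>I\<close> with denominators \<open>h\<^sub>i\<close>, \<open>i \<in> I\<close>, in the case that the
  \<open>h\<^sub>i\<close> vanish simultaneously at most at the origin of the coordinate subspace, so that the global
  residue is the local one there. By the transformation law, if \<open>x\<^sub>i ^ M\<^sub>i = \<Sum>\<^sub>j A\<^sub>i\<^sub>j h\<^sub>j\<close> then the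
  residue equals that of \<open>det A \<phi> dx\<^sub>I\<close> with denominators \<open>x\<^sub>i ^ M\<^sub>i\<close>, that is, the coefficient of
  the product of the \<open>x\<^sub>i ^ (M\<^sub>i - 1)\<close> in \<open>det A \<phi>\<close> (iterated Cauchy formula). Its value does not
  depend on \<open>M\<close> and \<open>A\<close>. For empty \<open>I\<close> it is the constant \<open>\<phi>\<close>.
\<close>

definition groth_res :: "'n::finite set \<Rightarrow> ('n \<Rightarrow> 'n mpoly) \<Rightarrow> 'n mpoly \<Rightarrow> complex" where
  "groth_res I h \<phi> = (THE r. \<exists>(M :: 'n \<Rightarrow> nat) (A :: 'n \<Rightarrow> 'n \<Rightarrow> 'n mpoly).
      (\<forall>i\<in>I. 0 < M i) \<and> (\<forall>i\<in>I. \<forall>j\<in>I. A i j \<in> polys I) \<and>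
      (\<forall>i\<in>I. var i ^ M i = (\<Sum>j\<in>I. A i j * h j)) \<and>
      r = Poly_Mapping.lookup (det_on I A * \<phi>) (\<Sum>i\<in>I. Poly_Mapping.single i (M i - 1)))"

text \<open>The pairing of the sectors of \<open>g\<close> and its inverse, which have the same fixed subspace. The
  last line evaluates it on representatives \<open>\<alpha>\<close>, \<open>\<beta>\<close>; it does not depend on their choice.\<close>

definition sector_pairing ::
  "'n::{finite,linorder} mpoly \<Rightarrow> ('n \<Rightarrow> complex) set \<Rightarrow> ('n \<Rightarrow> complex) \<Rightarrow>
     'n form set \<Rightarrow> 'n form set \<Rightarrow> complex" where
  "sector_pairing f G g C D = (let I = fix_coords g in THE r. \<exists>\<alpha>\<in>C. \<exists>\<beta>\<in>D.
      r = (- 1) ^ codim g * ee (- age g / 2) * of_nat (card G) *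
          groth_res I (\<lambda>i. pd i (restrict_fix f g)) (\<alpha> I * \<beta> I))"

definition residue_pairing ::
  "'n::{finite,linorder} mpoly \<Rightarrow> ('n \<Rightarrow> complex) set \<Rightarrow> 'n omega \<Rightarrow> 'n omega \<Rightarrow> complex" where
  "residue_pairing f G x y = (\<Sum>g\<in>G. sector_pairing f G g (x g) (y (inv\<^bsub>torus\<^esub> g)))"


section \<open>Automorphisms\<close>

definition calg_automorphism :: "('n mpoly \<Rightarrow> 'n mpoly) \<Rightarrow> bool" where
  "calg_automorphism \<phi> \<longleftrightarrow> bij \<phi> \<and> (\<forall>p q. \<phi> (p + q) = \<phi> p + \<phi> q) \<and>
     (\<forall>p q. \<phi> (p * q) = \<phi> p * \<phi> q) \<and> (\<forall>c. \<phi> (cst c) = cst c)"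

definition Aut :: "'n::finite mpoly \<Rightarrow> ('n \<Rightarrow> complex) set \<Rightarrow> ('n mpoly \<Rightarrow> 'n mpoly) set" where
  "Aut f G = {\<phi>. calg_automorphism \<phi> \<and> \<phi> f = f \<and>
     (\<forall>g\<in>G. \<phi> \<circ> diag_aut g \<circ> inv_into UNIV \<phi> \<in> diag_aut ` G)}"

text \<open>The component in the sector of \<open>h\<close> comes from the sector of \<open>g\<close> with
  \<open>h = \<phi> \<circ> g \<circ> \<phi>\<^sup>-\<^sup>1\<close>.\<close>

definition Omega_pull ::
  "'n::{finite,linorder} mpoly \<Rightarrow> ('n \<Rightarrow> complex) set \<Rightarrow> ('n mpoly \<Rightarrow> 'n mpoly) \<Rightarrow>
     'n omega \<Rightarrow> 'n omega" where
  "Omega_pull f G \<phi> x = (\<lambda>h\<in>G.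
     let g = (THE g. diag_aut g = inv_into UNIV \<phi> \<circ> diag_aut h \<circ> \<phi>)
     in (\<lambda>\<omega>. restrict_form (fix_coords h) (pullback \<phi> \<omega>)) ` x g + Om_rel f h)"


section \<open>Graded algebras and Frobenius algebras\<close>

definition complex_algebra :: "(complex, 'a, 'm) module_scheme \<Rightarrow> bool" where
  "complex_algebra A \<longleftrightarrow> ring A \<and> Module.module complex_field A \<and>
     (\<forall>c. \<forall>x\<in>carrier A. \<forall>y\<in>carrier A.
        (c \<odot>\<^bsub>A\<^esub> x) \<otimes>\<^bsub>A\<^esub> y = c \<odot>\<^bsub>A\<^esub> (x \<otimes>\<^bsub>A\<^esub> y) \<and>
        x \<otimes>\<^bsub>A\<^esub> (c \<odot>\<^bsub>A\<^esub> y) = c \<odot>\<^bsub>A\<^esub> (x \<otimes>\<^bsub>A\<^esub> y))"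

definition complex_algebra_hom ::
  "(complex, 'a, 'm) module_scheme \<Rightarrow> (complex, 'b, 'k) module_scheme \<Rightarrow> ('a \<Rightarrow> 'b) set" where
  "complex_algebra_hom A B = {\<psi> \<in> ring_hom A B.
     \<forall>c. \<forall>x\<in>carrier A. \<psi> (c \<odot>\<^bsub>A\<^esub> x) = c \<odot>\<^bsub>B\<^esub> \<psi> x}"

definition linear_iso ::
  "(complex, 'a, 'm) module_scheme \<Rightarrow> (complex, 'b, 'k) module_scheme \<Rightarrow> ('a \<Rightarrow> 'b) set" where
  "linear_iso A B = {\<psi>. bij_betw \<psi> (carrier A) (carrier B) \<and>
     (\<forall>x\<in>carrier A. \<forall>y\<in>carrier A. \<psi> (x \<oplus>\<^bsub>A\<^esub> y) = \<psi> x \<oplus>\<^bsub>B\<^esub> \<psi> y) \<and>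
     (\<forall>c. \<forall>x\<in>carrier A. \<psi> (c \<odot>\<^bsub>A\<^esub> x) = c \<odot>\<^bsub>B\<^esub> \<psi> x)}"

text \<open>The homogeneous parts are \<open>D 0\<close> (even) and \<open>D 1\<close> (odd).\<close>

definition Z2_graded_algebra ::
  "(complex, 'a, 'm) module_scheme \<Rightarrow> (nat \<Rightarrow> 'a set) \<Rightarrow> bool" where
  "Z2_graded_algebra A D \<longleftrightarrow> complex_algebra A \<and>
     (\<forall>i<2. submodule (D i) complex_field A) \<and>
     (\<forall>x\<in>carrier A. \<exists>!p. p \<in> D 0 \<times> D 1 \<and> x = fst p \<oplus>\<^bsub>A\<^esub> snd p) \<and>
     (\<forall>i<2. \<forall>j<2. \<forall>x\<in>D i. \<forall>y\<in>D j. x \<otimes>\<^bsub>A\<^esub> y \<in> D ((i + j) mod 2))"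

definition Z2_graded_commutative ::
  "(complex, 'a, 'm) module_scheme \<Rightarrow> (nat \<Rightarrow> 'a set) \<Rightarrow> bool" where
  "Z2_graded_commutative A D \<longleftrightarrow>
     (\<forall>i<2. \<forall>j<2. \<forall>x\<in>D i. \<forall>y\<in>D j. x \<otimes>\<^bsub>A\<^esub> y = (- 1) ^ (i * j) \<odot>\<^bsub>A\<^esub> (y \<otimes>\<^bsub>A\<^esub> x))"

definition frobenius_algebra ::
  "(complex, 'a, 'm) module_scheme \<Rightarrow> ('a \<Rightarrow> 'a \<Rightarrow> complex) \<Rightarrow> bool" where
  "frobenius_algebra A \<eta> \<longleftrightarrow> complex_algebra A \<and>
     (\<forall>x\<in>carrier A. \<forall>y\<in>carrier A. \<forall>z\<in>carrier A.
        \<eta> (x \<oplus>\<^bsub>A\<^esub> y) z = \<eta> x z + \<eta> y z \<and> \<eta> z (x \<oplus>\<^bsub>A\<^esub> y) = \<eta> z x + \<eta> z y) \<and>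
     (\<forall>c. \<forall>x\<in>carrier A. \<forall>y\<in>carrier A.
        \<eta> (c \<odot>\<^bsub>A\<^esub> x) y = c * \<eta> x y \<and> \<eta> x (c \<odot>\<^bsub>A\<^esub> y) = c * \<eta> x y) \<and>
     (\<forall>x\<in>carrier A. (\<forall>y\<in>carrier A. \<eta> x y = 0) \<longrightarrow> x = \<zero>\<^bsub>A\<^esub>) \<and>
     (\<forall>y\<in>carrier A. (\<forall>x\<in>carrier A. \<eta> x y = 0) \<longrightarrow> y = \<zero>\<^bsub>A\<^esub>) \<and>
     (\<forall>x\<in>carrier A. \<forall>y\<in>carrier A. \<forall>z\<in>carrier A. \<eta> (x \<otimes>\<^bsub>A\<^esub> y) z = \<eta> x (y \<otimes>\<^bsub>A\<^esub> z))"


section \<open>Twisted Jacobian algebras\<close>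

text \<open>
  An algebra together with its summands \<open>part A g = Jac'(f,g)\<close>, the identification \<open>jac_emb A\<close> of
  \<open>Jac f\<close> with the summand of the identity, and the action \<open>\<turnstile>\<close> on \<open>\<Omega>'\<close>.
\<close>

record ('n, 'a) twisted_alg = "(complex, 'a) module" +
  part :: "('n \<Rightarrow> complex) \<Rightarrow> 'a set"
  jac_emb :: "'n mpoly set \<Rightarrow> 'a"
  lact :: "'a \<Rightarrow> 'n omega \<Rightarrow> 'n omega"

definition parity_part ::
  "('n::finite \<Rightarrow> complex) set \<Rightarrow> ('n, 'a) twisted_alg \<Rightarrow> nat \<Rightarrow> 'a set" where
  "parity_part G A i = (let S = {g \<in> G. codim g mod 2 = i}
                        in {finsum A x S | x. x \<in> (\<Pi> g\<in>S. part A g)})"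

definition axiom_i ::
  "'n::{finite,linorder} mpoly \<Rightarrow> ('n \<Rightarrow> complex) set \<Rightarrow> ('n, 'a) twisted_alg \<Rightarrow> bool" where
  "axiom_i f G A \<longleftrightarrow>
     (\<forall>g\<in>G. submodule (part A g) complex_field A) \<and>
     (\<forall>U\<in>carrier A. \<exists>!x. x \<in> (\<Pi>\<^sub>E g\<in>G. part A g) \<and> U = finsum A x G) \<and>
     (\<forall>g\<in>G. linear_iso (A\<lparr>carrier := part A g\<rparr>)
                (Omega f G\<lparr>carrier := Omega_sector f G g\<rparr>) \<noteq> {}) \<and>
     Z2_graded_algebra A (parity_part G A)"

definition axiom_ii ::
  "'n::{finite,linorder} mpoly \<Rightarrow> ('n \<Rightarrow> complex) set \<Rightarrow> ('n, 'a) twisted_alg \<Rightarrow> bool" where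
  "axiom_ii f G A \<longleftrightarrow>
     (\<forall>g\<in>G. \<forall>h\<in>G. \<forall>U\<in>part A g. \<forall>V\<in>part A h. U \<otimes>\<^bsub>A\<^esub> V \<in> part A (g \<otimes>\<^bsub>torus\<^esub> h)) \<and>
     jac_emb A \<in> ring_iso (Jac f) (A\<lparr>carrier := part A \<one>\<^bsub>torus\<^esub>\<rparr>) \<and>
     (\<forall>c p. jac_emb A (jac_class f (cst c * p)) = c \<odot>\<^bsub>A\<^esub> jac_emb A (jac_class f p))"

definition axiom_iii ::
  "'n::{finite,linorder} mpoly \<Rightarrow> ('n \<Rightarrow> complex) set \<Rightarrow> ('n, 'a) twisted_alg \<Rightarrow> bool" where
  "axiom_iii f G A \<longleftrightarrow> (let \<Omega> = Omega f G in
     (\<forall>U\<in>carrier A. \<forall>\<omega>\<in>carrier \<Omega>. lact A U \<omega> \<in> carrier \<Omega>) \<and>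
     (\<forall>U\<in>carrier A. \<forall>V\<in>carrier A. \<forall>\<omega>\<in>carrier \<Omega>.
        lact A (U \<oplus>\<^bsub>A\<^esub> V) \<omega> = lact A U \<omega> \<oplus>\<^bsub>\<Omega>\<^esub> lact A V \<omega>) \<and>
     (\<forall>U\<in>carrier A. \<forall>\<omega>\<in>carrier \<Omega>. \<forall>\<omega>'\<in>carrier \<Omega>.
        lact A U (\<omega> \<oplus>\<^bsub>\<Omega>\<^esub> \<omega>') = lact A U \<omega> \<oplus>\<^bsub>\<Omega>\<^esub> lact A U \<omega>') \<and>
     (\<forall>c. \<forall>U\<in>carrier A. \<forall>\<omega>\<in>carrier \<Omega>.
        lact A (c \<odot>\<^bsub>A\<^esub> U) \<omega> = c \<odot>\<^bsub>\<Omega>\<^esub> lact A U \<omega> \<and>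
        lact A U (c \<odot>\<^bsub>\<Omega>\<^esub> \<omega>) = c \<odot>\<^bsub>\<Omega>\<^esub> lact A U \<omega>) \<and>
     (\<forall>U\<in>carrier A. \<forall>V\<in>carrier A. \<forall>\<omega>\<in>carrier \<Omega>.
        lact A (U \<otimes>\<^bsub>A\<^esub> V) \<omega> = lact A U (lact A V \<omega>)) \<and>
     (\<forall>\<omega>\<in>carrier \<Omega>. lact A \<one>\<^bsub>A\<^esub> \<omega> = \<omega>) \<and>
     (\<forall>g\<in>G. \<forall>h\<in>G. \<forall>U\<in>part A g. \<forall>\<omega>\<in>Omega_sector f G h.
        lact A U \<omega> \<in> Omega_sector f G (g \<otimes>\<^bsub>torus\<^esub> h)) \<and>
     (\<forall>p. \<forall>g\<in>G. \<forall>\<omega>\<in>forms (fix_coords g) (fix_dim g).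
        lact A (jac_emb A (jac_class f p)) (form_class f G g \<omega>) =
          form_class f G g (scale_form (restrict_poly (fix_coords g) p) \<omega>)) \<and>
     (\<forall>\<zeta>\<in>vol_classes f G. bij_betw (\<lambda>U. lact A U \<zeta>) (carrier A) (carrier \<Omega>)))"

text \<open>The action of \<open>Aut f G\<close> determined by the class \<open>vol f G\<close>; any other class in
  \<open>vol_classes f G\<close> is a non-zero multiple of it and gives the same action.\<close>

definition alg_pull ::
  "'n::{finite,linorder} mpoly \<Rightarrow> ('n \<Rightarrow> complex) set \<Rightarrow> ('n, 'a) twisted_alg \<Rightarrow>
     ('n mpoly \<Rightarrow> 'n mpoly) \<Rightarrow> 'a \<Rightarrow> 'a" where
  "alg_pull f G A \<phi> U = (THE V. V \<in> carrier A \<and>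
     lact A V (Omega_pull f G \<phi> (vol f G)) = Omega_pull f G \<phi> (lact A U (vol f G)))"

definition axiom_iv ::
  "'n::{finite,linorder} mpoly \<Rightarrow> ('n \<Rightarrow> complex) set \<Rightarrow> ('n, 'a) twisted_alg \<Rightarrow> bool" where
  "axiom_iv f G A \<longleftrightarrow>
     (\<forall>\<phi>\<in>Aut f G. \<forall>U\<in>carrier A. \<forall>V\<in>carrier A.
        alg_pull f G A \<phi> U \<otimes>\<^bsub>A\<^esub> alg_pull f G A \<phi> V = alg_pull f G A \<phi> (U \<otimes>\<^bsub>A\<^esub> V)) \<and>
     (\<forall>g\<in>G. \<forall>h\<in>G. \<forall>U\<in>part A g. \<forall>V\<in>part A h.
        U \<otimes>\<^bsub>A\<^esub> V =
          (- 1) ^ (codim g * codim h) \<odot>\<^bsub>A\<^esub> (alg_pull f G A (diag_aut g) V \<otimes>\<^bsub>A\<^esub> U))"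

definition axiom_v ::
  "'n::{finite,linorder} mpoly \<Rightarrow> ('n \<Rightarrow> complex) set \<Rightarrow> ('n, 'a) twisted_alg \<Rightarrow> bool" where
  "axiom_v f G A \<longleftrightarrow>
     (\<forall>g\<in>G. \<forall>h\<in>G. \<forall>U\<in>part A g. \<forall>\<omega>\<in>Omega_sector f G h. \<forall>\<omega>'\<in>carrier (Omega f G).
        residue_pairing f G (lact A U \<omega>) \<omega>' =
          (- 1) ^ (codim g * codim h) *
          residue_pairing f G \<omega> (lact A (alg_pull f G A (diag_aut (inv\<^bsub>torus\<^esub> h)) U) \<omega>'))"

definition extends_to ::
  "'n::{finite,linorder} mpoly \<Rightarrow> ('n \<Rightarrow> complex) set \<Rightarrow> ('n, 'a) twisted_alg \<Rightarrow>
     ('n \<Rightarrow> complex) set \<Rightarrow> ('n, 'a) twisted_alg \<Rightarrow> bool" where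
  "extends_to f G A G' A' \<longleftrightarrow>
     (\<exists>\<psi>\<in>complex_algebra_hom A A'. inj_on \<psi> (carrier A) \<and>
        (\<forall>U\<in>carrier A. lact A' (\<psi> U) (vol f G') = Omega_extend f G G' (lact A U (vol f G))))"

text \<open>
  The last premise is axiom (vi), by descending induction on \<open>G\<close>. Letting \<open>A'\<close> have the same
  carrier type as \<open>A\<close> is no restriction: all these algebras are finite-dimensional over the complex
  numbers, a non-zero \<open>A\<close> therefore has the cardinality of the continuum, and if \<open>A\<close> is zero then so
  is \<open>Jac f\<close>, hence so are all \<open>A'\<close>.
\<close>

inductive twisted_jacobian_algebra ::
  "'n::{finite,linorder} mpoly \<Rightarrow> ('n \<Rightarrow> complex) set \<Rightarrow> ('n, 'a) twisted_alg \<Rightarrow> bool"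
  for f :: "'n mpoly" where
  "\<lbrakk>axiom_i f G A; axiom_ii f G A; axiom_iii f G A; axiom_iv f G A; axiom_v f G A;
    \<forall>G'. subgroup G' torus \<and> finite G' \<and> G' \<subseteq> diag_symmetries f \<and> G \<subset> G' \<longrightarrow>
      (\<exists>A'. twisted_jacobian_algebra f G' A' \<and> extends_to f G A G' A')\<rbrakk>
   \<Longrightarrow> twisted_jacobian_algebra f G A"


section \<open>The orbifold Jacobian algebra\<close>

definition orbifold_jacobian_algebra ::
  "'n::{finite,linorder} mpoly \<Rightarrow> ('n \<Rightarrow> complex) set \<Rightarrow> ('n, 'a) twisted_alg \<Rightarrow>
     ('n, 'a) twisted_alg" where
  "orbifold_jacobian_algebra f G A =
     A\<lparr>carrier := {U \<in> carrier A. \<forall>g\<in>G. alg_pull f G A (diag_aut g) U = U}\<rparr>"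

definition orbifold_parity_part ::
  "'n::{finite,linorder} mpoly \<Rightarrow> ('n \<Rightarrow> complex) set \<Rightarrow> ('n, 'a) twisted_alg \<Rightarrow> nat \<Rightarrow> 'a set" where
  "orbifold_parity_part f G A i =
     parity_part G A i \<inter> carrier (orbifold_jacobian_algebra f G A)"

definition orbifold_form ::
  "'n::{finite,linorder} mpoly \<Rightarrow> ('n \<Rightarrow> complex) set \<Rightarrow> ('n, 'a) twisted_alg \<Rightarrow> 'a \<Rightarrow> 'a \<Rightarrow> complex"
  where "orbifold_form f G A U V = residue_pairing f G (lact A U (vol f G)) (lact A V (vol f G))"

end

theory Submission
  imports Defs "HOL-Analysis.Determinants"
begin

text \<open>
  Write \<open>J\<close> for the residue pairing. Since \<open>G\<close> lies in \<open>SL\<close>, the class \<open>\<zeta>\<close> is \<open>G\<close>-invariant, so that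
  \<open>X \<mapsto> X \<turnstile> \<zeta>\<close> turns the action on the algebra into the pull-back of forms. Axiom (iv)(b) makes
  invariant elements commute up to the sign of their sectors, and together with axiom (v) gives
  \<open>J(X \<circ> Y \<turnstile> \<zeta>, Z \<turnstile> \<zeta>) = \<plusminus> J(Y \<turnstile> (X \<turnstile> \<zeta>), Z \<turnstile> \<zeta>) = J(X \<turnstile> \<zeta>, Y \<turnstile> (Z \<turnstile> \<zeta>))\<close>, where the
  two signs cancel. Non-degeneracy reduces to the residue pairing on each \<open>Jac f\<^sup>g\<close>. There the
  vanishing of some powers of the variables modulo the Jacobian ideal follows from weighted
  homogeneity and finite dimension, and a Bezoutian argument in a second set of variables shows
  that a class orthogonal to all monomials is zero. The classification of invertible polynomials is
  not used: the exponent matrix only serves to make \<open>G\<close> finite.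
\<close>

section \<open>Polynomials over a commutative ring\<close>

text \<open>The residue is a definite description over all ways of expressing powers of the
  variables through the derivatives, so its independence of this choice precedes every computation.
  Independence is proved over an arbitrary coefficient ring and modulo an ideal of coefficients
  because it is used twice: over the complex numbers modulo zero it makes the residue well defined,
  and over C[x] modulo the Jacobian ideal it exchanges the two matrices of the Bezoutian argument.
  Finite dimension is assumed for \<open>Jac f\<close>, while residues live on Fix(g). A weight
  argument bridges the gap: the derivatives of f in the directions moved by g vanish on Fix(g), so
  relations for f restrict to relations for f^g. Non-degeneracy has to be tested on invariant
  elements only. Every diagonal symmetry k preserves the pairing of sectors: pull-back multiplies
  each of the two arguments by the determinant of k on Fix(g), and the residue contributes the
  inverse square of it. Hence this determinant may differ from one on Fix(g), although it is one on
  the whole space for k in G.\<close>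

abbreviation lookup where "lookup \<equiv> Poly_Mapping.lookup"
abbreviation keys where "keys \<equiv> Poly_Mapping.keys"
abbreviation single where "single \<equiv> Poly_Mapping.single"

declare One_nat_def [simp del]

lemma poly_mapping_eq_sum_single:
  fixes p :: "'k \<Rightarrow>\<^sub>0 'b::comm_monoid_add"
  shows "p = (\<Sum>m\<in>keys p. single m (lookup p m))"
proof (rule poly_mapping_eqI)
  fix k
  have "lookup (\<Sum>m\<in>keys p. single m (lookup p m)) k
      = (\<Sum>m\<in>keys p. if m = k then lookup p m else 0)"
    by (simp add: lookup_sum lookup_single when_def)
  also have "\<dots> = lookup p k"
    by (simp add: in_keys_iff)
  finally show "lookup p k = lookup (\<Sum>m\<in>keys p. single m (lookup p m)) k" by simp
qed

lemma poly_mapping_single_induct [case_names zero single add]: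
  fixes p :: "'k \<Rightarrow>\<^sub>0 'b::comm_monoid_add"
  assumes "P 0" "\<And>m c. P (single m c)" "\<And>p q. P p \<Longrightarrow> P q \<Longrightarrow> P (p + q)"
  shows "P p"
proof -
  have "P (\<Sum>m\<in>S. single m (lookup p m))" if "finite S" for S
    using that by induction (auto intro: assms)
  then show ?thesis
    using poly_mapping_eq_sum_single[of p] finite_keys[of p] by metis
qed

lemma lookup_mult_single:
  fixes p :: "('n \<Rightarrow>\<^sub>0 nat) \<Rightarrow>\<^sub>0 'c::comm_semiring_1"
  shows "lookup (p * single k a) (m + k) = lookup p m * a"
proof (induction p rule: poly_mapping_single_induct)
  case (single m' c)
  then show ?case
    by (auto simp: mult_single lookup_single when_def)
qed (simp_all add: lookup_add algebra_simps)

lemma lookup_mult_single_nonzero: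
  fixes p :: "('n \<Rightarrow>\<^sub>0 nat) \<Rightarrow>\<^sub>0 'c::comm_semiring_1"
  assumes "lookup (p * single k a) m \<noteq> 0"
  obtains m' where "m = m' + k"
proof -
  have "(\<exists>m'. m = m' + k) \<or> lookup (p * single k a) m = 0"
    by (induction p rule: poly_mapping_single_induct)
      (auto simp: mult_single lookup_single when_def lookup_add distrib_right)
  with assms that show thesis by blast
qed

lemma lookup_mult_const:
  fixes p :: "('n \<Rightarrow>\<^sub>0 nat) \<Rightarrow>\<^sub>0 'c::comm_semiring_1"
  shows "lookup (p * single 0 a) m = lookup p m * a" "lookup (single 0 a * p) m = a * lookup p m"
  using lookup_mult_single[of p 0 a m] by (simp_all add: mult.commute)

text \<open>Generic in the coefficient ring, because monomials are needed both over the complex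
  numbers and over C[x].\<close>

definition monom_of :: "('n \<Rightarrow>\<^sub>0 nat) \<Rightarrow> ('n \<Rightarrow>\<^sub>0 nat) \<Rightarrow>\<^sub>0 'c::comm_semiring_1" where
  "monom_of m = single m 1"

lemma monom_of_add: "monom_of (m + k) = monom_of m * monom_of k"
  by (simp add: monom_of_def mult_single)

lemma monom_of_zero [simp]: "monom_of 0 = 1"
  by (simp add: monom_of_def)

lemma monom_of_power: "monom_of (single i 1) ^ n = monom_of (single i n)"
proof (induction n)
  case (Suc n)
  have "single i (Suc n) = single i 1 + single i n"
    by (simp add: single_add[symmetric] Suc_eq_plus1_left)
  then show ?case using Suc by (simp add: monom_of_add)
qed simp

lemma monom_of_sum: "finite S \<Longrightarrow> monom_of (\<Sum>i\<in>S. m i) = (\<Prod>i\<in>S. monom_of (m i))"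
  by (induction S rule: finite_induct) (simp_all add: monom_of_add)

lemma exponent_eq_sum:
  fixes m :: "'n::finite \<Rightarrow>\<^sub>0 nat"
  shows "m = (\<Sum>i\<in>UNIV. single i (lookup m i))"
  by (rule poly_mapping_eqI) (simp add: lookup_sum lookup_single when_def)

lemma monom_of_eq_prod:
  fixes m :: "'n::finite \<Rightarrow>\<^sub>0 nat"
  shows "monom_of m = (\<Prod>i\<in>UNIV. monom_of (single i 1) ^ lookup m i)"
proof -
  have "monom_of m = monom_of (\<Sum>i\<in>UNIV. single i (lookup m i))"
    using exponent_eq_sum[of m] by simp
  then show ?thesis by (simp add: monom_of_sum monom_of_power)
qed

lemma single_eq_const_monom: "single m c = single 0 c * monom_of m"
  by (simp add: monom_of_def mult_single)

lemma var_eq_monom: "var i = monom_of (single i 1)"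
  by (simp add: var_def monom_of_def)

lemma var_power: "var i ^ n = monom_of (single i n)"
  by (simp add: var_eq_monom monom_of_power)


section \<open>Evaluation homomorphisms\<close>

definition ring_morphism :: "('a::comm_ring_1 \<Rightarrow> 'b::comm_ring_1) \<Rightarrow> bool" where
  "ring_morphism \<kappa> \<longleftrightarrow> \<kappa> 1 = 1 \<and> (\<forall>a b. \<kappa> (a + b) = \<kappa> a + \<kappa> b) \<and> (\<forall>a b. \<kappa> (a * b) = \<kappa> a * \<kappa> b)"

lemma ring_morphismD:
  assumes "ring_morphism \<kappa>"
  shows "\<kappa> 1 = 1" "\<kappa> (a + b) = \<kappa> a + \<kappa> b" "\<kappa> (a * b) = \<kappa> a * \<kappa> b"
    and "\<kappa> 0 = 0" "\<kappa> (- a) = - \<kappa> a" "\<kappa> (a - b) = \<kappa> a - \<kappa> b" "\<kappa> (a ^ n) = \<kappa> a ^ n"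
    and "\<kappa> (sum F S) = (\<Sum>x\<in>S. \<kappa> (F x))" "\<kappa> (prod F S) = (\<Prod>x\<in>S. \<kappa> (F x))"
    and "\<kappa> (of_int z) = of_int z"
proof -
  show one: "\<kappa> 1 = 1" and add: "\<And>a b. \<kappa> (a + b) = \<kappa> a + \<kappa> b"
    and mult: "\<And>a b. \<kappa> (a * b) = \<kappa> a * \<kappa> b"
    using assms by (auto simp: ring_morphism_def)
  show zero: "\<kappa> 0 = 0" using add[of 0 0] by simp
  show neg: "\<And>a. \<kappa> (- a) = - \<kappa> a" using add zero by (metis add.right_inverse add_eq_0_iff)
  show diff: "\<And>a b. \<kappa> (a - b) = \<kappa> a - \<kappa> b" using add neg by (metis diff_conv_add_uminus)
  show "\<kappa> (a ^ n) = \<kappa> a ^ n" by (induction n) (simp_all add: one mult)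
  show "\<kappa> (sum F S) = (\<Sum>x\<in>S. \<kappa> (F x))"
    by (induction S rule: infinite_finite_induct) (simp_all add: zero add)
  show "\<kappa> (prod F S) = (\<Prod>x\<in>S. \<kappa> (F x))"
    by (induction S rule: infinite_finite_induct) (simp_all add: one mult)
  show "\<kappa> (of_int z) = of_int z"
    by (induction z rule: int_induct[of _ 0]) (simp_all add: zero add one diff)
qed

text \<open>The coefficient map \<kappa> makes one homomorphism theorem cover \<open>msubst\<close>
  (with \<open>cst\<close> for \<kappa>) and the later change of variables \<open>in_z\<close>,
  which also changes the coefficient ring.\<close>

definition evalp ::
  "('c::comm_ring_1 \<Rightarrow> 'd::comm_ring_1) \<Rightarrow> ('n::finite \<Rightarrow> 'd) \<Rightarrow> (('n \<Rightarrow>\<^sub>0 nat) \<Rightarrow>\<^sub>0 'c) \<Rightarrow> 'd" where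
  "evalp \<kappa> \<sigma> p = (\<Sum>m\<in>keys p. \<kappa> (lookup p m) * (\<Prod>i\<in>UNIV. \<sigma> i ^ lookup m i))"

lemma evalp_eq_sum_superset:
  assumes "ring_morphism \<kappa>" "finite S" "keys p \<subseteq> S"
  shows "evalp \<kappa> \<sigma> p = (\<Sum>m\<in>S. \<kappa> (lookup p m) * (\<Prod>i\<in>UNIV. \<sigma> i ^ lookup m i))"
  unfolding evalp_def using assms
  by (intro sum.mono_neutral_left) (auto simp: in_keys_iff ring_morphismD)

lemma evalp_add:
  assumes "ring_morphism \<kappa>"
  shows "evalp \<kappa> \<sigma> (p + q) = evalp \<kappa> \<sigma> p + evalp \<kappa> \<sigma> q"
proof -
  let ?S = "keys p \<union> keys q"
  have "keys (p + q) \<subseteq> ?S" by (rule keys_add)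
  then show ?thesis
    using assms
    by (simp add: evalp_eq_sum_superset[of \<kappa> ?S] lookup_add ring_morphismD sum.distrib[symmetric]
        distrib_right)
qed

lemma evalp_single:
  assumes "ring_morphism \<kappa>"
  shows "evalp \<kappa> \<sigma> (single m c) = \<kappa> c * (\<Prod>i\<in>UNIV. \<sigma> i ^ lookup m i)"
  using evalp_eq_sum_superset[OF assms, of "{m}" "single m c" \<sigma>] by simp

lemma evalp_zero [simp]: "evalp \<kappa> \<sigma> 0 = 0"
  by (simp add: evalp_def)

lemma ring_morphism_evalp:
  assumes "ring_morphism \<kappa>"
  shows "ring_morphism (evalp \<kappa> \<sigma>)"
proof -
  have "evalp \<kappa> \<sigma> 1 = 1"
    using evalp_single[OF assms, of \<sigma> 0 1] by (simp add: ring_morphismD[OF assms])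
  moreover have "evalp \<kappa> \<sigma> (p * q) = evalp \<kappa> \<sigma> p * evalp \<kappa> \<sigma> q" for p q
  proof (induction p rule: poly_mapping_single_induct)
    case (single m c)
    show ?case
    proof (induction q rule: poly_mapping_single_induct)
      case (single m' c')
      then show ?case
        by (simp add: mult_single evalp_single[OF assms] ring_morphismD[OF assms] lookup_add
            power_add prod.distrib)
    qed (simp_all add: evalp_add[OF assms] distrib_left)
  qed (simp_all add: evalp_add[OF assms] distrib_right)
  ultimately show ?thesis
    by (simp add: ring_morphism_def evalp_add[OF assms])
qed

lemma evalp_const: "ring_morphism \<kappa> \<Longrightarrow> evalp \<kappa> \<sigma> (single 0 c) = \<kappa> c"
  by (simp add: evalp_single)

lemma prod_power_single:
  fixes \<sigma> :: "'n::finite \<Rightarrow> 'd::comm_ring_1"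
  shows "(\<Prod>j\<in>UNIV. \<sigma> j ^ lookup (single i n) j) = \<sigma> i ^ n"
proof -
  have "(\<Prod>j\<in>UNIV. \<sigma> j ^ lookup (single i n) j) = (\<Prod>j\<in>UNIV. if j = i then \<sigma> i ^ n else 1)"
    by (rule prod.cong) (auto simp: lookup_single when_def)
  then show ?thesis by simp
qed

lemma evalp_var: "ring_morphism \<kappa> \<Longrightarrow> evalp \<kappa> \<sigma> (monom_of (single i 1)) = \<sigma> i"
  unfolding monom_of_def
  by (simp add: evalp_single ring_morphismD prod_power_single del: single_one)

lemma ring_morphism_cst: "ring_morphism cst"
  by (simp add: ring_morphism_def cst_def single_add mult_single)

lemma msubst_eq_evalp: "msubst = evalp cst"
  by (intro ext) (simp add: msubst_def evalp_def)

lemma ring_morphism_msubst: "ring_morphism (msubst \<sigma>)"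
  by (simp add: msubst_eq_evalp ring_morphism_evalp ring_morphism_cst)

lemma msubst_cst [simp]: "msubst \<sigma> (cst c) = cst c"
  by (simp add: msubst_eq_evalp evalp_const ring_morphism_cst cst_def[of c])

lemma msubst_var [simp]: "msubst \<sigma> (var i) = \<sigma> i"
  by (simp add: msubst_eq_evalp evalp_var ring_morphism_cst var_eq_monom)

lemma msubst_single: "msubst \<sigma> (single m c) = cst c * (\<Prod>i\<in>UNIV. \<sigma> i ^ lookup m i)"
  by (simp add: msubst_eq_evalp evalp_single ring_morphism_cst)

lemmas cst_simps = ring_morphismD[OF ring_morphism_cst]

lemma lookup_cst_mult: "lookup (cst c * p) m = c * lookup p m"
  by (simp add: cst_def lookup_mult_const)


subsection \<open>Subrings of polynomials in a subset of the variables\<close>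

lemma keys_exponent_add: "keys (m + k :: 'n \<Rightarrow>\<^sub>0 nat) = keys m \<union> keys k"
  by (auto simp: in_keys_iff lookup_add)

lemma polys_0 [simp]: "0 \<in> polys I"
  by (simp add: polys_def)

lemma polys_add: "p \<in> polys I \<Longrightarrow> q \<in> polys I \<Longrightarrow> p + q \<in> polys I"
  using keys_add[of p q] by (auto simp: polys_def)

lemma polys_single: "c = 0 \<or> keys m \<subseteq> I \<Longrightarrow> single m c \<in> polys I"
  by (auto simp: polys_def)

lemma polys_mult: "p \<in> polys I \<Longrightarrow> q \<in> polys I \<Longrightarrow> p * q \<in> polys I"
  using keys_mult[of p q] by (fastforce simp: polys_def keys_exponent_add)

lemma polys_cst [simp]: "cst c \<in> polys I"
  by (simp add: cst_def polys_single)

lemma polys_1 [simp]: "1 \<in> polys I"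
  using polys_cst[of 1 I] by (simp add: cst_simps)

lemma polys_uminus: "p \<in> polys I \<Longrightarrow> - p \<in> polys I"
  using polys_mult[OF polys_cst[of "-1"], of p I] by (simp add: cst_simps)

lemma polys_diff: "p \<in> polys I \<Longrightarrow> q \<in> polys I \<Longrightarrow> p - q \<in> polys I"
  using polys_add[OF _ polys_uminus] by (metis diff_conv_add_uminus)

lemma polys_sum: "(\<And>x. x \<in> S \<Longrightarrow> F x \<in> polys I) \<Longrightarrow> sum F S \<in> polys I"
  by (induction S rule: infinite_finite_induct) (auto intro: polys_add)

lemma polys_power: "p \<in> polys I \<Longrightarrow> p ^ n \<in> polys I"
  by (induction n) (auto intro: polys_mult)

lemma polys_var: "i \<in> I \<Longrightarrow> var i \<in> polys I"
  by (simp add: var_def polys_single)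

lemma polys_UNIV [simp]: "p \<in> polys UNIV"
  by (simp add: polys_def)

lemma polys_induct [consumes 1, case_names single add]:
  assumes "p \<in> polys I" "\<And>m c. keys m \<subseteq> I \<Longrightarrow> P (single m c)"
    and "\<And>p q. P p \<Longrightarrow> P q \<Longrightarrow> P (p + q)"
  shows "P p"
proof -
  have zero: "P 0" using assms(2)[of 0 0] by simp
  have "P (\<Sum>m\<in>S. single m (lookup p m))" if "finite S" "S \<subseteq> keys p" for S
    using that assms(1) by induction (auto intro: assms(2,3) zero simp: polys_def)
  then show ?thesis
    using poly_mapping_eq_sum_single[of p] finite_keys[of p] by (metis order_refl)
qed

lemma restrict_poly_single:
  "restrict_poly I (single m c) = (if keys m \<subseteq> I then single m c else 0)"
proof (cases "keys m \<subseteq> I")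
  case True
  have "(\<Prod>i\<in>UNIV. (if i \<in> I then var i else 0) ^ lookup m i)
      = (\<Prod>i\<in>UNIV. monom_of (single i 1) ^ lookup m i :: 'a mpoly)"
  proof (rule prod.cong)
    fix i
    have "i \<in> I \<or> lookup m i = 0" using True by (auto simp: in_keys_iff)
    then show "(if i \<in> I then var i else 0) ^ lookup m i
        = (monom_of (single i 1) ^ lookup m i :: 'a mpoly)"
      by (auto simp: var_eq_monom)
  qed simp
  then show ?thesis
    using True
    by (simp add: restrict_poly_def msubst_single monom_of_eq_prod[symmetric])
      (simp add: cst_def single_eq_const_monom[symmetric])
next
  case False
  then obtain i where i: "i \<notin> I" "lookup m i \<noteq> 0" by (auto simp: in_keys_iff)
  then have "(\<Prod>i\<in>UNIV. (if i \<in> I then var i else 0) ^ lookup m i) = (0 :: 'a mpoly)"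
    by (intro prod_zero) (auto simp: power_0_left)
  then show ?thesis using False by (simp add: restrict_poly_def msubst_single)
qed

lemma ring_morphism_restrict_poly: "ring_morphism (restrict_poly I)"
  unfolding restrict_poly_def by (rule ring_morphism_msubst)

lemmas restrict_poly_simps = ring_morphismD[OF ring_morphism_restrict_poly]

lemma restrict_poly_var: "restrict_poly I (var i) = (if i \<in> I then var i else 0)"
  by (simp add: restrict_poly_def)

lemma restrict_poly_polys [simp]: "restrict_poly I p \<in> polys I"
  by (induction p rule: poly_mapping_single_induct)
    (auto simp: restrict_poly_simps restrict_poly_single intro: polys_add polys_single)

lemma restrict_poly_id: "p \<in> polys I \<Longrightarrow> restrict_poly I p = p"
  by (induction rule: polys_induct) (simp_all add: restrict_poly_single restrict_poly_simps)

lemma lookup_restrict_poly: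
  "lookup (restrict_poly I p) m = (if keys m \<subseteq> I then lookup p m else 0)"
  by (induction p rule: poly_mapping_single_induct)
    (auto simp: restrict_poly_simps restrict_poly_single lookup_add lookup_single when_def)


subsection \<open>Partial derivatives\<close>

lemma pd_eq_sum_superset:
  assumes "finite S" "keys p \<subseteq> S"
  shows "pd i p = (\<Sum>m\<in>S. single (m - single i 1) (of_nat (lookup m i) * lookup p m))"
  unfolding pd_def using assms by (intro sum.mono_neutral_left) (auto simp: in_keys_iff)

lemma pd_single: "pd i (single m c) = single (m - single i 1) (of_nat (lookup m i) * c)"
  using pd_eq_sum_superset[of "{m}" "single m c" i] by simp

lemma pd_zero [simp]: "pd i 0 = 0"
  by (simp add: pd_def)

lemma pd_add: "pd i (p + q) = pd i p + pd i q"
proof -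
  let ?S = "keys p \<union> keys q"
  have "keys (p + q) \<subseteq> ?S" by (rule keys_add)
  then show ?thesis
    by (simp add: pd_eq_sum_superset[of ?S] lookup_add sum.distrib[symmetric] single_add[symmetric]
        distrib_left)
qed

lemma pd_cst_mult: "pd i (cst c * p) = cst c * pd i p"
proof (induction p rule: poly_mapping_single_induct)
  case (single m a)
  then show ?case by (simp add: cst_def mult_single pd_single mult.left_commute)
qed (simp_all add: pd_add distrib_left)

lemma pd_var: "pd i (var j) = (if i = j then 1 else 0)"
  by (auto simp: var_def pd_single lookup_single when_def simp del: single_one)
    (simp add: single_one)

lemma pd_polys: "p \<in> polys I \<Longrightarrow> pd i p \<in> polys I"
proof (induction rule: polys_induct)
  case (single m c)
  have "keys (m - single i 1) \<subseteq> keys m" by (auto simp: in_keys_iff lookup_minus)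
  then show ?case using single by (auto simp: pd_single intro!: polys_single)
qed (simp add: pd_add polys_add)

lemma pd_eq_0: "p \<in> polys I \<Longrightarrow> i \<notin> I \<Longrightarrow> pd i p = 0"
proof (induction rule: polys_induct)
  case (single m c)
  then have "lookup m i = 0" by (auto simp: in_keys_iff)
  then show ?case by (simp add: pd_single)
qed (simp add: pd_add)

lemma pd_restrict_poly:
  assumes "i \<in> I"
  shows "restrict_poly I (pd i p) = pd i (restrict_poly I p)"
proof (induction p rule: poly_mapping_single_induct)
  case (single m c)
  show ?case
  proof (cases "lookup m i = 0")
    case True
    then show ?thesis by (auto simp: pd_single restrict_poly_single restrict_poly_simps)
  next
    case False
    have "keys (m - single i 1) \<union> {i} = keys m \<union> {i}"
      by (auto simp: in_keys_iff lookup_minus lookup_single when_def split: if_splits)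
    then have "keys (m - single i 1) \<subseteq> I \<longleftrightarrow> keys m \<subseteq> I" using assms by blast
    then show ?thesis by (auto simp: pd_single restrict_poly_single)
  qed
qed (simp_all add: pd_add restrict_poly_simps)


subsection \<open>Diagonal automorphisms\<close>

lemma ring_morphism_diag_aut: "ring_morphism (diag_aut g)"
  unfolding diag_aut_def by (rule ring_morphism_msubst)

lemmas diag_aut_simps = ring_morphismD[OF ring_morphism_diag_aut]

lemma diag_aut_cst [simp]: "diag_aut g (cst c) = cst c"
  by (simp add: diag_aut_def)

lemma diag_aut_var: "diag_aut g (var i) = cst (g i) * var i"
  by (simp add: diag_aut_def)

text \<open>Monomials are common eigenvectors of all diagonal automorphisms; this is the eigenvalue
  of \<open>g\<close> on the monomial with exponent \<open>m\<close>.\<close>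

definition character :: "('n::finite \<Rightarrow> complex) \<Rightarrow> ('n \<Rightarrow>\<^sub>0 nat) \<Rightarrow> complex" where
  "character g m = (\<Prod>i\<in>UNIV. g i ^ lookup m i)"

lemma diag_aut_single: "diag_aut g (single m c) = single m (character g m * c)"
proof -
  have "diag_aut g (single m c) = cst c * (cst (character g m) * monom_of m)"
    by (simp add: diag_aut_def msubst_single power_mult_distrib prod.distrib cst_simps
        character_def monom_of_eq_prod[of m] var_eq_monom)
  then show ?thesis
    by (simp add: cst_def monom_of_def mult_single mult.commute)
qed

lemma lookup_diag_aut: "lookup (diag_aut g p) m = character g m * lookup p m"
  by (induction p rule: poly_mapping_single_induct)
    (auto simp: diag_aut_simps diag_aut_single lookup_add lookup_single when_def distrib_left)

lemma character_single: "character g (single i n) = g i ^ n"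
  unfolding character_def by (rule prod_power_single)

lemma character_add: "character g (m + k) = character g m * character g k"
  by (simp add: character_def lookup_add power_add prod.distrib)

lemma character_0 [simp]: "character g 0 = 1"
  by (simp add: character_def)

lemma character_sum: "character g (\<Sum>x\<in>S. m x) = (\<Prod>x\<in>S. character g (m x))"
  by (induction S rule: infinite_finite_induct) (simp_all add: character_add)

lemma character_mult_left: "character (\<lambda>i. g i * h i) m = character g m * character h m"
  by (simp add: character_def power_mult_distrib prod.distrib)

lemma diag_aut_polys: "p \<in> polys I \<Longrightarrow> diag_aut g p \<in> polys I"
  by (auto simp: polys_def in_keys_iff lookup_diag_aut)

lemma pd_diag_aut: "pd i (diag_aut g p) = cst (g i) * diag_aut g (pd i p)"
proof (induction p rule: poly_mapping_single_induct)
  case (single m c)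
  show ?case
  proof (cases "lookup m i = 0")
    case True
    then show ?thesis by (simp add: pd_single diag_aut_single diag_aut_simps)
  next
    case False
    \<comment> \<open>Subtraction of exponents is truncated, so this holds only because x_i occurs
      in \<open>m\<close>; in the other case both derivatives vanish.\<close>
    have "m = (m - single i 1) + single i 1"
      using False
      by (intro poly_mapping_eqI) (auto simp: lookup_add lookup_minus lookup_single when_def)
    then have "character g m = character g (m - single i 1) * g i"
      using character_add character_single by (metis power_one_right)
    then show ?thesis
      by (simp add: pd_single diag_aut_single cst_def mult_single algebra_simps)
  qed
qed (simp_all add: pd_add diag_aut_simps distrib_left)

lemma restrict_poly_diag_aut: "restrict_poly I (diag_aut g p) = diag_aut g (restrict_poly I p)"
  by (rule poly_mapping_eqI) (simp add: lookup_restrict_poly lookup_diag_aut)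

lemma diag_aut_inject: "diag_aut g = diag_aut h \<longleftrightarrow> g = h"
proof
  assume "diag_aut g = diag_aut h"
  then have "lookup (diag_aut g (var i)) (single i 1) = lookup (diag_aut h (var i)) (single i 1)" for i
    by simp
  then have "g i = h i" for i
    by (simp add: lookup_diag_aut character_single var_def)
  then show "g = h" by blast
qed simp

lemma diag_aut_comp: "diag_aut g (diag_aut h p) = diag_aut (\<lambda>i. g i * h i) p"
  by (rule poly_mapping_eqI) (simp add: lookup_diag_aut character_mult_left)

lemma diag_aut_one: "diag_aut (\<lambda>i. 1) p = p"
  by (rule poly_mapping_eqI) (simp add: lookup_diag_aut character_def)


section \<open>Determinants over a finite index set\<close>

text \<open>Completes the block on \<open>I\<close> by an identity block, so that the determinant of
  square matrices over the whole index type applies to \<open>det_on\<close>.\<close>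

definition bordered :: "'n::finite set \<Rightarrow> ('n \<Rightarrow> 'n \<Rightarrow> 'a::comm_ring_1) \<Rightarrow> 'a ^ 'n ^ 'n" where
  "bordered I A = (\<chi> i j. if i \<in> I \<and> j \<in> I then A i j else if i = j then 1 else 0)"

text \<open>A permutation that moves an index outside \<open>I\<close> meets an off-diagonal zero of
  the border, and the remaining ones contribute only through their factors in
  \<open>I\<close>.\<close>

lemma det_on_eq_det:
  fixes I :: "'n::finite set"
  shows "det_on I A = det (bordered I A)"
proof -
  have "det (bordered I A)
      = (\<Sum>p | p permutes UNIV. of_int (sign p) * (\<Prod>i\<in>UNIV. bordered I A $ i $ p i))"
    by (simp add: det_def)
  also have "\<dots> = (\<Sum>p | p permutes I. of_int (sign p) * (\<Prod>i\<in>UNIV. bordered I A $ i $ p i))"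
  proof (rule sum.mono_neutral_right)
    show "{p. p permutes I} \<subseteq> {p. p permutes UNIV}"
      by (auto intro: permutes_subset)
    show "\<forall>p\<in>{p. p permutes UNIV} - {p. p permutes I}.
        of_int (sign p) * (\<Prod>i\<in>UNIV. bordered I A $ i $ p i) = 0"
    proof
      fix p assume p: "p \<in> {p. p permutes (UNIV::'n set)} - {p. p permutes I}"
      then obtain i where "i \<notin> I" "p i \<noteq> i" by (auto simp: permutes_def)
      then have "(\<Prod>i\<in>UNIV. bordered I A $ i $ p i) = 0"
        by (intro prod_zero bexI[of _ i]) (auto simp: bordered_def)
      then show "of_int (sign p) * (\<Prod>i\<in>UNIV. bordered I A $ i $ p i) = 0" by simp
    qed
  qed simp
  also have "\<dots> = det_on I A"
    unfolding det_on_def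
  proof (rule sum.cong[OF refl])
    fix p assume p: "p \<in> {p. p permutes I}"
    have "(\<Prod>i\<in>UNIV. bordered I A $ i $ p i) = (\<Prod>i\<in>I. A i (p i))"
      by (rule prod.mono_neutral_cong_right)
        (use p in \<open>auto simp: bordered_def permutes_in_image permutes_not_in\<close>)
    then show "of_int (sign p) * (\<Prod>i\<in>UNIV. bordered I A $ i $ p i)
        = of_int (sign p) * (\<Prod>i\<in>I. A i (p i))" by simp
  qed
  finally show ?thesis by simp
qed

lemma det_on_cong:
  fixes I :: "'n::finite set"
  shows "(\<And>i j. i \<in> I \<Longrightarrow> j \<in> I \<Longrightarrow> A i j = B i j) \<Longrightarrow> det_on I A = det_on I B"
  by (simp add: det_on_eq_det bordered_def vec_eq_iff cong: if_cong)

lemma det_on_mult: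
  fixes I :: "'n::finite set"
  shows "det_on I (\<lambda>i j. \<Sum>k\<in>I. A i k * B k j) = det_on I A * det_on I B"
proof -
  have "bordered I (\<lambda>i j. \<Sum>k\<in>I. A i k * B k j) = bordered I A ** bordered I B"
  proof -
    have "(if i \<in> I \<and> j \<in> I then \<Sum>k\<in>I. A i k * B k j else if i = j then 1 else 0)
        = (\<Sum>k\<in>UNIV. bordered I A $ i $ k * bordered I B $ k $ j)" for i j
    proof (cases "i \<in> I")
      case True
      then have "(\<Sum>k\<in>UNIV. bordered I A $ i $ k * bordered I B $ k $ j)
          = (\<Sum>k\<in>I. A i k * bordered I B $ k $ j)"
        by (intro sum.mono_neutral_cong_right) (auto simp: bordered_def)
      moreover have "(\<Sum>k\<in>I. A i k * bordered I B $ k $ j) = 0" if "j \<notin> I"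
        using that by (intro sum.neutral) (auto simp: bordered_def)
      moreover have "(\<Sum>k\<in>I. A i k * bordered I B $ k $ j) = (\<Sum>k\<in>I. A i k * B k j)" if "j \<in> I"
        using that by (intro sum.cong) (auto simp: bordered_def)
      ultimately show ?thesis using True by auto
    next
      case False
      then have "(\<Sum>k\<in>UNIV. bordered I A $ i $ k * bordered I B $ k $ j)
          = (\<Sum>k\<in>{i}. bordered I B $ k $ j)"
        by (intro sum.mono_neutral_cong_right) (auto simp: bordered_def)
      then show ?thesis using False by (auto simp: bordered_def)
    qed
    then show ?thesis
      by (simp add: vec_eq_iff matrix_matrix_mult_def) (simp add: bordered_def)
  qed
  then show ?thesis by (simp add: det_on_eq_det det_mul)
qed

lemma det_on_diagonal:
  fixes I :: "'n::finite set"
  shows "det_on I (\<lambda>i j. if i = j then d i else 0) = (\<Prod>i\<in>I. d i)"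
proof -
  have "det_on I (\<lambda>i j. if i = j then d i else 0) = (\<Prod>i\<in>UNIV. if i \<in> I then d i else 1)"
    unfolding det_on_eq_det by (subst det_diagonal) (auto simp: bordered_def intro!: prod.cong)
  then show ?thesis by (simp add: prod.If_cases)
qed

lemma det_on_scale:
  fixes I :: "'n::finite set"
  shows "det_on I (\<lambda>i j. r i * A i j * c j) = (\<Prod>i\<in>I. r i) * (\<Prod>i\<in>I. c i) * det_on I A"
proof -
  have "(\<Prod>i\<in>I. r i * A i (p i) * c (p i))
      = (\<Prod>i\<in>I. r i) * (\<Prod>i\<in>I. c i) * (\<Prod>i\<in>I. A i (p i))" if "p permutes I" for p
    using prod.permute[OF that, of c] by (simp add: prod.distrib o_def mult_ac)
  then show ?thesis
    unfolding det_on_def sum_distrib_left by (intro sum.cong) (auto simp: mult_ac)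
qed

lemma det_on_morphism:
  fixes I :: "'n::finite set"
  assumes "ring_morphism \<kappa>"
  shows "\<kappa> (det_on I A) = det_on I (\<lambda>i j. \<kappa> (A i j))"
  by (simp add: det_on_def ring_morphismD[OF assms])

lemma det_on_row_diff:
  fixes I :: "'n::finite set"
  assumes "k \<in> I"
  shows "det_on I A - det_on I (A(k := r)) = det_on I (A(k := \<lambda>j. A k j - r j))"
proof -
  have split: "(\<Prod>i\<in>I. (A(k := s)) i (p i)) = s (p k) * (\<Prod>i\<in>I - {k}. A i (p i))" for p s
  proof -
    have "(\<Prod>i\<in>I - {k}. (A(k := s)) i (p i)) = (\<Prod>i\<in>I - {k}. A i (p i))"
      by (rule prod.cong) auto
    then show ?thesis by (subst prod.remove[OF _ assms]) auto
  qed
  have "(\<Prod>i\<in>I. A i (p i)) = A k (p k) * (\<Prod>i\<in>I - {k}. A i (p i))" for p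
    using split[of "A k" p] by simp
  then show ?thesis
    unfolding det_on_def split by (simp add: sum_subtractf[symmetric] algebra_simps)
qed

text \<open>Column k is replaced by the combination of all columns with coefficients u_l. In the
  multilinear expansion every term with l \<noteq> k has a repeated column. The expansion is carried
  out on rows of the transpose \<open>T\<close>; no division occurs, so any commutative ring is
  allowed.\<close>

lemma det_on_cramer:
  fixes A :: "'n::finite \<Rightarrow> 'n \<Rightarrow> 'a::comm_ring_1"
  assumes k: "k \<in> I"
  shows "det_on I A * u k = det_on I (\<lambda>i j. if j = k then \<Sum>l\<in>I. A i l * u l else A i j)"
proof -
  define T where "T = transpose (bordered I A)"
  have T: "T $ i $ j = bordered I A $ j $ i" for i j by (simp add: T_def transpose_def)
  have det_T: "det (\<chi> j. if j = k then row l T else row j T) = (if l = k then det T else 0)" for l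
  proof (cases "l = k")
    case True
    then have "(\<chi> j. if j = k then row l T else row j T) = T"
      by (simp add: vec_eq_iff row_def)
    then show ?thesis using True by simp
  next
    case False
    then show ?thesis
      by (auto intro!: det_identical_rows[of l k] simp: row_def vec_eq_iff)
  qed
  have tr: "transpose (bordered I (\<lambda>i j. if j = k then \<Sum>l\<in>I. A i l * u l else A i j))
      = (\<chi> j. if j = k then (\<Sum>l\<in>I. u l *s row l T) else row j T)"
  proof -
    have "bordered I (\<lambda>i j. if j = k then \<Sum>l\<in>I. A i l * u l else A i j) $ i $ j
        = (if j = k then (\<Sum>l\<in>I. u l *s row l T) else row j T) $ i" for i j
    proof (cases "j = k")
      case True
      have "(\<Sum>l\<in>I. u l *s row l T) $ i = (\<Sum>l\<in>I. u l * bordered I A $ i $ l)"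
        by (simp add: sum_component row_def T)
      also have "\<dots> = (if i \<in> I then \<Sum>l\<in>I. A i l * u l else 0)"
      proof (cases "i \<in> I")
        case True
        then show ?thesis by (simp add: bordered_def mult.commute cong: sum.cong_simp)
      next
        case False
        then show ?thesis by (auto simp: bordered_def intro: sum.neutral)
      qed
      finally have "(\<Sum>l\<in>I. u l *s row l T) $ i = (if i \<in> I then \<Sum>l\<in>I. A i l * u l else 0)" .
      then show ?thesis using True k by (simp add: bordered_def)
    next
      case False
      then show ?thesis by (simp add: row_def T bordered_def)
    qed
    then show ?thesis by (simp add: vec_eq_iff transpose_def)
  qed
  have "det_on I (\<lambda>i j. if j = k then \<Sum>l\<in>I. A i l * u l else A i j)
      = det (transpose (bordered I (\<lambda>i j. if j = k then \<Sum>l\<in>I. A i l * u l else A i j)))"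
    by (simp only: det_on_eq_det det_transpose)
  also have "\<dots> = det (\<chi> j. if j = k then (\<Sum>l\<in>I. u l *s row l T) else row j T)"
    by (simp only: tr)
  also have "\<dots> = (\<Sum>l\<in>I. det (\<chi> j. if j = k then u l *s row l T else row j T))"
    by (rule det_linear_row_sum) simp
  also have "\<dots> = (\<Sum>l\<in>I. u l * (if l = k then det T else 0))"
    by (subst det_row_mul) (simp add: det_T)
  also have "\<dots> = (\<Sum>l\<in>I. if l = k then u k * det T else 0)"
    by (rule sum.cong) auto
  also have "\<dots> = u k * det T"
    using k by simp
  finally show ?thesis by (simp add: T_def det_on_eq_det mult.commute)
qed


section \<open>Residues at the origin\<close>

definition is_ideal :: "'a::comm_ring_1 set \<Rightarrow> bool" where
  "is_ideal J \<longleftrightarrow> 0 \<in> J \<and> (\<forall>a\<in>J. \<forall>b\<in>J. a + b \<in> J) \<and> (\<forall>a\<in>J. \<forall>r. r * a \<in> J)"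

lemma is_idealD:
  assumes "is_ideal J"
  shows "0 \<in> J" "a \<in> J \<Longrightarrow> b \<in> J \<Longrightarrow> a + b \<in> J" "a \<in> J \<Longrightarrow> r * a \<in> J" "a \<in> J \<Longrightarrow> a * r \<in> J"
    and "a \<in> J \<Longrightarrow> - a \<in> J" "a \<in> J \<Longrightarrow> b \<in> J \<Longrightarrow> a - b \<in> J"
    and "(\<And>x. x \<in> S \<Longrightarrow> F x \<in> J) \<Longrightarrow> sum F S \<in> J"
proof -
  show *: "0 \<in> J" "\<And>a b. a \<in> J \<Longrightarrow> b \<in> J \<Longrightarrow> a + b \<in> J" "\<And>a r. a \<in> J \<Longrightarrow> r * a \<in> J"
    using assms by (auto simp: is_ideal_def)
  show "\<And>a r. a \<in> J \<Longrightarrow> a * r \<in> J" using *(3) by (metis mult.commute)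
  show neg: "\<And>a. a \<in> J \<Longrightarrow> - a \<in> J" using *(3)[of _ "-1"] by simp
  show "\<And>a b. a \<in> J \<Longrightarrow> b \<in> J \<Longrightarrow> a - b \<in> J" using *(2) neg by (metis diff_conv_add_uminus)
  show "(\<And>x. x \<in> S \<Longrightarrow> F x \<in> J) \<Longrightarrow> sum F S \<in> J"
    by (induction S rule: infinite_finite_induct) (auto intro: *)
qed

lemma is_ideal_zero: "is_ideal {0}"
  by (simp add: is_ideal_def)

text \<open>Every term of the Leibniz expansion contains a factor from column
  \<open>k\<close>.\<close>

lemma det_on_in_ideal:
  fixes I :: "'n::finite set"
  assumes J: "is_ideal J" and k: "k \<in> I" and col: "\<And>i. i \<in> I \<Longrightarrow> A i k \<in> J"
  shows "det_on I A \<in> J"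
  unfolding det_on_def
proof (rule is_idealD(7)[OF J], rule is_idealD(3)[OF J])
  fix p assume "p \<in> {p. p permutes I}"
  then have p: "p permutes I" by simp
  then obtain i where i: "i \<in> I" "p i = k"
    using k by (metis permutes_in_image permutes_surj surjD)
  have "(\<Prod>i\<in>I. A i (p i)) = A i (p i) * (\<Prod>i\<in>I - {i}. A i (p i))"
    by (rule prod.remove) (auto simp: i)
  then show "(\<Prod>i\<in>I. A i (p i)) \<in> J"
    using col[of i] i is_idealD(4)[OF J] by simp
qed

section \<open>Ideals of powers of variables, and independence of the determinant\<close>

definition small_ideal ::
  "'n set \<Rightarrow> ('n \<Rightarrow> nat) \<Rightarrow> 'c::comm_ring_1 set \<Rightarrow> (('n \<Rightarrow>\<^sub>0 nat) \<Rightarrow>\<^sub>0 'c) set" where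
  "small_ideal K M J = {p. \<forall>m. (\<forall>i\<in>K. lookup m i < M i) \<longrightarrow> lookup p m \<in> J}"

lemma is_ideal_small_ideal:
  assumes J: "is_ideal J"
  shows "is_ideal (small_ideal K M J)"
proof -
  have "r * a \<in> small_ideal K M J" if a: "a \<in> small_ideal K M J" for a r
  proof (induction r rule: poly_mapping_single_induct)
    case (single k c)
    show ?case
      unfolding small_ideal_def
    proof (intro CollectI allI impI)
      fix m assume m: "\<forall>i\<in>K. lookup m i < M i"
      show "lookup (single k c * a) m \<in> J"
      proof (cases "lookup (a * single k c) m = 0")
        case True
        then show ?thesis using is_idealD(1)[OF J] by (simp add: mult.commute)
      next
        case False
        then obtain m' where m': "m = m' + k" by (rule lookup_mult_single_nonzero)
        then have "\<forall>i\<in>K. lookup m' i < M i" using m by (auto simp: lookup_add)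
        then have "lookup a m' \<in> J" using a by (simp add: small_ideal_def)
        then show ?thesis
          using is_idealD(4)[OF J] m' by (simp add: mult.commute[of "single k c"] lookup_mult_single)
      qed
    qed
  qed (auto simp: small_ideal_def distrib_right lookup_add is_idealD[OF J])
  then show ?thesis
    by (auto simp: is_ideal_def small_ideal_def lookup_add is_idealD[OF J])
qed

lemma small_ideal_mono: "K \<subseteq> K' \<Longrightarrow> small_ideal K M J \<subseteq> small_ideal K' M J"
  by (auto simp: small_ideal_def)

lemma power_in_small_ideal:
  assumes "is_ideal J" "i \<in> K"
  shows "monom_of (single i (M i)) \<in> small_ideal K M J"
  using assms by (auto simp: small_ideal_def monom_of_def lookup_single when_def is_idealD)

text \<open>Membership constrains only the exponents of variables in \<open>K\<close>, and
  multiplying by a power of another variable merely shifts the coefficients.\<close>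

lemma small_ideal_cancel_power:
  assumes "p * monom_of (single i n) \<in> small_ideal K M J" "i \<notin> K"
  shows "p \<in> small_ideal K M J"
  unfolding small_ideal_def
proof (intro CollectI allI impI)
  fix m assume "\<forall>j\<in>K. lookup m j < M j"
  then have "\<forall>j\<in>K. lookup (m + single i n) j < M j"
    using assms(2) by (auto simp: lookup_add lookup_single when_def)
  then have "lookup (p * monom_of (single i n)) (m + single i n) \<in> J"
    using assms(1) unfolding small_ideal_def by blast
  then show "lookup p m \<in> J" by (simp add: monom_of_def lookup_mult_single)
qed

context
  fixes I :: "'n::finite set" and M :: "'n \<Rightarrow> nat" and J :: "'c::comm_ring_1 set"
    and u :: "'n \<Rightarrow> ('n \<Rightarrow>\<^sub>0 nat) \<Rightarrow>\<^sub>0 'c"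
  assumes J: "is_ideal J"
begin

text \<open>\<open>small_ideal {} M J\<close> consists of the polynomials with all coefficients in
  \<open>J\<close>. So over the quotient of the coefficient ring by \<open>J\<close> the condition
  says that \<open>A\<close> maps the vector \<open>u\<close> to the vector of powers. In general
  \<open>small_ideal K M J\<close> is the ideal generated by \<open>J\<close> and the powers z_i^(M
  i) with i in \<open>K\<close>.\<close>

definition represents_powers :: "('n \<Rightarrow> 'n \<Rightarrow> ('n \<Rightarrow>\<^sub>0 nat) \<Rightarrow>\<^sub>0 'c) \<Rightarrow> bool" where
  "represents_powers A \<longleftrightarrow>
     (\<forall>i\<in>I. monom_of (single i (M i)) - (\<Sum>j\<in>I. A i j * u j) \<in> small_ideal {} M J)"

text \<open>The two determinants differ by a determinant \<open>D\<close> whose \<open>k\<close>-th row annihilates \<open>u\<close>. By Cramer's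
  rule \<open>D u\<^sub>l\<close>, hence also \<open>D z\<^sub>k^M\<^sub>k\<close>, lies in the ideal of the other powers, modulo which \<open>z\<^sub>k\<close> is
  not a zero divisor.\<close>

lemma det_row_exchange:
  assumes B: "represents_powers B" and B': "represents_powers (B(k := r))" and k: "k \<in> I"
  shows "det_on I B - det_on I (B(k := r)) \<in> small_ideal I M J"
proof -
  let ?W = "small_ideal (I - {k}) M J"
  let ?C = "small_ideal {} M J"
  have W: "is_ideal ?W" and C: "is_ideal ?C"
    using is_ideal_small_ideal[OF J] by auto
  have C_W: "?C \<subseteq> ?W" by (rule small_ideal_mono) simp
  define D where "D = B(k := \<lambda>j. B k j - r j)"
  have "(\<Sum>j\<in>I. D i j * u j) \<in> ?W" if i: "i \<in> I" for i
  proof (cases "i = k")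
    case True
    let ?y = "monom_of (single k (M k)) :: ('n \<Rightarrow>\<^sub>0 nat) \<Rightarrow>\<^sub>0 'c"
    have "?y - (\<Sum>j\<in>I. B k j * u j) \<in> ?C" "?y - (\<Sum>j\<in>I. r j * u j) \<in> ?C"
      using B B' k by (force simp: represents_powers_def)+
    from is_idealD(6)[OF C this(2,1)]
    have "(\<Sum>j\<in>I. B k j * u j) - (\<Sum>j\<in>I. r j * u j) \<in> ?C" by simp
    then show ?thesis
      using True C_W by (auto simp: D_def left_diff_distrib sum_subtractf)
  next
    case False
    have "monom_of (single i (M i)) - (\<Sum>j\<in>I. B i j * u j) \<in> ?C"
      using B i by (auto simp: represents_powers_def)
    moreover have "monom_of (single i (M i)) \<in> ?W"
      using i False by (intro power_in_small_ideal[OF J]) auto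
    ultimately show ?thesis
      using is_idealD(6)[OF W, of "monom_of (single i (M i))"] C_W False
      by (force simp: D_def)
  qed
  then have "det_on I D * u l \<in> ?W" if "l \<in> I" for l
    unfolding det_on_cramer[OF that] by (intro det_on_in_ideal[OF W that]) auto
  then have "det_on I D * (\<Sum>j\<in>I. B k j * u j) \<in> ?W"
    unfolding sum_distrib_left by (intro is_idealD(7)[OF W]) (metis is_idealD(3)[OF W] mult.left_commute)
  moreover have "det_on I D * (monom_of (single k (M k)) - (\<Sum>j\<in>I. B k j * u j)) \<in> ?W"
    using B k C_W by (intro is_idealD(3)[OF W]) (auto simp: represents_powers_def)
  ultimately have "det_on I D * monom_of (single k (M k)) \<in> ?W"
    using is_idealD(2)[OF W] by (fastforce simp: algebra_simps)
  then have "det_on I D \<in> ?W"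
    by (rule small_ideal_cancel_power) simp
  then show ?thesis
    using det_on_row_diff[OF k, of B r] small_ideal_mono[of "I - {k}" I M J] by (auto simp: D_def)
qed

text \<open>Being a representation is a condition on each row separately, so rows of
  \<open>B\<close> can be exchanged for rows of \<open>B'\<close> one at a time.\<close>

lemma det_independent:
  assumes B: "represents_powers B" and B': "represents_powers B'"
  shows "det_on I B - det_on I B' \<in> small_ideal I M J"
proof -
  have W: "is_ideal (small_ideal I M J)" by (rule is_ideal_small_ideal[OF J])
  define mix where "mix S = (\<lambda>i. if i \<in> S then B' i else B i)" for S
  have mix: "represents_powers (mix S)" for S
    using B B' by (auto simp: represents_powers_def mix_def)
  have "det_on I B - det_on I (mix S) \<in> small_ideal I M J" if "finite S" "S \<subseteq> I" for S
    using that
  proof (induction S rule: finite_induct)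
    case empty
    then show ?case using is_idealD(1)[OF W] by (simp add: mix_def)
  next
    case (insert k S)
    have "mix (insert k S) = (mix S)(k := B' k)" by (auto simp: mix_def)
    then have "det_on I (mix S) - det_on I (mix (insert k S)) \<in> small_ideal I M J"
      using det_row_exchange[OF mix, of S k "B' k"] mix[of "insert k S"] insert.prems by simp
    from is_idealD(2)[OF W insert.IH this] insert.prems show ?case by simp
  qed
  from this[of I] have "det_on I B - det_on I (mix I) \<in> small_ideal I M J" by simp
  moreover have "det_on I (mix I) = det_on I B'"
    by (rule det_on_cong) (simp add: mix_def)
  ultimately show ?thesis by simp
qed

end

section \<open>The residue as a coefficient\<close>

definition top_exponent :: "'n::finite set \<Rightarrow> ('n \<Rightarrow> nat) \<Rightarrow> 'n \<Rightarrow>\<^sub>0 nat" where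
  "top_exponent I M = (\<Sum>i\<in>I. single i (M i - 1))"

lemma lookup_top_exponent: "lookup (top_exponent I M) i = (if i \<in> I then M i - 1 else 0)"
  by (simp add: top_exponent_def lookup_sum lookup_single when_def)

lemma small_ideal_top_coeff:
  assumes "p \<in> small_ideal I M J" "\<And>i. i \<in> I \<Longrightarrow> 0 < M i"
  shows "lookup p (top_exponent I M) \<in> J"
proof -
  have "\<forall>i\<in>I. lookup (top_exponent I M) i < M i"
    using assms(2) by (simp add: lookup_top_exponent)
  then show ?thesis using assms(1) by (simp add: small_ideal_def)
qed


text \<open>The coefficients are arbitrary polynomials, also when all generators lie in
  \<open>polys I\<close>; \<open>fix_ideal\<close> later cuts back to
  \<open>polys I\<close>.\<close>

definition gen_ideal :: "'n set \<Rightarrow> ('n \<Rightarrow> 'n mpoly) \<Rightarrow> 'n mpoly set" where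
  "gen_ideal I h = {\<Sum>i\<in>I. a i * h i | a. True}"

lemma gen_idealI: "p = (\<Sum>i\<in>I. a i * h i) \<Longrightarrow> p \<in> gen_ideal I h"
  by (auto simp: gen_ideal_def)

lemma is_ideal_gen_ideal: "is_ideal (gen_ideal I h)"
  unfolding is_ideal_def
proof (intro conjI ballI allI)
  show "0 \<in> gen_ideal I h" by (rule gen_idealI[of _ "\<lambda>_. 0"]) simp
next
  fix a b assume "a \<in> gen_ideal I h" "b \<in> gen_ideal I h"
  then obtain x y where "a = (\<Sum>i\<in>I. x i * h i)" "b = (\<Sum>i\<in>I. y i * h i)"
    by (auto simp: gen_ideal_def)
  then show "a + b \<in> gen_ideal I h"
    by (intro gen_idealI[of _ "\<lambda>i. x i + y i"]) (simp add: distrib_right sum.distrib)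
next
  fix a r assume "a \<in> gen_ideal I h"
  then obtain x where "a = (\<Sum>i\<in>I. x i * h i)" by (auto simp: gen_ideal_def)
  then show "r * a \<in> gen_ideal I h"
    by (intro gen_idealI[of _ "\<lambda>i. r * x i"]) (simp add: sum_distrib_left mult.assoc)
qed

lemma gen_in_gen_ideal:
  assumes "finite I" "k \<in> I"
  shows "h k \<in> gen_ideal I h"
proof (rule gen_idealI[of _ "\<lambda>i. if i = k then 1 else 0"])
  have "(\<Sum>i\<in>I. (if i = k then 1 else 0) * h i) = (\<Sum>i\<in>I. if i = k then h k else 0)"
    by (rule sum.cong) auto
  then show "h k = (\<Sum>i\<in>I. (if i = k then 1 else 0) * h i)" using assms by simp
qed

text \<open>These are the conditions under the definite description in
  \<open>groth_res\<close>.\<close>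

definition residue_data ::
  "'n::finite set \<Rightarrow> ('n \<Rightarrow> 'n mpoly) \<Rightarrow> ('n \<Rightarrow> nat) \<Rightarrow> ('n \<Rightarrow> 'n \<Rightarrow> 'n mpoly) \<Rightarrow> bool" where
  "residue_data I h M A \<longleftrightarrow> (\<forall>i\<in>I. 0 < M i) \<and> (\<forall>i\<in>I. \<forall>j\<in>I. A i j \<in> polys I) \<and>
      (\<forall>i\<in>I. var i ^ M i = (\<Sum>j\<in>I. A i j * h j))"

text \<open>Multiplying row i by x_i^(K i) multiplies the determinant by a monomial, and the
  exponent at which the coefficient is read moves by exactly that monomial.\<close>

lemma residue_data_raise:
  fixes I :: "'n::finite set"
  assumes "residue_data I h M A"
  shows "residue_data I h (\<lambda>i. K i + M i) (\<lambda>i j. var i ^ K i * A i j)"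
    and "lookup (det_on I (\<lambda>i j. var i ^ K i * A i j) * \<phi>) (top_exponent I (\<lambda>i. K i + M i))
      = lookup (det_on I A * \<phi>) (top_exponent I M)"
proof -
  have A: "0 < M i" "var i ^ M i = (\<Sum>j\<in>I. A i j * h j)" if "i \<in> I" for i
    using assms that by (auto simp: residue_data_def)
  show "residue_data I h (\<lambda>i. K i + M i) (\<lambda>i j. var i ^ K i * A i j)"
    using assms
    by (auto simp: residue_data_def power_add mult.assoc sum_distrib_left
        intro!: polys_mult polys_power polys_var)
  have "det_on I (\<lambda>i j. var i ^ K i * A i j) = (\<Prod>i\<in>I. var i ^ K i) * det_on I A"
    using det_on_scale[of I "\<lambda>i. var i ^ K i" A "\<lambda>_. 1"] by simp
  also have "(\<Prod>i\<in>I. var i ^ K i) = monom_of (\<Sum>i\<in>I. single i (K i))"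
    by (simp add: monom_of_sum var_power)
  finally have "det_on I (\<lambda>i j. var i ^ K i * A i j) * \<phi>
      = (det_on I A * \<phi>) * single (\<Sum>i\<in>I. single i (K i)) 1"
    by (simp add: monom_of_def mult_ac)
  moreover have "top_exponent I (\<lambda>i. K i + M i) = top_exponent I M + (\<Sum>i\<in>I. single i (K i))"
    unfolding top_exponent_def sum.distrib[symmetric]
  proof (intro sum.cong refl)
    fix i assume "i \<in> I"
    then have "K i + M i - 1 = (M i - 1) + K i" using A(1)[of i] by simp
    then show "single i (K i + M i - 1) = single i (M i - 1) + single i (K i)"
      by (simp only: single_add)
  qed
  ultimately show "lookup (det_on I (\<lambda>i j. var i ^ K i * A i j) * \<phi>)
        (top_exponent I (\<lambda>i. K i + M i)) = lookup (det_on I A * \<phi>) (top_exponent I M)"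
    by (simp add: lookup_mult_single)
qed

text \<open>Both data are raised to the common exponents \<open>M + M'\<close>; there the
  determinants agree modulo the powers of the variables, by the independence lemma with zero
  coefficient ideal.\<close>

lemma residue_data_unique:
  fixes I :: "'n::finite set"
  assumes "residue_data I h M A" "residue_data I h M' A'"
  shows "lookup (det_on I A * \<phi>) (top_exponent I M) = lookup (det_on I A' * \<phi>) (top_exponent I M')"
proof -
  define N where "N = (\<lambda>i. M' i + M i)"
  define B where "B = (\<lambda>i j. var i ^ M' i * A i j)"
  define B' where "B' = (\<lambda>i j. var i ^ M i * A' i j)"
  have N': "(\<lambda>i. M i + M' i) = N" by (auto simp: N_def)
  have B: "residue_data I h N B"
    using residue_data_raise(1)[OF assms(1), of M'] by (simp add: N_def B_def)
  have B': "residue_data I h N B'"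
    using residue_data_raise(1)[OF assms(2), of M] by (simp add: N' B'_def)
  have W: "is_ideal (small_ideal I N {0::complex})" and C: "is_ideal (small_ideal {} N {0::complex})"
    by (auto intro!: is_ideal_small_ideal is_ideal_zero)
  have "represents_powers I N {0} h B" "represents_powers I N {0} h B'"
    using B B' is_idealD(1)[OF C]
    by (auto simp: represents_powers_def[OF is_ideal_zero] residue_data_def var_power[symmetric])
  from det_independent[OF is_ideal_zero this]
  have "(det_on I B - det_on I B') * \<phi> \<in> small_ideal I N {0}"
    by (rule is_idealD(4)[OF W])
  then have "lookup ((det_on I B - det_on I B') * \<phi>) (top_exponent I N) \<in> {0}"
    by (rule small_ideal_top_coeff) (use B in \<open>auto simp: residue_data_def\<close>)
  then have "lookup (det_on I B * \<phi>) (top_exponent I N) = lookup (det_on I B' * \<phi>) (top_exponent I N)"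
    by (simp add: left_diff_distrib lookup_minus)
  then show ?thesis
    using residue_data_raise(2)[OF assms(1), of M' \<phi>] residue_data_raise(2)[OF assms(2), of M \<phi>]
    by (simp add: N_def[symmetric] N' B_def[symmetric] B'_def[symmetric])
qed

lemma groth_res_eq:
  assumes "residue_data I h M A"
  shows "groth_res I h \<phi> = lookup (det_on I A * \<phi>) (top_exponent I M)"
  unfolding groth_res_def
proof (rule the_equality)
  show "\<exists>M' A'. (\<forall>i\<in>I. 0 < M' i) \<and> (\<forall>i\<in>I. \<forall>j\<in>I. A' i j \<in> polys I) \<and>
      (\<forall>i\<in>I. var i ^ M' i = (\<Sum>j\<in>I. A' i j * h j)) \<and>
      lookup (det_on I A * \<phi>) (top_exponent I M)
        = lookup (det_on I A' * \<phi>) (\<Sum>i\<in>I. single i (M' i - 1))"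
    by (rule exI[of _ M], rule exI[of _ A])
      (use assms in \<open>auto simp: residue_data_def top_exponent_def\<close>)
next
  fix r
  assume "\<exists>M' A'. (\<forall>i\<in>I. 0 < M' i) \<and> (\<forall>i\<in>I. \<forall>j\<in>I. A' i j \<in> polys I) \<and>
      (\<forall>i\<in>I. var i ^ M' i = (\<Sum>j\<in>I. A' i j * h j)) \<and>
      r = lookup (det_on I A' * \<phi>) (\<Sum>i\<in>I. single i (M' i - 1))"
  then obtain M' A' where "residue_data I h M' A'"
      and r: "r = lookup (det_on I A' * \<phi>) (top_exponent I M')"
    unfolding residue_data_def top_exponent_def by blast
  then show "r = lookup (det_on I A * \<phi>) (top_exponent I M)"
    using residue_data_unique[OF assms] by metis
qed

context
  fixes I :: "'n::finite set" and h M A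
  assumes data: "residue_data I h M A"
begin

lemma groth_res_add: "groth_res I h (\<phi> + \<psi>) = groth_res I h \<phi> + groth_res I h \<psi>"
  by (simp add: groth_res_eq[OF data] distrib_left lookup_add)

lemma groth_res_cst_mult: "groth_res I h (cst c * \<phi>) = c * groth_res I h \<phi>"
  by (simp add: groth_res_eq[OF data] mult.left_commute[of _ "cst c"] lookup_cst_mult)

text \<open>By Cramer's rule \<open>det_on I A * h k\<close> is a determinant whose k-th column
  consists of the powers x_i^(M i), and no multiple of these reaches the top exponent.\<close>

lemma groth_res_gen_ideal:
  assumes "\<phi> \<in> gen_ideal I h"
  shows "groth_res I h \<phi> = 0"
proof -
  let ?W = "small_ideal I M {0::complex}"
  have W: "is_ideal ?W" by (intro is_ideal_small_ideal is_ideal_zero)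
  have "det_on I A * h k \<in> ?W" if "k \<in> I" for k
    unfolding det_on_cramer[OF that]
  proof (rule det_on_in_ideal[OF W that])
    fix i assume "i \<in> I"
    then have "(\<Sum>l\<in>I. A i l * h l) = monom_of (single i (M i))"
      using data by (simp add: residue_data_def var_power)
    then show "(if k = k then \<Sum>l\<in>I. A i l * h l else A i k) \<in> ?W"
      using power_in_small_ideal[OF is_ideal_zero \<open>i \<in> I\<close>] by simp
  qed
  moreover obtain a where "\<phi> = (\<Sum>i\<in>I. a i * h i)"
    using assms by (auto simp: gen_ideal_def)
  moreover from this have "det_on I A * \<phi> = (\<Sum>i\<in>I. a i * (det_on I A * h i))"
    by (simp add: sum_distrib_left mult.left_commute)
  ultimately have "det_on I A * \<phi> \<in> ?W"
    by (metis (no_types, lifting) is_idealD(3,7)[OF W])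
  then have "lookup (det_on I A * \<phi>) (top_exponent I M) \<in> {0}"
    by (rule small_ideal_top_coeff) (use data in \<open>auto simp: residue_data_def\<close>)
  then show ?thesis by (simp add: groth_res_eq[OF data])
qed

text \<open>Change of variables by g: one factor g_i comes from dx_i, the other from the denominator
  h_i, which transforms like a derivative of a g-invariant function.\<close>

lemma groth_res_diag_aut:
  assumes g: "\<And>i. i \<in> I \<Longrightarrow> g i \<noteq> 0"
    and h: "\<And>i. i \<in> I \<Longrightarrow> cst (g i) * diag_aut g (h i) = h i"
  shows "(\<Prod>i\<in>I. g i) ^ 2 * groth_res I h (diag_aut g \<phi>) = groth_res I h \<phi>"
proof -
  \<comment> \<open>Found by applying \<open>diag_aut g\<close> to the relation for x_i^(M i),
    dividing by g_i^(M i) and expressing the transformed h_j through h_j.\<close>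
  define A' where "A' = (\<lambda>i j. cst (inverse (g i) ^ M i) * diag_aut g (A i j) * cst (inverse (g j)))"
  have inv: "cst (inverse (g i)) * cst (g i) = 1" if "i \<in> I" for i
    using g[OF that] by (simp add: cst_simps(3)[symmetric] cst_simps(1))
  have data': "residue_data I h M A'"
    unfolding residue_data_def
  proof (intro conjI ballI)
    fix i assume i: "i \<in> I"
    have "A' i j * h j = cst (inverse (g i) ^ M i) * diag_aut g (A i j * h j)" if "j \<in> I" for j
    proof -
      have "A' i j * h j = cst (inverse (g i) ^ M i) * diag_aut g (A i j)
          * (cst (inverse (g j)) * cst (g j)) * diag_aut g (h j)"
        by (subst h[OF that, symmetric]) (simp add: A'_def mult_ac)
      also have "\<dots> = cst (inverse (g i) ^ M i) * diag_aut g (A i j * h j)"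
        by (simp add: inv[OF that] diag_aut_simps mult.assoc)
      finally show ?thesis .
    qed
    then have "(\<Sum>j\<in>I. A' i j * h j) = cst (inverse (g i) ^ M i) * diag_aut g (\<Sum>j\<in>I. A i j * h j)"
      by (simp add: diag_aut_simps sum_distrib_left)
    also have "(\<Sum>j\<in>I. A i j * h j) = var i ^ M i"
      using data i by (simp add: residue_data_def)
    also have "cst (inverse (g i) ^ M i) * diag_aut g (var i ^ M i)
        = (cst (inverse (g i)) * cst (g i)) ^ M i * var i ^ M i"
      by (simp add: diag_aut_simps diag_aut_var cst_simps power_mult_distrib mult_ac)
    finally show "var i ^ M i = (\<Sum>j\<in>I. A' i j * h j)"
      by (simp only: inv[OF i] power_one mult_1_left)
  qed (use data in \<open>auto simp: residue_data_def A'_def intro!: polys_mult diag_aut_polys\<close>)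
  let ?c = "(\<Prod>i\<in>I. inverse (g i) ^ M i) * (\<Prod>i\<in>I. inverse (g i))"
  have det: "det_on I A' = cst ?c * diag_aut g (det_on I A)"
    unfolding A'_def det_on_scale det_on_morphism[OF ring_morphism_diag_aut]
    by (simp add: cst_simps)
  have "character g (top_exponent I M) = (\<Prod>i\<in>I. g i ^ (M i - 1))"
    by (simp add: top_exponent_def character_sum character_single)
  then have res: "groth_res I h (diag_aut g \<phi>)
      = (?c * (\<Prod>i\<in>I. g i ^ (M i - 1))) * groth_res I h \<phi>"
    unfolding groth_res_eq[OF data', of "diag_aut g \<phi>"] groth_res_eq[OF data, of \<phi>] det mult.assoc lookup_cst_mult
      diag_aut_simps(3)[symmetric] lookup_diag_aut by (simp only: mult.assoc)
  have "(g i)\<^sup>2 * (inverse (g i) ^ M i * inverse (g i) * g i ^ (M i - 1)) = 1" if "i \<in> I" for i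
  proof -
    have "0 < M i" using data that by (simp add: residue_data_def)
    then obtain n where "M i = Suc n" using gr0_implies_Suc by blast
    then have "(g i)\<^sup>2 * (inverse (g i) ^ M i * inverse (g i) * g i ^ (M i - 1))
        = (g i * inverse (g i)) ^ (n + 2)"
      by (simp add: power_mult_distrib power2_eq_square mult_ac)
    then show ?thesis using g[OF that] by simp
  qed
  then have "(\<Prod>i\<in>I. (g i)\<^sup>2 * (inverse (g i) ^ M i * inverse (g i) * g i ^ (M i - 1))) = 1"
    by (intro prod.neutral ballI)
  then have "(\<Prod>i\<in>I. g i) ^ 2 * (?c * (\<Prod>i\<in>I. g i ^ (M i - 1))) = 1"
    by (simp only: prod.distrib prod_power_distrib mult_ac)
  then show ?thesis
    unfolding res mult.assoc[symmetric] by (simp only: mult_1_left)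
qed

end


subsection \<open>Non-degeneracy of the residue pairing\<close>

text \<open>
  The Scheja-Storch argument, in a second set of variables \<open>z\<close> over the coefficient ring
  \<open>\<complex>[x]\<close>. Write \<open>h\<^sub>j(z) - h\<^sub>j(x) = \<Sum>\<^sub>k b\<^sub>j\<^sub>k (z\<^sub>k - x\<^sub>k)\<close>. Modulo \<open>h(x)\<close>, both \<open>A(z) b\<close> and the
  diagonal matrix of the \<open>(z\<^sub>i^M\<^sub>i - x\<^sub>i^M\<^sub>i)/(z\<^sub>i - x\<^sub>i)\<close> map the vector \<open>z - x\<close> to the vector of
  powers \<open>z\<^sub>i^M\<^sub>i\<close>, so they may be exchanged in the residue with respect to \<open>z\<close>. The second one
  reproduces \<open>\<phi>(x)\<close> from \<open>\<phi>(z)\<close>, the first one only involves residues of multiples of \<open>\<phi>\<close>.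
\<close>

type_synonym 'n mpoly2 = "('n \<Rightarrow>\<^sub>0 nat) \<Rightarrow>\<^sub>0 'n mpoly"

definition in_x :: "'n mpoly \<Rightarrow> 'n mpoly2" where
  "in_x p = single 0 p"

definition in_z :: "'n::finite mpoly \<Rightarrow> 'n mpoly2" where
  "in_z = evalp (\<lambda>c. in_x (cst c)) (\<lambda>i. monom_of (single i 1))"

lemma ring_morphism_in_x: "ring_morphism in_x"
  by (simp add: ring_morphism_def in_x_def single_add mult_single)

lemmas in_x_simps = ring_morphismD[OF ring_morphism_in_x]

lemma ring_morphism_in_x_cst: "ring_morphism (\<lambda>c. in_x (cst c))"
  by (simp add: in_x_simps cst_simps ring_morphism_def)

lemma ring_morphism_in_z: "ring_morphism in_z"
  unfolding in_z_def by (rule ring_morphism_evalp[OF ring_morphism_in_x_cst])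

lemmas in_z_simps = ring_morphismD[OF ring_morphism_in_z]

lemma in_z_single: "in_z (single m c) = single m (cst c)"
  unfolding in_z_def evalp_single[OF ring_morphism_in_x_cst] monom_of_eq_prod[symmetric]
  by (simp add: in_x_def monom_of_def mult_single)

lemma lookup_in_z: "lookup (in_z p) m = cst (lookup p m)"
proof (induction p rule: poly_mapping_single_induct)
  case (single k c)
  show ?case by (simp add: in_z_single lookup_single when_def cst_simps)
qed (simp_all add: in_z_simps lookup_add cst_simps)

lemma in_z_monom: "in_z (monom_of m) = monom_of m"
  by (simp add: monom_of_def in_z_single cst_simps)

definition z_minus_x :: "'n \<Rightarrow> 'n mpoly2" where
  "z_minus_x i = monom_of (single i 1) - in_x (var i)"

text \<open>The polynomials with this property form a ring that contains the constants and the
  variables in \<open>I\<close>. No explicit divided differences are required.\<close>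

lemma difference_in_ideal:
  fixes I :: "'n::finite set"
  assumes "p \<in> polys I"
  shows "\<exists>b. in_z p - in_x p = (\<Sum>k\<in>I. b k * z_minus_x k)"
proof -
  define Q where "Q p \<longleftrightarrow> (\<exists>b. in_z p - in_x p = (\<Sum>k\<in>I. b k * z_minus_x k))" for p :: "'n mpoly"
  have QI: "Q p" if "in_z p - in_x p = (\<Sum>k\<in>I. b k * z_minus_x k)" for p b
    using that by (auto simp: Q_def)
  have add: "Q (p + q)" if "Q p" "Q q" for p q
  proof -
    from that obtain b b' where "in_z p - in_x p = (\<Sum>k\<in>I. b k * z_minus_x k)"
      "in_z q - in_x q = (\<Sum>k\<in>I. b' k * z_minus_x k)" by (auto simp: Q_def)
    then have "in_z (p + q) - in_x (p + q) = (\<Sum>k\<in>I. (b k + b' k) * z_minus_x k)"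
      by (simp add: in_z_simps in_x_simps distrib_right sum.distrib algebra_simps)
    then show ?thesis by (rule QI)
  qed
  have mult: "Q (p * q)" if "Q p" "Q q" for p q
  proof -
    from that obtain b b' where b: "in_z p - in_x p = (\<Sum>k\<in>I. b k * z_minus_x k)"
      "in_z q - in_x q = (\<Sum>k\<in>I. b' k * z_minus_x k)" by (auto simp: Q_def)
    \<comment> \<open>The product rule for differences, with the mixed term q(x) p(z)
      inserted.\<close>
    have "in_z (p * q) - in_x (p * q) = in_x q * (in_z p - in_x p) + in_z p * (in_z q - in_x q)"
      by (simp add: in_z_simps in_x_simps algebra_simps)
    also have "\<dots> = (\<Sum>k\<in>I. (in_x q * b k + in_z p * b' k) * z_minus_x k)"
      by (simp add: b sum_distrib_left distrib_right sum.distrib mult.assoc)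
    finally show ?thesis by (rule QI)
  qed
  have const: "Q (cst c)" for c
  proof -
    have "in_z (cst c) = in_x (cst c)" by (simp add: cst_def in_z_single in_x_def)
    then show ?thesis by (auto simp: Q_def intro!: exI[of _ "\<lambda>_. 0"])
  qed
  have one: "Q 1" using const[of 1] by (simp add: cst_simps)
  have var: "Q (var i)" if i: "i \<in> I" for i
  proof -
    have "(\<Sum>k\<in>I. (if k = i then 1 else 0) * z_minus_x k)
        = (\<Sum>k\<in>I. if k = i then z_minus_x i else (0 :: 'n mpoly2))"
      by (rule sum.cong) auto
    also have "\<dots> = in_z (var i) - in_x (var i)"
      using i by (simp add: z_minus_x_def var_eq_monom in_z_monom)
    finally show ?thesis by (intro QI) (rule sym)
  qed
  have power: "Q (q ^ n)" if "Q q" for q n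
    using that by (induction n) (auto intro: one mult)
  have prod: "Q (\<Prod>i\<in>S. F i)" if "\<And>i. i \<in> S \<Longrightarrow> Q (F i)" for S :: "'n set" and F
    using that by (induction S rule: infinite_finite_induct) (auto intro: one mult)
  from assms have "Q p"
  proof (induction rule: polys_induct)
    case (single m c)
    have "Q (monom_of (single i 1) ^ lookup m i)" for i
    proof (cases "i \<in> I")
      case True
      then show ?thesis using power[OF var] by (simp add: var_eq_monom)
    next
      case False
      then have "lookup m i = 0" using single by (auto simp: in_keys_iff)
      then show ?thesis by (simp add: one)
    qed
    then have "Q (monom_of m)" unfolding monom_of_eq_prod[of m] by (intro prod)
    then have "Q (cst c * monom_of m)" by (intro mult const)
    then show ?case by (simp add: cst_def monom_of_def mult_single)
  qed (rule add)
  then show ?thesis by (simp add: Q_def)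
qed

text \<open>The quotient of z_i^(M i) - x_i^(M i) by z_i - x_i, written as a geometric sum.\<close>

definition power_quotient :: "('n \<Rightarrow> nat) \<Rightarrow> 'n \<Rightarrow> 'n mpoly2" where
  "power_quotient M i = (\<Sum>a<M i. single (single i a) (var i ^ (M i - Suc a)))"

lemma power_quotient_mult:
  fixes i :: 'n
  shows "power_quotient M i * z_minus_x i = monom_of (single i (M i)) - in_x (var i ^ M i)"
proof -
  let ?z = "monom_of (single i 1) :: 'n mpoly2" and ?x = "in_x (var i)"
  have "power_quotient M i = (\<Sum>a<M i. ?x ^ (M i - Suc a) * ?z ^ a)"
    unfolding power_quotient_def
    by (intro sum.cong) (simp_all add: in_x_simps(7)[symmetric] monom_of_power,
        simp_all add: in_x_def monom_of_def mult_single)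
  then have "power_quotient M i * z_minus_x i = ?z ^ M i - ?x ^ M i"
    by (simp add: power_diff_sumr2 z_minus_x_def mult.commute)
  then show ?thesis by (simp add: monom_of_power in_x_simps)
qed

text \<open>Each choice of one summand per factor yields a different monomial in z, so a single
  choice contributes. This is a reproducing kernel: for t the top exponent minus e, the coefficient
  is the monomial x^e.\<close>

lemma lookup_prod_power_quotient:
  fixes I :: "'n::finite set"
  assumes t: "\<And>i. i \<in> I \<Longrightarrow> lookup t i < M i" "keys t \<subseteq> I"
  shows "lookup (\<Prod>i\<in>I. power_quotient M i) t = (\<Prod>i\<in>I. var i ^ (M i - Suc (lookup t i)))"
proof -
  let ?G = "\<Pi>\<^sub>E i\<in>I. {..<M i}"
  define g0 where "g0 = (\<lambda>i\<in>I. lookup t i)"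
  have prod_single: "(\<Prod>i\<in>S. single (e i) (c i)) = single (\<Sum>i\<in>S. e i) (\<Prod>i\<in>S. c i)"
    if "finite S" for S and e :: "'n \<Rightarrow> 'n \<Rightarrow>\<^sub>0 nat" and c :: "'n \<Rightarrow> 'n mpoly"
    using that by (induction S rule: finite_induct) (simp_all add: mult_single)
  have "(\<Prod>i\<in>I. power_quotient M i)
      = (\<Sum>g\<in>?G. \<Prod>i\<in>I. single (single i (g i)) (var i ^ (M i - Suc (g i))))"
    unfolding power_quotient_def by (rule prod_sum_PiE) auto
  also have "\<dots> = (\<Sum>g\<in>?G. single (\<Sum>i\<in>I. single i (g i)) (\<Prod>i\<in>I. var i ^ (M i - Suc (g i))))"
    by (simp add: prod_single)
  finally have "lookup (\<Prod>i\<in>I. power_quotient M i) t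
      = (\<Sum>g\<in>?G. (\<Prod>i\<in>I. var i ^ (M i - Suc (g i))) when (\<Sum>i\<in>I. single i (g i)) = t)"
    by (simp add: lookup_sum lookup_single)
  also have "\<dots> = (\<Sum>g\<in>{g0}. (\<Prod>i\<in>I. var i ^ (M i - Suc (g i))))"
  proof (rule sum.mono_neutral_cong_right)
    show "finite ?G" by (intro finite_PiE) auto
    show "{g0} \<subseteq> ?G" using t by (auto simp: g0_def)
    have expo: "lookup (\<Sum>i\<in>I. single i (g i)) j = (if j \<in> I then g j else 0)" for g :: "'n \<Rightarrow> nat" and j
      by (simp add: lookup_sum lookup_single when_def)
    have "g = g0" if "g \<in> ?G" "(\<Sum>i\<in>I. single i (g i)) = t" for g
      using expo[of g] that by (auto simp: g0_def fun_eq_iff PiE_def extensional_def)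
    then show "\<forall>g\<in>?G - {g0}. ((\<Prod>i\<in>I. var i ^ (M i - Suc (g i)))
        when (\<Sum>i\<in>I. single i (g i)) = t) = (0 :: 'n mpoly)"
      by (auto simp: when_def)
    have "(\<Sum>i\<in>I. single i (g0 i)) = t"
      using t(2) by (intro poly_mapping_eqI) (auto simp: expo g0_def in_keys_iff)
    then show "((\<Prod>i\<in>I. var i ^ (M i - Suc (g i))) when (\<Sum>i\<in>I. single i (g i)) = t)
        = ((\<Prod>i\<in>I. var i ^ (M i - Suc (g i))) :: 'n mpoly)" if "g \<in> {g0}" for g
      using that by simp
  qed
  also have "\<dots> = (\<Prod>i\<in>I. var i ^ (M i - Suc (lookup t i)))"
    by (simp add: g0_def)
  finally show ?thesis .
qed

theorem groth_res_nondegenerate: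
  fixes I :: "'n::finite set"
  assumes data: "residue_data I h M A" and h: "\<And>j. j \<in> I \<Longrightarrow> h j \<in> polys I"
    and \<phi>: "\<phi> \<in> polys I"
    and zero: "\<And>m. keys m \<subseteq> I \<Longrightarrow> groth_res I h (\<phi> * monom_of m) = 0"
  shows "\<phi> \<in> gen_ideal I h"
proof -
  let ?J = "gen_ideal I h"
  let ?top = "top_exponent I M"
  have J: "is_ideal ?J" by (rule is_ideal_gen_ideal)
  let ?C = "small_ideal {} M ?J" and ?W = "small_ideal I M ?J"
  have C: "is_ideal ?C" and W: "is_ideal ?W" by (rule is_ideal_small_ideal[OF J])+
  have Mpos: "0 < M i" and A: "(\<Sum>j\<in>I. A i j * h j) = var i ^ M i" if "i \<in> I" for i
    using data that by (simp_all add: residue_data_def)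
  have in_x_C: "in_x p \<in> ?C" if "p \<in> ?J" for p
    using that is_idealD(1)[OF J] by (auto simp: small_ideal_def in_x_def lookup_single when_def)
  have h_J: "h j \<in> ?J" if "j \<in> I" for j using that by (simp add: gen_in_gen_ideal)
  have var_J: "var i ^ M i \<in> ?J" if "i \<in> I" for i
    unfolding A[OF that, symmetric] by (intro is_idealD(7)[OF J] is_idealD(3)[OF J] h_J)
  obtain b where b: "\<And>j. j \<in> I \<Longrightarrow> in_z (h j) - in_x (h j) = (\<Sum>k\<in>I. b j k * z_minus_x k)"
    using difference_in_ideal[OF h] by metis
  define B where "B = (\<lambda>i k. \<Sum>j\<in>I. in_z (A i j) * b j k)"
  define B' where "B' = (\<lambda>i k. if i = k then power_quotient M i else 0)"
  have "represents_powers I M ?J z_minus_x B"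
    unfolding represents_powers_def[OF J]
  proof
    fix i assume i: "i \<in> I"
    have "(\<Sum>k\<in>I. B i k * z_minus_x k) = (\<Sum>k\<in>I. \<Sum>j\<in>I. in_z (A i j) * (b j k * z_minus_x k))"
      by (simp add: B_def sum_distrib_right mult.assoc)
    also have "\<dots> = (\<Sum>j\<in>I. in_z (A i j) * (\<Sum>k\<in>I. b j k * z_minus_x k))"
      by (subst sum.swap) (simp add: sum_distrib_left)
    also have "\<dots> = (\<Sum>j\<in>I. in_z (A i j * h j)) - (\<Sum>j\<in>I. in_z (A i j) * in_x (h j))"
      by (simp add: b[symmetric] right_diff_distrib sum_subtractf in_z_simps)
    also have "(\<Sum>j\<in>I. in_z (A i j * h j)) = monom_of (single i (M i))"
      by (simp add: in_z_simps(8)[symmetric] A[OF i] var_power in_z_monom)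
    finally have "monom_of (single i (M i)) - (\<Sum>k\<in>I. B i k * z_minus_x k)
        = (\<Sum>j\<in>I. in_z (A i j) * in_x (h j))" by simp
    also have "\<dots> \<in> ?C" by (intro is_idealD(7)[OF C] is_idealD(3)[OF C] in_x_C h_J)
    finally show "monom_of (single i (M i)) - (\<Sum>k\<in>I. B i k * z_minus_x k) \<in> ?C" .
  qed
  moreover have "represents_powers I M ?J z_minus_x B'"
    unfolding represents_powers_def[OF J]
  proof
    fix i assume i: "i \<in> I"
    have "(\<Sum>k\<in>I. B' i k * z_minus_x k)
        = (\<Sum>k\<in>I. if k = i then power_quotient M i * z_minus_x i else 0)"
      by (rule sum.cong) (auto simp: B'_def)
    also have "\<dots> = monom_of (single i (M i)) - in_x (var i ^ M i)"
      using i by (simp add: power_quotient_mult)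
    finally show "monom_of (single i (M i)) - (\<Sum>k\<in>I. B' i k * z_minus_x k) \<in> ?C"
      using in_x_C[OF var_J[OF i]] by simp
  qed
  ultimately have "(det_on I B - det_on I B') * in_z \<phi> \<in> ?W"
    by (intro is_idealD(4)[OF W] det_independent[OF J])
  then have "lookup ((det_on I B - det_on I B') * in_z \<phi>) ?top \<in> ?J"
    by (rule small_ideal_top_coeff) (rule Mpos)
  then have diff: "lookup (det_on I B * in_z \<phi>) ?top - lookup (det_on I B' * in_z \<phi>) ?top \<in> ?J"
    by (simp add: left_diff_distrib lookup_minus)

  \<comment> \<open>\<open>F\<close> is a C[x]-combination of monomials in z. Those in the variables
    of \<open>I\<close> are covered by the assumption \<open>zero\<close>; a monomial with another
    variable cannot reach the top exponent.\<close>
  have "lookup (in_z (det_on I A * \<phi>) * F) ?top = 0" for F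
  proof (induction F rule: poly_mapping_single_induct)
    case (single m c)
    have "in_z (det_on I A * \<phi>) * single m c = in_z (det_on I A * (\<phi> * monom_of m)) * single 0 c"
      by (simp add: in_z_simps(3) in_z_monom mult.assoc)
        (simp add: monom_of_def mult_single)
    then have "lookup (in_z (det_on I A * \<phi>) * single m c) ?top
        = cst (lookup (det_on I A * (\<phi> * monom_of m)) ?top) * c"
      by (simp add: lookup_mult_const lookup_in_z)
    also have "lookup (det_on I A * (\<phi> * monom_of m)) ?top = 0"
    proof (cases "keys m \<subseteq> I")
      case True
      then show ?thesis using zero groth_res_eq[OF data] by simp
    next
      case False
      have "keys ?top \<subseteq> I" by (auto simp: in_keys_iff lookup_top_exponent split: if_splits)
      with False have "?top \<noteq> m' + m" for m' by (metis keys_exponent_add le_sup_iff)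
      then show ?thesis
        using lookup_mult_single_nonzero[of "det_on I A * \<phi>" m 1 ?top]
        by (metis monom_of_def mult.assoc)
    qed
    finally show ?case by (simp add: cst_simps)
  qed (simp_all add: distrib_left lookup_add)
  \<comment> \<open>\<open>B\<close> is the product of A(z) and b, so its determinant is a multiple
    of that of A(z).\<close>
  moreover have "det_on I B * in_z \<phi> = in_z (det_on I A * \<phi>) * det_on I b"
    unfolding B_def det_on_mult det_on_morphism[OF ring_morphism_in_z, symmetric]
    by (simp add: in_z_simps mult_ac)
  ultimately have zero': "lookup (det_on I B * in_z \<phi>) ?top = 0" by metis

  \<comment> \<open>The reproducing property, checked on monomials: if all exponents stay below
    \<open>M\<close>, the coefficient is the monomial itself; otherwise it is zero and the monomial
    lies in the ideal anyway.\<close>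
  have "lookup (det_on I B' * in_z \<phi>) ?top - \<phi> \<in> ?J"
    using \<phi>
  proof (induction rule: polys_induct)
    case (single e c)
    have det: "det_on I B' * in_z (single e c) = (\<Prod>i\<in>I. power_quotient M i) * single e (cst c)"
      by (simp add: B'_def det_on_diagonal in_z_single)
    show ?case
    proof (cases "\<forall>i\<in>I. lookup e i < M i")
      case True
      \<comment> \<open>The complementary exponent. The off-by-one terms cancel, since
        \<open>M i - Suc (M i - Suc a) = a\<close> for \<open>a < M i\<close>.\<close>
      define t where "t = ?top - e"
      have t: "lookup t i = M i - Suc (lookup e i)" if "i \<in> I" for i
        using that by (simp add: t_def lookup_minus lookup_top_exponent)
      have t0: "lookup t i = 0" if "i \<notin> I" for i
        using that by (simp add: t_def lookup_minus lookup_top_exponent)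
      have e0: "lookup e i = 0" if "i \<notin> I" for i
        using that single by (auto simp: in_keys_iff)
      have lt: "lookup e i < M i" if "i \<in> I" for i using True that by blast
      have "?top = t + e"
      proof (rule poly_mapping_eqI)
        fix i show "lookup ?top i = lookup (t + e) i"
          using t[of i] t0[of i] e0[of i] lt[of i]
          by (cases "i \<in> I") (simp_all add: lookup_add lookup_top_exponent)
      qed
      then have "lookup (det_on I B' * in_z (single e c)) ?top
          = lookup (\<Prod>i\<in>I. power_quotient M i) t * cst c"
        by (simp add: det lookup_mult_single)
      also have "lookup (\<Prod>i\<in>I. power_quotient M i) t
          = (\<Prod>i\<in>I. var i ^ (M i - Suc (lookup t i)))"
        using t lt t0 by (intro lookup_prod_power_quotient) (force simp: in_keys_iff)+
      also have "\<dots> = (\<Prod>i\<in>I. var i ^ lookup e i)"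
      proof (intro prod.cong refl arg_cong2[of _ _ _ _ "(^)"])
        fix i assume "i \<in> I"
        then show "M i - Suc (lookup t i) = lookup e i" using t[of i] lt[of i] by simp
      qed
      also have "\<dots> = (\<Prod>i\<in>UNIV. monom_of (single i 1) ^ lookup e i)"
        using e0 by (intro prod.mono_neutral_cong_left) (auto simp: var_eq_monom)
      also have "\<dots> * cst c = single e c"
        unfolding monom_of_eq_prod[symmetric] by (simp add: cst_def monom_of_def mult_single)
      finally show ?thesis using is_idealD(1)[OF J] by simp
    next
      case False
      then obtain i where i: "i \<in> I" "M i \<le> lookup e i" by (meson not_le)
      have "lookup ?top i < lookup e i" using i Mpos[of i] by (simp add: lookup_top_exponent)
      then have "?top \<noteq> m' + e" for m' by (metis lookup_add add.commute le_add1 not_le)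
      then have "lookup (det_on I B' * in_z (single e c)) ?top = 0"
        unfolding det using lookup_mult_single_nonzero by metis
      moreover have "single e c = single (e - single i (M i)) c * var i ^ M i"
      proof -
        have "e = (e - single i (M i)) + single i (M i)"
          using i by (intro poly_mapping_eqI) (auto simp: lookup_add lookup_minus lookup_single when_def)
        then show ?thesis by (simp add: var_power monom_of_def mult_single)
      qed
      ultimately show ?thesis
        using is_idealD(3)[OF J var_J[OF i(1)]] is_idealD(5)[OF J] by simp
    qed
  next
    case (add p q)
    from is_idealD(2)[OF J this] show ?case
      by (simp add: in_z_simps distrib_left lookup_add algebra_simps)
  qed
  from is_idealD(2)[OF J diff this] zero' have "- \<phi> \<in> ?J" by simp
  from is_idealD(5)[OF J this] show ?thesis by simp
qed


section \<open>Jacobian ideals of weighted homogeneous polynomials\<close>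

text \<open>Makes the minimality of \<open>genideal\<close> applicable, so that equality of classes
  in \<open>Jac f\<close> yields an explicit combination of the derivatives.\<close>

lemma ideal_gen_ideal: "ideal (gen_ideal I h) ring_of_type_algebra"
proof (rule idealI)
  let ?R = "ring_of_type_algebra :: 'a mpoly ring"
  show R: "ring ?R" by (rule ring_from_type_algebra)
  note J = is_idealD[OF is_ideal_gen_ideal[of I h]]
  have inv: "inv\<^bsub>add_monoid ?R\<^esub> a = - a" for a
    using abelian_group.minus_equality[OF ring.is_abelian_group[OF R], of "- a" a]
    by (simp add: ring_of_type_algebra_def a_inv_def)
  show "subgroup (gen_ideal I h) (add_monoid ?R)"
    unfolding subgroup_def inv using J(1,2,5) by (simp add: ring_of_type_algebra_def)
qed (auto simp: ring_of_type_algebra_def is_idealD[OF is_ideal_gen_ideal])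

lemma jac_ideal_subset: "jac_ideal f \<subseteq> gen_ideal UNIV (\<lambda>i. pd i f)" for f :: "'n::finite mpoly"
  unfolding jac_ideal_def genideal_def
  by (intro Inter_lower)
    (auto simp: ideal_gen_ideal intro: gen_in_gen_ideal[where h = "\<lambda>i. pd i f"])

lemma jac_class_eqD:
  fixes f :: "'n::finite mpoly"
  assumes "jac_class f p = jac_class f q"
  shows "p - q \<in> gen_ideal UNIV (\<lambda>i. pd i f)"
proof -
  have "0 \<in> jac_ideal f"
    unfolding jac_ideal_def genideal_def
    by (auto dest!: ideal.axioms(1) additive_subgroup.zero_closed simp: ring_of_type_algebra_def)
  then have "p \<in> jac_class f p"
    by (auto simp: a_r_coset_def r_coset_def ring_of_type_algebra_def)
  then have "p \<in> jac_class f q" using assms by simp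
  then obtain j where "j \<in> jac_ideal f" "p = j + q"
    by (auto simp: a_r_coset_def r_coset_def ring_of_type_algebra_def)
  then show ?thesis using jac_ideal_subset by auto
qed

text \<open>Gaussian elimination, one coordinate \<open>b\<close> at a time: a vector
  \<open>k0\<close> with non-zero entry at \<open>b\<close> serves as pivot and is removed from the
  family.\<close>

lemma nontrivial_linear_relation:
  fixes c :: "'k \<Rightarrow> 'b \<Rightarrow> 'c::field"
  assumes "finite B" "finite K" "card B < card K"
  shows "\<exists>d. (\<exists>k\<in>K. d k \<noteq> 0) \<and> (\<forall>b\<in>B. (\<Sum>k\<in>K. d k * c k b) = 0)"
  using assms
proof (induction B arbitrary: K c rule: finite_induct)
  case empty
  then obtain k where "k \<in> K" by fastforce
  then show ?case by (auto intro!: exI[of _ "\<lambda>_. 1"])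
next
  case (insert b B)
  show ?case
  proof (cases "\<forall>k\<in>K. c k b = 0")
    case True
    have "card B < card K" using insert by simp
    from insert.IH[OF insert.prems(1) this, of c] True show ?thesis by auto
  next
    case False
    then obtain k0 where k0: "k0 \<in> K" "c k0 b \<noteq> 0" by blast
    let ?K = "K - {k0}"
    define c' where "c' k b' = c k b' - c k b / c k0 b * c k0 b'" for k b'
    have "card B < card ?K" using insert k0 by simp
    from insert.IH[OF _ this, of c'] insert.prems(1)
    obtain d where d: "\<exists>k\<in>?K. d k \<noteq> 0" "\<forall>b'\<in>B. (\<Sum>k\<in>?K. d k * c' k b') = 0" by auto
    \<comment> \<open>The coefficient of the pivot is forced by the equation at coordinate
      \<open>b\<close>.\<close>
    define e where "e = (\<Sum>k\<in>?K. d k * c k b) / c k0 b"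
    define d' where "d' = d(k0 := - e)"
    have sum: "(\<Sum>k\<in>K. d' k * c k b') = (\<Sum>k\<in>?K. d k * c k b') - e * c k0 b'" for b'
      using k0 insert.prems(1) by (simp add: sum.remove[of K k0] d'_def)
    have "(\<Sum>k\<in>?K. d k * c' k b') = (\<Sum>k\<in>?K. d k * c k b') - e * c k0 b'" for b'
      by (simp add: c'_def e_def right_diff_distrib sum_subtractf sum_divide_distrib
          sum_distrib_right mult.assoc)
    then have "(\<Sum>k\<in>K. d' k * c k b') = 0" if "b' \<in> B" for b'
      using d(2) that by (simp add: sum)
    moreover have "(\<Sum>k\<in>K. d' k * c k b) = 0"
      using k0 by (simp add: sum e_def)
    moreover have "\<exists>k\<in>K. d' k \<noteq> 0" using d(1) by (auto simp: d'_def)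
    ultimately show ?thesis by (intro exI[of _ d']) auto
  qed
qed

text \<open>The powers of a variable are eigenvectors of a diagonal automorphism, so a relation between
  them can be shortened to a single term.\<close>

lemma power_in_stable_ideal:
  fixes J :: "'n::finite mpoly set"
  assumes J: "is_ideal J" and stable: "\<And>p. p \<in> J \<Longrightarrow> diag_aut g p \<in> J"
    and g: "inj (\<lambda>k. g i ^ k)"
    and K: "finite K" "K \<noteq> {}" "\<And>k. k \<in> K \<Longrightarrow> d k \<noteq> 0"
    and rel: "(\<Sum>k\<in>K. cst (d k) * var i ^ k) \<in> J"
  shows "\<exists>k\<in>K. var i ^ k \<in> J"
  using K rel
proof (induction K arbitrary: d rule: finite_ne_induct)
  case (singleton k)
  then have "cst (inverse (d k)) * (cst (d k) * var i ^ k) \<in> J"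
    using is_idealD(3)[OF J] by simp
  also have "cst (inverse (d k)) * (cst (d k) * var i ^ k) = var i ^ k"
    unfolding mult.assoc[symmetric] cst_simps(3)[symmetric] using singleton(1)[of k]
    by (simp add: cst_simps(1))
  finally show ?case by simp
next
  case (insert k0 K)
  let ?P = "\<Sum>k\<in>insert k0 K. cst (d k) * var i ^ k"
  \<comment> \<open>Subtracting the eigenvalue of x_i^k0 removes this term; the eigenvalues are
    distinct, so the other coefficients stay non-zero.\<close>
  have "diag_aut g ?P - cst (g i ^ k0) * ?P \<in> J"
    using insert.prems(2) by (intro is_idealD(6)[OF J] stable is_idealD(3)[OF J])
  also have "diag_aut g ?P - cst (g i ^ k0) * ?P
      = (\<Sum>k\<in>insert k0 K. cst (d k * (g i ^ k - g i ^ k0)) * var i ^ k)"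
    unfolding diag_aut_simps(8) sum_distrib_left sum_subtractf[symmetric]
    by (intro sum.cong)
      (simp_all add: diag_aut_simps diag_aut_var cst_simps power_mult_distrib algebra_simps)
  also have "\<dots> = (\<Sum>k\<in>K. cst (d k * (g i ^ k - g i ^ k0)) * var i ^ k)"
    using insert.hyps by (simp add: cst_simps)
  finally have "(\<Sum>k\<in>K. cst (d k * (g i ^ k - g i ^ k0)) * var i ^ k) \<in> J" .
  moreover have "d k * (g i ^ k - g i ^ k0) \<noteq> 0" if "k \<in> K" for k
    using insert.prems(1)[of k] insert.hyps that injD[OF g, of k k0] by auto
  ultimately have "\<exists>k\<in>K. var i ^ k \<in> J" by (rule insert.IH[rotated])
  then show ?case by blast
qed

section \<open>Powers of the variables in the Jacobian ideal, and passage to the fixed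
  subspaces\<close>

lemma diag_aut_pd:
  assumes "diag_aut g f = cst e * f"
  shows "cst (g j) * diag_aut g (pd j f) = cst e * pd j f"
  by (metis assms pd_cst_mult pd_diag_aut)

text \<open>By finite dimension the powers of x_i are linearly dependent modulo the ideal. The
  weight action preserves the ideal and has distinct eigenvalues on these powers, so one of them
  lies in it.\<close>

lemma var_power_in_jacobian_ideal:
  fixes f :: "'n::finite mpoly"
  assumes "weighted_homogeneous f" "nondegenerate f"
  shows "\<exists>k>0. var i ^ k \<in> gen_ideal UNIV (\<lambda>i. pd i f)"
proof -
  let ?J = "gen_ideal UNIV (\<lambda>i. pd i f)"
  have J: "is_ideal ?J" by (rule is_ideal_gen_ideal)
  obtain w :: "'n \<Rightarrow> nat" and e :: nat where w: "\<And>i. 0 < w i"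
    and we: "\<And>c. c \<noteq> 0 \<Longrightarrow> msubst (\<lambda>i. cst (c ^ w i) * var i) f = cst (c ^ e) * f"
    using assms(1) unfolding weighted_homogeneous_def by blast
  \<comment> \<open>The weight action at c = 2; the eigenvalues \<open>2 ^ (w i * k)\<close> of the
    powers of x_i are distinct because \<open>w i\<close> is positive.\<close>
  define g :: "'n \<Rightarrow> complex" where "g = (\<lambda>i. 2 ^ w i)"
  have "diag_aut g f = cst (2 ^ e) * f"
    using we[of 2] by (simp add: diag_aut_def g_def)
  note pd = diag_aut_pd[OF this]
  have "diag_aut g (pd j f) = cst (inverse (g j)) * (cst (2 ^ e) * pd j f)" for j
    unfolding pd[symmetric] mult.assoc[symmetric] cst_simps(3)[symmetric]
    by (simp add: g_def cst_simps(1))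
  then have pd_J: "diag_aut g (pd j f) \<in> ?J" for j
    by (simp only:) (intro is_idealD(3)[OF J] gen_in_gen_ideal[where h = "\<lambda>i. pd i f"] finite UNIV_I)
  have stable: "diag_aut g p \<in> ?J" if p: "p \<in> ?J" for p
  proof -
    obtain a where "p = (\<Sum>j\<in>UNIV. a j * pd j f)" using p by (auto simp: gen_ideal_def)
    then have "diag_aut g p = (\<Sum>j\<in>UNIV. diag_aut g (a j) * diag_aut g (pd j f))"
      by (simp add: diag_aut_simps)
    also have "\<dots> \<in> ?J" by (intro is_idealD(7)[OF J] is_idealD(3)[OF J] pd_J)
    finally show ?thesis .
  qed
  have inj: "inj (\<lambda>k. g i ^ k)"
  proof (rule injI)
    fix k k' :: nat assume "g i ^ k = g i ^ k'"
    then have "(2::complex) ^ (w i * k) = 2 ^ (w i * k')" by (simp add: g_def power_mult)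
    then have "(2::real) ^ (w i * k) = 2 ^ (w i * k')"
      by (metis norm_numeral norm_power)
    then show "k = k'" using w[of i] by simp
  qed
  obtain B where B: "finite B" "\<And>p. \<exists>c. jac_class f p = jac_class f (\<Sum>b\<in>B. cst (c b) * b)"
    using assms(2) unfolding nondegenerate_def by blast
  have "\<forall>k::nat. \<exists>c. jac_class f (var i ^ k) = jac_class f (\<Sum>b\<in>B. cst (c b) * b)"
    using B(2) by blast
  from choice[OF this] obtain c :: "nat \<Rightarrow> 'n mpoly \<Rightarrow> complex"
    where ck: "\<forall>k. jac_class f (var i ^ k) = jac_class f (\<Sum>b\<in>B. cst (c k b) * b)" ..
  have c: "var i ^ k - (\<Sum>b\<in>B. cst (c k b) * b) \<in> ?J" for k
    by (rule jac_class_eqD[OF spec[OF ck]])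
  \<comment> \<open>\<open>{..card B}\<close> has one element more than the spanning set.\<close>
  obtain d where d: "\<exists>k\<in>{..card B}. d k \<noteq> 0" "\<forall>b\<in>B. (\<Sum>k\<in>{..card B}. d k * c k b) = 0"
    using nontrivial_linear_relation[OF B(1), of "{..card B}" c] by auto
  have "(\<Sum>k\<in>{..card B}. cst (d k) * (var i ^ k - (\<Sum>b\<in>B. cst (c k b) * b))) \<in> ?J"
    by (intro is_idealD(7)[OF J] is_idealD(3)[OF J] c)
  also have "(\<Sum>k\<in>{..card B}. cst (d k) * (var i ^ k - (\<Sum>b\<in>B. cst (c k b) * b)))
      = (\<Sum>k\<in>{..card B}. cst (d k) * var i ^ k)
        - (\<Sum>b\<in>B. \<Sum>k\<in>{..card B}. cst (d k) * (cst (c k b) * b))"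
    by (subst sum.swap) (simp add: right_diff_distrib sum_subtractf sum_distrib_left)
  also have "(\<Sum>b\<in>B. \<Sum>k\<in>{..card B}. cst (d k) * (cst (c k b) * b))
      = (\<Sum>b\<in>B. cst (\<Sum>k\<in>{..card B}. d k * c k b) * b)"
    by (simp add: cst_simps sum_distrib_right mult.assoc)
  also have "\<dots> = 0" using d(2) by (simp add: cst_simps(4))
  also have "(\<Sum>k\<in>{..card B}. cst (d k) * var i ^ k) - 0
      = (\<Sum>k | k \<le> card B \<and> d k \<noteq> 0. cst (d k) * var i ^ k)"
    by (simp, rule sum.mono_neutral_right) (auto simp: cst_simps(4))
  finally have "\<exists>k\<in>{k. k \<le> card B \<and> d k \<noteq> 0}. var i ^ k \<in> ?J"
    using d(1) by (intro power_in_stable_ideal[OF J stable inj]) auto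
  then obtain k where "var i ^ k \<in> ?J" by blast
  \<comment> \<open>The exponent found may be 0, while residue data require positive
    exponents.\<close>
  then have "var i ^ Suc k \<in> ?J" using is_idealD(3)[OF J] by simp
  then show ?thesis by blast
qed

text \<open>By invariance of f, all monomials of its j-th derivative have g-weight 1 / g_j \<noteq>
  1, whereas a monomial in the fixed coordinates has weight 1.\<close>

lemma restrict_poly_pd_moved:
  assumes "g \<in> diag_symmetries f" "j \<notin> fix_coords g"
  shows "restrict_poly (fix_coords g) (pd j f) = 0"
proof (rule poly_mapping_eqI)
  fix m
  have "diag_aut g f = cst 1 * f" using assms(1) by (simp add: diag_symmetries_def cst_simps(1))
  from diag_aut_pd[OF this, of j]
  have "lookup (cst (g j) * diag_aut g (pd j f)) m = lookup (pd j f) m"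
    by (simp add: cst_simps(1))
  then have eq: "g j * (character g m * lookup (pd j f) m) = lookup (pd j f) m"
    by (simp only: lookup_cst_mult lookup_diag_aut)
  have "character g m = 1" if "keys m \<subseteq> fix_coords g"
    unfolding character_def
  proof (rule prod.neutral, rule ballI)
    fix i
    show "g i ^ lookup m i = 1"
      using that by (cases "lookup m i = 0") (auto simp: in_keys_iff fix_coords_def subset_iff)
  qed
  then show "lookup (restrict_poly (fix_coords g) (pd j f)) m = lookup 0 m"
    using eq assms(2) by (auto simp: lookup_restrict_poly fix_coords_def)
qed

text \<open>The relations that express powers of the variables through the derivatives of f are
  restricted to Fix(g), where the derivatives in moved directions drop out.\<close>

lemma residue_data_exists:
  fixes f :: "'n::finite mpoly"
  assumes "weighted_homogeneous f" "nondegenerate f" "g \<in> diag_symmetries f"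
  shows "\<exists>M A. residue_data (fix_coords g) (\<lambda>j. pd j (restrict_fix f g)) M A"
proof -
  let ?I = "fix_coords g"
  have "\<exists>k a. 0 < k \<and> var i ^ k = (\<Sum>j\<in>UNIV. a j * pd j f)" for i
    using var_power_in_jacobian_ideal[OF assms(1,2), of i] by (auto simp: gen_ideal_def)
  then obtain M a where Ma: "\<And>i. 0 < M i" "\<And>i. var i ^ M i = (\<Sum>j\<in>UNIV. a i j * pd j f)"
    by metis
  have "residue_data ?I (\<lambda>j. pd j (restrict_fix f g)) M (\<lambda>i j. restrict_poly ?I (a i j))"
    unfolding residue_data_def
  proof (intro conjI ballI)
    fix i assume i: "i \<in> ?I"
    then have "var i ^ M i = restrict_poly ?I (var i ^ M i)"
      by (simp add: restrict_poly_simps restrict_poly_var)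
    also have "\<dots> = (\<Sum>j\<in>UNIV. restrict_poly ?I (a i j) * restrict_poly ?I (pd j f))"
      by (simp add: Ma(2) restrict_poly_simps)
    also have "\<dots> = (\<Sum>j\<in>?I. restrict_poly ?I (a i j) * pd j (restrict_fix f g))"
      by (rule sum.mono_neutral_cong_right)
        (auto simp: restrict_poly_pd_moved[OF assms(3)] restrict_fix_def pd_restrict_poly)
    finally show "var i ^ M i = (\<Sum>j\<in>?I. restrict_poly ?I (a i j) * pd j (restrict_fix f g))" .
  qed (simp_all add: Ma(1))
  then show ?thesis by blast
qed


section \<open>Finiteness of the group of diagonal symmetries\<close>

lemma rat_common_denominator:
  fixes r :: "'i::finite \<Rightarrow> rat"
  obtains D :: int and n :: "'i \<Rightarrow> int" where "0 < D" "\<And>i. of_int D * r i = of_int (n i)"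
proof -
  define d where "d i = snd (quotient_of (r i))" for i
  define D where "D = (\<Prod>i\<in>UNIV. d i)"
  have pos: "0 < d i" for i by (simp add: d_def quotient_of_denom_pos')
  have "of_int (d i) * r i = of_int (fst (quotient_of (r i)))" for i
    using quotient_of_div[of "r i" "fst (quotient_of (r i))" "d i"] pos[of i]
    by (simp add: d_def field_simps)
  moreover have "D = (\<Prod>j\<in>UNIV - {i}. d j) * d i" for i
    by (simp add: D_def prod.remove[of UNIV i] mult.commute)
  ultimately have "of_int D * r i = of_int ((\<Prod>j\<in>UNIV - {i}. d j) * fst (quotient_of (r i)))" for i
    by (metis (no_types, lifting) mult.assoc of_int_mult)
  moreover have "0 < D" using pos by (simp add: D_def prod_pos)
  ultimately show thesis using that[of D "\<lambda>i. (\<Prod>j\<in>UNIV - {i}. d j) * fst (quotient_of (r i))"] by blast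
qed

text \<open>A symmetry fixes every monomial of f. Since the exponent matrix is invertible over the
  rationals, each g_k is then a root of unity of an order bounded independently of g.\<close>

lemma finite_diag_symmetries:
  fixes f :: "'n::finite mpoly"
  assumes "invertible_polynomial f"
  shows "finite (diag_symmetries f)"
proof -
  obtain c E where c: "\<And>i. c i \<noteq> 0"
    and f: "f = (\<Sum>i\<in>UNIV. cst (c i) * (\<Prod>j\<in>UNIV. var j ^ E i j))"
    and inv: "invertible ((\<chi> i j. of_nat (E i j)) :: rat ^ 'n ^ 'n)"
    using assms unfolding invertible_polynomial_def by blast
  let ?E = "(\<chi> i j. of_nat (E i j)) :: rat ^ 'n ^ 'n"
  obtain E' where E': "?E ** E' = mat 1" "E' ** ?E = mat 1"
    using inv unfolding invertible_def by blast
  define e where "e i = (\<Sum>j\<in>UNIV. single j (E i j))" for i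
  have lookup_e: "lookup (e i) j = E i j" for i j
    by (simp add: e_def lookup_sum lookup_single when_def)
  \<comment> \<open>The rows of an invertible matrix are distinct, so no two monomials of f merge
    and each keeps its non-zero coefficient.\<close>
  have inj_e: "i = i'" if "e i = e i'" for i i'
  proof -
    have "E i j = E i' j" for j using that lookup_e by metis
    then have "(?E ** E') $ i = (?E ** E') $ i'"
      by (simp add: vec_eq_iff matrix_matrix_mult_def)
    then have "mat 1 $ i $ i = (mat 1 :: rat ^ 'n ^ 'n) $ i' $ i" by (simp add: E'(1))
    then show ?thesis by (simp add: mat_def split: if_splits)
  qed
  have "f = (\<Sum>i\<in>UNIV. single (e i) (c i))"
    unfolding f e_def single_eq_const_monom[of "sum _ _"]
    by (simp add: monom_of_sum var_power cst_def)
  then have lookup_f: "lookup f (e i) = c i" for i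
  proof -
    assume f: "f = (\<Sum>i\<in>UNIV. single (e i) (c i))"
    have "lookup f (e i) = (\<Sum>j\<in>UNIV. if j = i then c i else 0)"
      unfolding f lookup_sum lookup_single when_def using inj_e by (intro sum.cong) auto
    then show ?thesis by simp
  qed
  have char: "character g (e i) = 1" if "g \<in> diag_symmetries f" for g i
  proof -
    have "lookup (diag_aut g f) (e i) = lookup f (e i)" using that by (simp add: diag_symmetries_def)
    then show ?thesis using c[of i] by (simp add: lookup_diag_aut lookup_f)
  qed
  have "\<exists>D>0. \<forall>g\<in>diag_symmetries f. g k ^ D = 1" for k
  proof -
    \<comment> \<open>Clearing denominators in row k of the inverse gives an integral combination of
      the exponent vectors equal to D times the k-th unit vector; raising the relations g^(e i) = 1
      to these powers gives g_k^D = 1.\<close>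
    obtain D :: int and n where D: "0 < D" "\<And>i. of_int D * E' $ k $ i = of_int (n i)"
      using rat_common_denominator[of "\<lambda>i. E' $ k $ i"] by metis
    have n: "(\<Sum>i\<in>UNIV. n i * int (E i j)) = (if j = k then D else 0)" for j
    proof -
      have "of_int (\<Sum>i\<in>UNIV. n i * int (E i j)) = of_int D * (E' ** ?E) $ k $ j"
        by (simp add: D(2)[symmetric] matrix_matrix_mult_def sum_distrib_left mult.assoc)
      also have "\<dots> = of_int (if j = k then D else 0)"
        by (simp add: E'(2) mat_def)
      finally show ?thesis by (simp only: of_int_eq_iff)
    qed
    have "g k ^ nat D = 1" if g: "g \<in> diag_symmetries f" for g
    proof -
      have nz: "g j \<noteq> 0" for j using g by (simp add: diag_symmetries_def torus_def)
      have prod_powi: "(\<Prod>i\<in>S. x powi F i) = x powi (\<Sum>i\<in>S. F i)" if "x \<noteq> 0" "finite S"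
        for x :: complex and F :: "'n \<Rightarrow> int" and S
        using that(2,1) by (induction S rule: finite_induct) (simp_all add: power_int_add)
      have powi_prod: "(\<Prod>j\<in>S. F j) powi z = (\<Prod>j\<in>S. F j powi z)" if "finite S"
        for F :: "'n \<Rightarrow> complex" and S and z :: int
        using that by (induction S rule: finite_induct) (simp_all add: power_int_mult_distrib)
      have "1 = (\<Prod>i\<in>UNIV. character g (e i) powi n i)" by (simp add: char[OF g])
      also have "\<dots> = (\<Prod>i\<in>UNIV. \<Prod>j\<in>UNIV. g j powi (n i * int (E i j)))"
        by (intro prod.cong refl)
          (simp add: character_def lookup_e powi_prod power_int_mult mult.commute[of "n _"])
      also have "\<dots> = (\<Prod>j\<in>UNIV. g j powi (\<Sum>i\<in>UNIV. n i * int (E i j)))"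
        by (subst prod.swap) (simp add: prod_powi nz)
      also have "\<dots> = (\<Prod>j\<in>UNIV. if j = k then g k powi D else 1)"
        by (intro prod.cong) (auto simp: n)
      also have "\<dots> = g k ^ nat D" using D(1) by (simp add: power_int_def)
      finally show ?thesis by simp
    qed
    then show ?thesis using D(1) by (intro exI[of _ "nat D"]) auto
  qed
  then obtain D where D: "\<And>k. 0 < D k" "\<And>k g. g \<in> diag_symmetries f \<Longrightarrow> g k ^ D k = 1" by metis
  have "diag_symmetries f \<subseteq> (\<Pi>\<^sub>E k\<in>UNIV. {z. z ^ D k = 1})"
    using D(2) by auto
  moreover have "finite (\<Pi>\<^sub>E k\<in>(UNIV::'n set). {z::complex. z ^ D k = 1})"
    using D(1) by (intro finite_PiE finite_roots_unity) (auto simp: Suc_leI One_nat_def)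
  ultimately show ?thesis by (rule finite_subset)
qed


section \<open>Coordinates on the module of forms\<close>

abbreviation fix_grad :: "'n::finite mpoly \<Rightarrow> ('n \<Rightarrow> complex) \<Rightarrow> 'n \<Rightarrow> 'n mpoly" where
  "fix_grad f g \<equiv> (\<lambda>j. pd j (restrict_fix f g))"

text \<open>The Jacobian ideal of f^g in the coordinate ring of Fix(g), realised inside the full
  polynomial ring.\<close>

definition fix_ideal :: "'n::finite mpoly \<Rightarrow> ('n \<Rightarrow> complex) \<Rightarrow> 'n mpoly set" where
  "fix_ideal f g = polys (fix_coords g) \<inter> gen_ideal (fix_coords g) (fix_grad f g)"

lemma fix_grad_polys: "fix_grad f g j \<in> polys (fix_coords g)"
  by (intro pd_polys) (simp add: restrict_fix_def)

text \<open>Restriction to Fix(g) is a retraction that leaves both \<open>p\<close> and the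
  derivatives of f^g unchanged, so it may be applied to the coefficients.\<close>

lemma fix_idealE:
  assumes "p \<in> fix_ideal f g"
  obtains a where "\<And>i. a i \<in> polys (fix_coords g)" "p = (\<Sum>i\<in>fix_coords g. a i * fix_grad f g i)"
proof -
  let ?I = "fix_coords g"
  obtain a where a: "p = (\<Sum>i\<in>?I. a i * fix_grad f g i)"
    using assms by (auto simp: fix_ideal_def gen_ideal_def)
  have "p = restrict_poly ?I p" using assms by (simp add: fix_ideal_def restrict_poly_id)
  also have "\<dots> = (\<Sum>i\<in>?I. restrict_poly ?I (a i) * fix_grad f g i)"
    unfolding a by (simp add: restrict_poly_simps restrict_poly_id[OF fix_grad_polys])
  finally show thesis using that[of "\<lambda>i. restrict_poly ?I (a i)"] by simp
qed

lemma fix_ideal_closed: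
  "0 \<in> fix_ideal f g"
  "p \<in> fix_ideal f g \<Longrightarrow> q \<in> fix_ideal f g \<Longrightarrow> p + q \<in> fix_ideal f g"
  "p \<in> fix_ideal f g \<Longrightarrow> q \<in> fix_ideal f g \<Longrightarrow> p - q \<in> fix_ideal f g"
  "r \<in> polys (fix_coords g) \<Longrightarrow> p \<in> fix_ideal f g \<Longrightarrow> r * p \<in> fix_ideal f g"
  "(\<And>x. x \<in> S \<Longrightarrow> F x \<in> fix_ideal f g) \<Longrightarrow> sum F S \<in> fix_ideal f g"
  by (auto simp: fix_ideal_def
      intro: polys_add polys_mult polys_diff polys_sum is_idealD[OF is_ideal_gen_ideal])

definition top_form :: "'n set \<Rightarrow> 'n mpoly \<Rightarrow> 'n form" where
  "top_form I p = (\<lambda>S. if S = I then p else 0)"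

lemma top_form_add: "top_form I (p + q) = top_form I p + top_form I q"
  by (auto simp: top_form_def)

lemma top_form_inject: "top_form I p = top_form I q \<longleftrightarrow> p = q"
  by (metis top_form_def)

lemma top_form_apply [simp]: "top_form I p I = p"
  by (simp add: top_form_def)

lemma forms_top: "forms I (card I) = top_form I ` polys I" for I :: "'n::finite set"
proof -
  have eq: "S \<subseteq> I \<and> card S = card I \<longleftrightarrow> S = I" for S
    by (metis card_subset_eq finite order_refl)
  have "\<omega> = top_form I (\<omega> I)" if "\<omega> \<in> forms I (card I)" for \<omega> :: "'n form"
    using that unfolding forms_def eq by (auto simp: top_form_def)
  moreover have "\<omega> I \<in> polys I" if "\<omega> \<in> forms I (card I)" for \<omega> :: "'n form"
    using that by (simp add: forms_def)
  moreover have "top_form I p \<in> forms I (card I)" if "p \<in> polys I" for p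
    unfolding forms_def eq using that by (simp add: top_form_def)
  ultimately show ?thesis by blast
qed

lemma dfun_singleton: "dfun p {i} = pd i p"
  by (simp add: dfun_def)

lemma dfun_eq_0: "(\<And>i. S \<noteq> {i}) \<Longrightarrow> dfun p S = 0"
  by (simp add: dfun_def)

text \<open>In the top degree only the products of the i-th derivative with the component at I - {i}
  survive. Their shuffle signs square to one, so they can be absorbed into the coefficients and
  every element of the ideal occurs.\<close>

lemma Om_rel_eq: "Om_rel f g = top_form (fix_coords g) ` fix_ideal f g"
  for f :: "'n::{finite,linorder} mpoly"
proof -
  let ?I = "fix_coords g" and ?F = "restrict_fix f g"
  define s :: "'n set \<Rightarrow> 'n set \<Rightarrow> 'n mpoly"
    where "s S T = (- 1) ^ card {(t, u). t \<in> T \<and> u \<in> S - T \<and> u < t}" for S T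
  have wedge: "wedge (dfun ?F) \<theta> S = (\<Sum>T\<in>Pow S. s S T * dfun ?F T * \<theta> (S - T))" for \<theta> S
    by (simp only: wedge_def s_def)
  have s_polys: "s S T \<in> polys ?I" for S T
    unfolding s_def by (intro polys_power polys_uminus polys_1)
  have s_sq: "s S T * s S T = 1" for S T
    unfolding s_def power_add[symmetric] mult_2[symmetric] by simp
  have pd0: "pd i ?F = 0" if "i \<notin> ?I" for i
    using that by (intro pd_eq_0) (auto simp: restrict_fix_def)
  have sub: "wedge (dfun ?F) \<theta> \<in> top_form ?I ` fix_ideal f g"
    if \<theta>: "\<theta> \<in> forms ?I (card ?I - 1)" for \<theta>
  proof
    have term_0: "s S T * dfun ?F T * \<theta> (S - T) = 0" if "S \<noteq> ?I" "T \<subseteq> S" for S T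
    proof (rule ccontr)
      assume nz: "s S T * dfun ?F T * \<theta> (S - T) \<noteq> 0"
      have "dfun ?F T \<noteq> 0"
      proof
        assume "dfun ?F T = 0"
        with nz show False by (simp only: mult_zero_left mult_zero_right simp_thms)
      qed
      have "\<theta> (S - T) \<noteq> 0"
      proof
        assume "\<theta> (S - T) = 0"
        with nz show False by (simp only: mult_zero_right simp_thms)
      qed
      obtain i where T: "T = {i}"
        using \<open>dfun ?F T \<noteq> 0\<close> dfun_eq_0[of T ?F] by blast
      then have i: "i \<in> ?I" using \<open>dfun ?F T \<noteq> 0\<close> pd0[of i] unfolding T dfun_singleton by blast
      have "S - {i} \<subseteq> ?I" "card (S - {i}) = card ?I - 1"
      proof -
        have "\<not> (S - T \<subseteq> ?I \<and> card (S - T) = card ?I - 1) \<longrightarrow> \<theta> (S - T) = 0"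
          using \<theta> by (simp add: forms_def)
        then have "S - T \<subseteq> ?I \<and> card (S - T) = card ?I - 1"
          using \<open>\<theta> (S - T) \<noteq> 0\<close> by argo
        then show "S - {i} \<subseteq> ?I" "card (S - {i}) = card ?I - 1" unfolding T by simp_all
      qed
      moreover have "i \<in> S" using that T by simp
      \<comment> \<open>Rules out the case in which the truncated \<open>card ?I - 1\<close> equals
        \<open>card ?I\<close>.\<close>
      moreover have "0 < card ?I"
      proof -
        have "?I \<noteq> {}" using i by blast
        then show ?thesis by (simp add: card_gt_0_iff)
      qed
      moreover have "card S = Suc (card (S - {i}))"
        using card.remove[of S i] \<open>i \<in> S\<close> finite[of S] by blast
      ultimately have "card S = card ?I" by linarith
      moreover have "S \<subseteq> ?I" using \<open>S - {i} \<subseteq> ?I\<close> i by blast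
      ultimately show False using that(1) card_subset_eq[OF finite] by blast
    qed
    show "wedge (dfun ?F) \<theta> = top_form ?I (wedge (dfun ?F) \<theta> ?I)"
    proof
      fix S
      have "wedge (dfun ?F) \<theta> S = 0" if "S \<noteq> ?I"
        unfolding wedge using term_0[OF that] by (intro sum.neutral) blast
      then show "wedge (dfun ?F) \<theta> S = top_form ?I (wedge (dfun ?F) \<theta> ?I) S"
        by (simp add: top_form_def)
    qed
    have "s ?I T * dfun ?F T * \<theta> (?I - T) \<in> fix_ideal f g" if TI: "T \<subseteq> ?I" for T
    proof -
      have "dfun ?F T \<in> fix_ideal f g"
      proof (cases "\<exists>i. T = {i}")
        case True
        then obtain i where i: "T = {i}" "i \<in> ?I" using TI by auto
        then have "fix_grad f g i \<in> gen_ideal ?I (fix_grad f g)"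
          by (intro gen_in_gen_ideal[where h = "fix_grad f g"]) auto
        then show ?thesis
          unfolding i(1) dfun_singleton fix_ideal_def using fix_grad_polys by blast
      next
        case False
        then have "dfun ?F T = 0" by (intro dfun_eq_0) blast
        then show ?thesis by (simp only: fix_ideal_closed(1))
      qed
      moreover have "\<theta> (?I - T) \<in> polys ?I" using \<theta> by (simp add: forms_def)
      moreover note s_polys
      ultimately have "(s ?I T * \<theta> (?I - T)) * dfun ?F T \<in> fix_ideal f g"
        by (intro fix_ideal_closed(4) polys_mult) auto
      then show ?thesis by (simp only: mult_ac)
    qed
    then show "wedge (dfun ?F) \<theta> ?I \<in> fix_ideal f g"
      unfolding wedge by (intro fix_ideal_closed(5)) blast
  qed
  have "top_form ?I p \<in> wedge (dfun ?F) ` forms ?I (card ?I - 1)" if p: "p \<in> fix_ideal f g" for p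
  proof -
    obtain a where a: "\<And>i. a i \<in> polys ?I" "p = (\<Sum>i\<in>?I. a i * pd i ?F)"
      using fix_idealE[OF p] by metis
    \<comment> \<open>The component at I - {i} carries the sign with which the wedge product will
      read it.\<close>
    define \<theta> where "\<theta> = (\<lambda>S. \<Sum>i\<in>?I. if S = ?I - {i} then s ?I {i} * a i else 0)"
    have \<theta>_I: "\<theta> (?I - {i}) = s ?I {i} * a i" if "i \<in> ?I" for i
    proof -
      have "\<theta> (?I - {i}) = (\<Sum>j\<in>?I. if j = i then s ?I {i} * a i else 0)"
        unfolding \<theta>_def using that by (intro sum.cong) auto
      then show ?thesis using that by simp
    qed
    have "\<theta> \<in> forms ?I (card ?I - 1)"
      unfolding forms_def
    proof (intro CollectI allI conjI impI)
      fix S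
      show "\<theta> S \<in> polys ?I"
        unfolding \<theta>_def
        by (intro polys_sum) (simp add: polys_mult s_polys a)
      assume "\<not> (S \<subseteq> ?I \<and> card S = card ?I - 1)"
      then have "S \<noteq> ?I - {i}" if "i \<in> ?I" for i using that by (auto simp: card_Diff_singleton)
      then show "\<theta> S = 0" unfolding \<theta>_def by (intro sum.neutral) auto
    qed
    moreover have "wedge (dfun ?F) \<theta> ?I = p"
    proof -
      have "wedge (dfun ?F) \<theta> ?I = (\<Sum>T\<in>(\<lambda>i. {i}) ` ?I. s ?I T * dfun ?F T * \<theta> (?I - T))"
        unfolding wedge
      proof (rule sum.mono_neutral_right)
        show "\<forall>T\<in>Pow ?I - (\<lambda>i. {i}) ` ?I. s ?I T * dfun ?F T * \<theta> (?I - T) = 0"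
        proof
          fix T assume T: "T \<in> Pow ?I - (\<lambda>i. {i}) ` ?I"
          then have "T \<noteq> {i}" for i by auto
          then show "s ?I T * dfun ?F T * \<theta> (?I - T) = 0" by (simp add: dfun_eq_0)
        qed
      qed auto
      also have "\<dots> = (\<Sum>i\<in>?I. s ?I {i} * dfun ?F {i} * \<theta> (?I - {i}))"
        by (subst sum.reindex) auto
      also have "\<dots> = (\<Sum>i\<in>?I. a i * pd i ?F)"
      proof (rule sum.cong[OF refl])
        fix i assume "i \<in> ?I"
        have "s ?I {i} * dfun ?F {i} * \<theta> (?I - {i}) = (s ?I {i} * s ?I {i}) * (a i * pd i ?F)"
          unfolding \<theta>_I[OF \<open>i \<in> ?I\<close>] dfun_singleton by (simp only: mult_ac)
        then show "s ?I {i} * dfun ?F {i} * \<theta> (?I - {i}) = a i * pd i ?F"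
          unfolding s_sq by simp
      qed
      finally show ?thesis using a(2) by simp
    qed
    moreover obtain r where "wedge (dfun ?F) \<theta> = top_form ?I r"
      using sub[OF calculation(1)] by (rule imageE)
    ultimately have "top_form ?I p = wedge (dfun ?F) \<theta>" by simp
    then show ?thesis using \<open>\<theta> \<in> forms ?I (card ?I - 1)\<close> by (rule image_eqI)
  qed
  with sub show ?thesis unfolding Om_rel_def fix_dim_def by (intro equalityI subsetI) blast+
qed

definition cls :: "'n::{finite,linorder} mpoly \<Rightarrow> ('n \<Rightarrow> complex) \<Rightarrow> 'n mpoly \<Rightarrow> 'n form set" where
  "cls f g p = top_form (fix_coords g) p +o Om_rel f g"

lemma cls_eq: "cls f g p = {top_form (fix_coords g) q | q. q - p \<in> fix_ideal f g}"
proof -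
  have "cls f g p = {top_form (fix_coords g) (p + r) | r. r \<in> fix_ideal f g}"
    by (auto simp: cls_def elt_set_plus_def Om_rel_eq top_form_add)
  also have "\<dots> = {top_form (fix_coords g) q | q. q - p \<in> fix_ideal f g}"
  proof (intro equalityI subsetI; elim CollectE exE conjE)
    fix \<omega> r assume "\<omega> = top_form (fix_coords g) (p + r)" "r \<in> fix_ideal f g"
    then show "\<omega> \<in> {top_form (fix_coords g) q | q. q - p \<in> fix_ideal f g}"
      by (intro CollectI exI[of _ "p + r"]) simp
  next
    fix \<omega> q assume "\<omega> = top_form (fix_coords g) q" "q - p \<in> fix_ideal f g"
    then show "\<omega> \<in> {top_form (fix_coords g) (p + r) | r. r \<in> fix_ideal f g}"
      by (intro CollectI exI[of _ "q - p"]) simp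
  qed
  finally show ?thesis .
qed

lemma Om_eq: "Om f g = cls f g ` polys (fix_coords g)"
  by (simp add: Om_def fix_dim_def forms_top cls_def image_image)

lemma Om_rel_eq_cls: "Om_rel f g = cls f g 0"
  by (auto simp: cls_eq Om_rel_eq)

lemma cls_eq_iff: "cls f g p = cls f g q \<longleftrightarrow> p - q \<in> fix_ideal f g"
proof
  assume "cls f g p = cls f g q"
  moreover have "top_form (fix_coords g) p \<in> cls f g p"
    by (auto simp: cls_eq fix_ideal_closed)
  ultimately show "p - q \<in> fix_ideal f g"
    by (auto simp: cls_eq top_form_inject)
next
  assume pq: "p - q \<in> fix_ideal f g"
  have "r - p \<in> fix_ideal f g \<longleftrightarrow> r - q \<in> fix_ideal f g" for r
    using fix_ideal_closed(2)[OF _ pq, of "r - p"] fix_ideal_closed(3)[OF _ pq, of "r - q"] by auto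
  then show "cls f g p = cls f g q" by (simp add: cls_eq)
qed

text \<open>The image of a coset need not be a whole coset, which adding \<open>Om_rel f g\<close>
  repairs. The alternative in the first assumption restricts it to representatives of the class of
  \<open>p\<close>, the only ones to which \<Phi> is applied.\<close>

lemma cls_map:
  assumes "\<And>q. \<Phi> (top_form (fix_coords g) q) = top_form (fix_coords g) (\<alpha> q)
      \<or> q - p \<notin> fix_ideal f g"
    and "\<And>q. q - p \<in> fix_ideal f g \<Longrightarrow> \<alpha> q - \<alpha> p \<in> fix_ideal f g"
  shows "\<Phi> ` cls f g p + Om_rel f g = cls f g (\<alpha> p)"
proof
  show "\<Phi> ` cls f g p + Om_rel f g \<subseteq> cls f g (\<alpha> p)"
  proof
    fix \<omega> assume "\<omega> \<in> \<Phi> ` cls f g p + Om_rel f g"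
    then obtain q r where q: "q - p \<in> fix_ideal f g" and r: "r \<in> fix_ideal f g"
      and \<omega>: "\<omega> = \<Phi> (top_form (fix_coords g) q) + top_form (fix_coords g) r"
      by (auto simp: set_plus_def cls_eq Om_rel_eq)
    have "\<omega> = top_form (fix_coords g) (\<alpha> q + r)"
      using assms(1)[of q] q \<omega> by (simp add: top_form_add)
    moreover have "\<alpha> q + r - \<alpha> p \<in> fix_ideal f g"
      using fix_ideal_closed(2)[OF assms(2)[OF q] r] by (simp add: algebra_simps)
    ultimately show "\<omega> \<in> cls f g (\<alpha> p)" by (auto simp: cls_eq)
  qed
next
  have \<Phi>: "\<Phi> (top_form (fix_coords g) p) = top_form (fix_coords g) (\<alpha> p)"
    using assms(1)[of p] fix_ideal_closed(1)[of f g] by simp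
  show "cls f g (\<alpha> p) \<subseteq> \<Phi> ` cls f g p + Om_rel f g"
  proof
    fix \<omega> assume "\<omega> \<in> cls f g (\<alpha> p)"
    then obtain q where q: "q - \<alpha> p \<in> fix_ideal f g" "\<omega> = top_form (fix_coords g) q"
      by (auto simp: cls_eq)
    have "\<omega> = \<Phi> (top_form (fix_coords g) p) + top_form (fix_coords g) (q - \<alpha> p)"
      using q by (simp add: \<Phi> top_form_add[symmetric])
    moreover have "top_form (fix_coords g) p \<in> cls f g p"
      by (auto simp: cls_eq fix_ideal_closed)
    ultimately show "\<omega> \<in> \<Phi> ` cls f g p + Om_rel f g"
      using q(1) by (auto simp: Om_rel_eq intro!: set_plus_intro)
  qed
qed

lemma cls_add: "cls f g p + cls f g q = cls f g (p + q)"
proof -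
  have "Om_rel f g + Om_rel f g = Om_rel f g"
    using cls_map[of "\<lambda>\<omega>. \<omega>" g "\<lambda>q. q" 0 f] by (simp add: Om_rel_eq_cls)
  then show ?thesis
    unfolding cls_def by (simp add: set_plus_rearrange top_form_add)
qed

lemma cls_scale: "scale_form (cst c) ` cls f g p + Om_rel f g = cls f g (cst c * p)"
proof (rule cls_map)
  show "scale_form (cst c) (top_form (fix_coords g) q) = top_form (fix_coords g) (cst c * q)
      \<or> q - p \<notin> fix_ideal f g" for q
    by (auto simp: scale_form_def top_form_def)
  show "cst c * q - cst c * p \<in> fix_ideal f g" if "q - p \<in> fix_ideal f g" for q
    using fix_ideal_closed(4)[OF polys_cst that] by (simp add: right_diff_distrib)
qed


subsection \<open>Pull-back along diagonal automorphisms\<close>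

text \<open>Each d(k_i x_i) is k_i dx_i, and in an increasing list the first index precedes all
  others, so no sign appears.\<close>

lemma wedge_list_diag:
  assumes "sorted_wrt (<) xs"
  shows "wedge_list (map (\<lambda>i. dfun (diag_aut k (var i))) xs)
    = (\<lambda>S. if S = set xs then cst (\<Prod>i\<in>set xs. k i) else 0)"
  using assms
proof (induction xs)
  case Nil
  show ?case by (rule ext) (simp add: wedge_list_def cst_simps(1))
next
  case (Cons i xs)
  let ?\<beta> = "\<lambda>S. if S = set xs then cst (\<Prod>i\<in>set xs. k i) else 0"
  have d: "dfun (diag_aut k (var i)) T = (if T = {i} then cst (k i) else 0)" for T
  proof (cases "\<exists>j. T = {j}")
    case True
    then show ?thesis by (auto simp: dfun_singleton diag_aut_var pd_cst_mult pd_var split: if_splits)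
  next
    case False
    then show ?thesis using dfun_eq_0[of T] by auto
  qed
  have i: "i \<notin> set xs" "\<And>j. j \<in> set xs \<Longrightarrow> i < j" using Cons.prems by auto
  have IH: "wedge_list (map (\<lambda>i. dfun (diag_aut k (var i))) xs) = ?\<beta>"
    using Cons by simp
  have "wedge_list (map (\<lambda>i. dfun (diag_aut k (var i))) (i # xs))
      = wedge (dfun (diag_aut k (var i))) ?\<beta>"
    unfolding IH[symmetric] by (simp add: wedge_list_def)
  also have "\<dots> = (\<lambda>S. if S = set (i # xs) then cst (\<Prod>i\<in>set (i # xs). k i) else 0)"
  proof
    fix S
    let ?t = "\<lambda>T. (- 1) ^ card {(t, u). t \<in> T \<and> u \<in> S - T \<and> u < t}
      * dfun (diag_aut k (var i)) T * ?\<beta> (S - T)"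
    have "wedge (dfun (diag_aut k (var i))) ?\<beta> S = (\<Sum>T\<in>Pow S. if T = {i} then ?t {i} else 0)"
      unfolding wedge_def by (rule sum.cong) (auto simp: d)
    also have "\<dots> = (if i \<in> S then ?t {i} else 0)"
      by (subst sum.delta) auto
    also have "\<dots> = (if S = set (i # xs) then cst (\<Prod>i\<in>set (i # xs). k i) else 0)"
    proof (cases "S = set (i # xs)")
      case True
      then have S: "S - {i} = set xs" "i \<in> S" using i by auto
      have emp: "{(t, u). t \<in> {i} \<and> u \<in> S - {i} \<and> u < t} = {}" using i(2) S by force
      have "?t {i} = cst (k i) * cst (\<Prod>i\<in>set xs. k i)"
        unfolding emp unfolding d S(1) by simp
      then show ?thesis using True S(2) i(1) by (simp only: if_True) (simp add: cst_simps)
    next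
      case False
      then have "i \<in> S \<Longrightarrow> S - {i} \<noteq> set xs" using i(1) by auto
      then show ?thesis using False by auto
    qed
    finally show "wedge (dfun (diag_aut k (var i))) ?\<beta> S
        = (if S = set (i # xs) then cst (\<Prod>i\<in>set (i # xs). k i) else 0)" .
  qed
  finally show ?case .
qed

text \<open>The coefficient of the pulled-back top form on Fix(g); the constant factor is the
  determinant of k there.\<close>

definition pull_coord :: "('n::finite \<Rightarrow> complex) \<Rightarrow> ('n \<Rightarrow> complex) \<Rightarrow> 'n mpoly \<Rightarrow> 'n mpoly" where
  "pull_coord k g p = cst (\<Prod>i\<in>fix_coords g. k i) * diag_aut k p"

lemma pull_coord_add: "pull_coord k g (p + q) = pull_coord k g p + pull_coord k g q"
  by (simp add: pull_coord_def diag_aut_simps distrib_left)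

lemma pull_coord_diff: "pull_coord k g (p - q) = pull_coord k g p - pull_coord k g q"
  by (simp add: pull_coord_def diag_aut_simps right_diff_distrib)

lemma pull_coord_polys: "p \<in> polys (fix_coords g) \<Longrightarrow> pull_coord k g p \<in> polys (fix_coords g)"
  by (simp add: pull_coord_def polys_mult diag_aut_polys)

lemma fix_grad_diag_aut:
  assumes "k \<in> diag_symmetries f"
  shows "cst (k j) * diag_aut k (fix_grad f g j) = fix_grad f g j"
proof -
  have "diag_aut k (restrict_fix f g) = cst 1 * restrict_fix f g"
    using assms by (simp add: diag_symmetries_def restrict_fix_def restrict_poly_diag_aut[symmetric]
        cst_simps(1))
  from diag_aut_pd[OF this, of j] show ?thesis by (simp add: cst_simps(1))
qed

lemma diag_symmetries_nonzero: "k \<in> diag_symmetries f \<Longrightarrow> k i \<noteq> 0"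
  by (simp add: diag_symmetries_def torus_def)

lemma pull_coord_fix_ideal:
  assumes k: "k \<in> diag_symmetries f" and p: "p \<in> fix_ideal f g"
  shows "pull_coord k g p \<in> fix_ideal f g"
proof -
  let ?J = "gen_ideal (fix_coords g) (fix_grad f g)"
  note J = is_idealD[OF is_ideal_gen_ideal[of "fix_coords g" "fix_grad f g"]]
  obtain a where a: "p = (\<Sum>i\<in>fix_coords g. a i * fix_grad f g i)"
    using fix_idealE[OF p] by metis
  have "diag_aut k (fix_grad f g i) = cst (inverse (k i)) * fix_grad f g i" for i
  proof -
    have "cst (inverse (k i)) * fix_grad f g i
        = cst (inverse (k i)) * (cst (k i) * diag_aut k (fix_grad f g i))"
      by (simp only: fix_grad_diag_aut[OF k])
    also have "\<dots> = diag_aut k (fix_grad f g i)"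
      unfolding mult.assoc[symmetric] cst_simps(3)[symmetric]
      using diag_symmetries_nonzero[OF k, of i] by (simp add: cst_simps(1))
    finally show ?thesis by simp
  qed
  then have "diag_aut k (a i * fix_grad f g i) \<in> ?J" if "i \<in> fix_coords g" for i
    using gen_in_gen_ideal[of "fix_coords g" i "fix_grad f g"] that
    by (simp add: diag_aut_simps J(3))
  then have "diag_aut k p \<in> ?J" unfolding a diag_aut_simps(8) by (rule J(7))
  then show ?thesis
    using p by (simp add: fix_ideal_def pull_coord_def J(3) polys_mult diag_aut_polys)
qed

lemma cls_pull:
  assumes k: "k \<in> diag_symmetries f" and p: "p \<in> polys (fix_coords g)"
  shows "(\<lambda>\<omega>. restrict_form (fix_coords g) (pullback (diag_aut k) \<omega>)) ` cls f g p + Om_rel f g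
    = cls f g (pull_coord k g p)"
proof (rule cls_map)
  fix q
  let ?I = "fix_coords g"
  have "sorted_wrt (<) (sorted_list_of_set ?I)" by simp
  note wl = wedge_list_diag[OF this, of k]
  have "restrict_form ?I (pullback (diag_aut k) (top_form ?I q)) = top_form ?I (pull_coord k g q)"
    if q: "q \<in> polys ?I"
  proof
    fix S
    have "pullback (diag_aut k) (top_form ?I q) S
        = (\<Sum>T\<in>UNIV. if T = ?I then diag_aut k q
            * wedge_list (map (\<lambda>i. dfun (diag_aut k (var i))) (sorted_list_of_set ?I)) S else 0)"
      unfolding pullback_def by (rule sum.cong) (auto simp: top_form_def diag_aut_simps)
    also have "\<dots> = top_form ?I (pull_coord k g q) S"
      by (simp add: wl top_form_def pull_coord_def mult.commute)
    finally show "restrict_form ?I (pullback (diag_aut k) (top_form ?I q)) S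
        = top_form ?I (pull_coord k g q) S"
      using pull_coord_polys[OF q, of k]
      by (auto simp: restrict_form_def top_form_def restrict_poly_id restrict_poly_simps(4))
  qed
  moreover have "q \<in> polys ?I" if "q - p \<in> fix_ideal f g"
    using polys_add[OF _ p, of "q - p"] that by (simp add: fix_ideal_def)
  ultimately show "restrict_form ?I (pullback (diag_aut k) (top_form ?I q))
      = top_form ?I (pull_coord k g q) \<or> q - p \<notin> fix_ideal f g"
    by blast
next
  show "pull_coord k g q - pull_coord k g p \<in> fix_ideal f g" if "q - p \<in> fix_ideal f g" for q
    using pull_coord_fix_ideal[OF k that] by (simp add: pull_coord_diff)
qed


subsection \<open>The torus\<close>

lemma torus_simps: "carrier torus = {g. \<forall>i. g i \<noteq> 0}" "g \<otimes>\<^bsub>torus\<^esub> h = (\<lambda>i. g i * h i)"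
  "\<one>\<^bsub>torus\<^esub> = (\<lambda>_. 1)"
  by (simp_all add: torus_def)

lemma comm_group_torus: "comm_group torus"
proof (rule comm_groupI)
  show "\<exists>y\<in>carrier torus. y \<otimes>\<^bsub>torus\<^esub> x = \<one>\<^bsub>torus\<^esub>"
    if "x \<in> carrier torus" for x :: "'a \<Rightarrow> complex"
    using that by (intro bexI[of _ "\<lambda>i. inverse (x i)"]) (auto simp: torus_simps)
qed (auto simp: torus_simps mult_ac)

lemma group_torus: "group torus"
  using comm_group_torus by (rule comm_group.axioms(2))

lemma inv_torus: "g \<in> carrier torus \<Longrightarrow> inv\<^bsub>torus\<^esub> g = (\<lambda>i. inverse (g i))"
  by (rule group.inv_equality[OF group_torus]) (auto simp: torus_simps)

lemma fix_coords_inverse: "fix_coords (\<lambda>i. inverse (g i)) = fix_coords g"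
  by (simp add: fix_coords_def)

lemma restrict_fix_inverse: "restrict_fix f (\<lambda>i. inverse (g i)) = restrict_fix f g"
  by (simp add: restrict_fix_def fix_coords_inverse)

lemma cls_inverse: "cls f (\<lambda>i. inverse (g i)) p = cls f g p"
  by (simp add: cls_eq fix_ideal_def fix_coords_inverse restrict_fix_inverse)

lemma fix_coords_one: "fix_coords (\<lambda>_. 1) = UNIV"
  by (simp add: fix_coords_def)


subsection \<open>Families of representatives\<close>

definition poly_family :: "(('n \<Rightarrow> complex) \<Rightarrow> 'n mpoly) \<Rightarrow> bool" where
  "poly_family p \<longleftrightarrow> (\<forall>g. p g \<in> polys (fix_coords g))"

definition omega_of ::
  "'n::{finite,linorder} mpoly \<Rightarrow> ('n \<Rightarrow> complex) set \<Rightarrow> (('n \<Rightarrow> complex) \<Rightarrow> 'n mpoly) \<Rightarrow> 'n omega"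
  where "omega_of f G p = (\<lambda>g\<in>G. cls f g (p g))"

definition delta :: "('n \<Rightarrow> complex) \<Rightarrow> 'n mpoly \<Rightarrow> ('n \<Rightarrow> complex) \<Rightarrow> 'n mpoly" where
  "delta g p = (\<lambda>h. if h = g then p else 0)"

lemma poly_family_delta: "p \<in> polys (fix_coords g) \<Longrightarrow> poly_family (delta g p)"
  by (simp add: poly_family_def delta_def)

lemma Omega_carrierE:
  assumes "x \<in> carrier (Omega f G)"
  obtains p where "poly_family p" "x = omega_of f G p"
proof -
  have x: "x \<in> (\<Pi>\<^sub>E g\<in>G. Om f g)" using assms by (simp add: Omega_def)
  have "\<exists>q. q \<in> polys (fix_coords g) \<and> (g \<in> G \<longrightarrow> x g = cls f g q)" for g
  proof (cases "g \<in> G")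
    case True
    then have "x g \<in> Om f g" using x by auto
    then show ?thesis by (auto simp: Om_eq)
  qed (use polys_0 in blast)
  then obtain p where p: "\<And>g. p g \<in> polys (fix_coords g)" "\<And>g. g \<in> G \<Longrightarrow> x g = cls f g (p g)"
    by metis
  have "x = omega_of f G p"
  proof
    fix g show "x g = omega_of f G p g"
      using x p(2) by (cases "g \<in> G") (auto simp: omega_of_def)
  qed
  with p(1) show thesis by (intro that) (simp_all add: poly_family_def)
qed

lemma omega_of_closed: "poly_family p \<Longrightarrow> omega_of f G p \<in> carrier (Omega f G)"
  by (auto simp: Omega_def omega_of_def Om_eq poly_family_def)

lemma omega_of_add:
  "omega_of f G p \<oplus>\<^bsub>Omega f G\<^esub> omega_of f G q = omega_of f G (\<lambda>g. p g + q g)"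
  by (simp add: Omega_def omega_of_def cls_add fun_eq_iff)

lemma omega_of_smult:
  "c \<odot>\<^bsub>Omega f G\<^esub> omega_of f G p = omega_of f G (\<lambda>g. cst c * p g)"
  by (simp add: Omega_def omega_of_def cls_scale fun_eq_iff)

lemma omega_of_eq_iff:
  "omega_of f G p = omega_of f G q \<longleftrightarrow> (\<forall>g\<in>G. p g - q g \<in> fix_ideal f g)"
proof
  assume eq: "omega_of f G p = omega_of f G q"
  show "\<forall>g\<in>G. p g - q g \<in> fix_ideal f g"
  proof
    fix g assume "g \<in> G"
    then have "cls f g (p g) = cls f g (q g)" using fun_cong[OF eq, of g] by (simp add: omega_of_def)
    then show "p g - q g \<in> fix_ideal f g" by (simp add: cls_eq_iff)
  qed
next
  assume "\<forall>g\<in>G. p g - q g \<in> fix_ideal f g"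
  then show "omega_of f G p = omega_of f G q"
    unfolding omega_of_def by (intro restrict_ext) (simp add: cls_eq_iff)
qed

lemma Omega_sectorE:
  assumes "x \<in> Omega_sector f G g"
  obtains p where "p \<in> polys (fix_coords g)" "x = omega_of f G (delta g p)"
proof -
  from assms obtain p where p: "p \<in> polys (fix_coords g)" "x = Omega_incl f G g (cls f g p)"
    by (auto simp: Omega_sector_def Om_eq)
  have "x = omega_of f G (delta g p)"
    unfolding p(2) Omega_incl_def omega_of_def delta_def
    by (rule restrict_ext) (simp add: Om_rel_eq_cls)
  with p(1) show thesis by (rule that)
qed

lemma omega_of_delta_sector:
  "p \<in> polys (fix_coords g) \<Longrightarrow> omega_of f G (delta g p) \<in> Omega_sector f G g"
  unfolding Omega_sector_def Om_eq image_image Omega_incl_def omega_of_def delta_def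
  by (rule image_eqI[of _ _ p], rule restrict_ext) (simp_all add: Om_rel_eq_cls)

lemma vol_eq: "vol f G = omega_of f G (delta (\<lambda>_. 1) 1)"
proof -
  have "(\<lambda>S. if S = UNIV then 1 else 0) = (top_form UNIV 1 :: 'a form)"
    by (simp add: top_form_def)
  then have "vol f G = Omega_incl f G (\<lambda>_. 1) (cls f (\<lambda>_. 1) 1)"
    by (simp add: vol_def form_class_def torus_simps cls_def fix_coords_one)
  then show ?thesis
    unfolding Omega_incl_def omega_of_def delta_def
    by (simp only:) (rule restrict_ext, simp add: Om_rel_eq_cls)
qed

lemma vol_in_vol_classes: "vol f G \<in> vol_classes f G"
proof -
  let ?\<omega> = "(\<lambda>S. if S = UNIV then 1 else 0) :: 'a form"
  have "?\<omega> = top_form UNIV 1" by (simp add: top_form_def)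
  then have "?\<omega> \<in> forms UNIV CARD('a)" using forms_top[of "UNIV :: 'a set"] by auto
  moreover have "meval x (?\<omega> UNIV) \<noteq> 0" for x by (simp add: meval_def)
  ultimately show ?thesis unfolding vol_classes_def vol_def by blast
qed

text \<open>Diagonal automorphisms commute, so conjugation by k sends every sector to
  itself.\<close>

lemma omega_of_pull:
  assumes k: "k \<in> diag_symmetries f" and G: "G \<subseteq> carrier torus" and p: "poly_family p"
  shows "Omega_pull f G (diag_aut k) (omega_of f G p) = omega_of f G (\<lambda>g. pull_coord k g (p g))"
  unfolding Omega_pull_def omega_of_def
proof (rule restrict_ext)
  fix h assume h: "h \<in> G"
  let ?k' = "\<lambda>i. inverse (k i)"
  have cancel: "diag_aut ?k' (diag_aut k q) = q" "diag_aut k (diag_aut ?k' q) = q" for q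
    using diag_symmetries_nonzero[OF k] by (simp_all add: diag_aut_comp diag_aut_one)
  then have inv: "inv_into UNIV (diag_aut k) = diag_aut ?k'"
    by (metis inv_equality)
  have "inv_into UNIV (diag_aut k) \<circ> diag_aut h \<circ> diag_aut k = diag_aut h"
  proof
    fix q
    have "(inv_into UNIV (diag_aut k) \<circ> diag_aut h \<circ> diag_aut k) q
        = diag_aut ?k' (diag_aut k (diag_aut h q))"
      by (simp add: inv diag_aut_comp mult_ac)
    then show "(inv_into UNIV (diag_aut k) \<circ> diag_aut h \<circ> diag_aut k) q = diag_aut h q"
      by (simp add: cancel)
  qed
  then have "(THE g. diag_aut g = inv_into UNIV (diag_aut k) \<circ> diag_aut h \<circ> diag_aut k) = h"
    by (simp add: diag_aut_inject)
  then show "(let g = (THE g. diag_aut g = inv_into UNIV (diag_aut k) \<circ> diag_aut h \<circ> diag_aut k)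
      in (\<lambda>\<omega>. restrict_form (fix_coords h) (pullback (diag_aut k) \<omega>))
          ` (\<lambda>g\<in>G. cls f g (p g)) g + Om_rel f h) = cls f h (pull_coord k h (p h))"
    using h p cls_pull[OF k, of "p h" h] by (simp add: poly_family_def)
qed


subsection \<open>The residue pairing in coordinates\<close>

abbreviation fix_res :: "'n::finite mpoly \<Rightarrow> ('n \<Rightarrow> complex) \<Rightarrow> 'n mpoly \<Rightarrow> complex" where
  "fix_res f g \<equiv> groth_res (fix_coords g) (fix_grad f g)"

definition pairing_const :: "('n::finite \<Rightarrow> complex) set \<Rightarrow> ('n \<Rightarrow> complex) \<Rightarrow> complex" where
  "pairing_const G g = (- 1) ^ codim g * ee (- age g / 2) * of_nat (card G)"

lemma pairing_const_nonzero: "finite G \<Longrightarrow> g \<in> G \<Longrightarrow> pairing_const G g \<noteq> 0"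
  by (auto simp: pairing_const_def ee_def)

context
  fixes f :: "'n::{finite,linorder} mpoly" and G :: "('n \<Rightarrow> complex) set"
  assumes wh: "weighted_homogeneous f" and nd: "nondegenerate f"
    and G: "subgroup G torus" "G \<subseteq> diag_symmetries f"
begin

lemma fix_res_additive:
  assumes "g \<in> diag_symmetries f"
  shows "fix_res f g (p + q) = fix_res f g p + fix_res f g q"
    and "fix_res f g (cst c * p) = c * fix_res f g p"
    and "p \<in> gen_ideal (fix_coords g) (fix_grad f g) \<Longrightarrow> fix_res f g p = 0"
  using residue_data_exists[OF wh nd assms]
  by (auto intro: groth_res_add groth_res_cst_mult groth_res_gen_ideal)

text \<open>Other representatives change the product \<open>p * q\<close> by an element of the
  Jacobian ideal of f^g, where the residue vanishes; so the definite description has a unique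
  value.\<close>

lemma sector_pairing_cls:
  assumes g: "g \<in> G"
  shows "sector_pairing f G g (cls f g p) (cls f (inv\<^bsub>torus\<^esub> g) q)
    = pairing_const G g * fix_res f g (p * q)"
proof -
  let ?I = "fix_coords g"
  let ?J = "gen_ideal ?I (fix_grad f g)"
  note J = is_idealD[OF is_ideal_gen_ideal[of ?I "fix_grad f g"]]
  have sym: "g \<in> diag_symmetries f" and tor: "g \<in> carrier torus"
    using g G subgroup.subset[OF G(1)] by auto
  have q: "cls f (inv\<^bsub>torus\<^esub> g) q = cls f g q" by (simp add: inv_torus[OF tor] cls_inverse)
  have eq: "fix_res f g (\<alpha> ?I * \<beta> ?I) = fix_res f g (p * q)"
    if "\<alpha> \<in> cls f g p" "\<beta> \<in> cls f g q" for \<alpha> \<beta>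
  proof -
    from that obtain p' q' where \<alpha>\<beta>: "\<alpha> ?I = p'" "\<beta> ?I = q'" and J': "p' - p \<in> ?J" "q' - q \<in> ?J"
      by (auto simp: cls_eq fix_ideal_def)
    have "p' * (q' - q) + (p' - p) * q \<in> ?J" by (intro J(2,3,4) J')
    then have "fix_res f g (p * q + (p' * (q' - q) + (p' - p) * q)) = fix_res f g (p * q)"
      by (simp only: fix_res_additive(1)[OF sym, of "p * q"] fix_res_additive(3)[OF sym] add_0_right)
    also have "p * q + (p' * (q' - q) + (p' - p) * q) = p' * q'"
      by (simp add: algebra_simps)
    finally show ?thesis by (simp add: \<alpha>\<beta>)
  qed
  have mem: "top_form ?I r \<in> cls f g r" for r by (auto simp: cls_eq fix_ideal_closed)
  show ?thesis
    unfolding sector_pairing_def Let_def q pairing_const_def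
  proof (rule the_equality)
    show "\<exists>\<alpha>\<in>cls f g p. \<exists>\<beta>\<in>cls f g q. (- 1) ^ codim g * ee (- age g / 2) * of_nat (card G)
        * fix_res f g (p * q) = (- 1) ^ codim g * ee (- age g / 2) * of_nat (card G)
        * fix_res f g (\<alpha> ?I * \<beta> ?I)"
      by (rule bexI[OF bexI[OF _ mem] mem]) simp
  qed (use eq in auto)
qed

lemma residue_pairing_omega_of:
  "residue_pairing f G (omega_of f G p) (omega_of f G q)
    = (\<Sum>g\<in>G. pairing_const G g * fix_res f g (p g * q (inv\<^bsub>torus\<^esub> g)))"
  unfolding residue_pairing_def
  using subgroup.m_inv_closed[OF G(1)]
  by (intro sum.cong) (auto simp: omega_of_def sector_pairing_cls)

lemma residue_pairing_add:
  assumes "x \<in> carrier (Omega f G)" "y \<in> carrier (Omega f G)" "z \<in> carrier (Omega f G)"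
  shows "residue_pairing f G (x \<oplus>\<^bsub>Omega f G\<^esub> y) z = residue_pairing f G x z + residue_pairing f G y z"
    and "residue_pairing f G z (x \<oplus>\<^bsub>Omega f G\<^esub> y) = residue_pairing f G z x + residue_pairing f G z y"
proof -
  obtain p q r where [simp]: "x = omega_of f G p" "y = omega_of f G q" "z = omega_of f G r"
    using assms by (metis Omega_carrierE)
  have sym: "g \<in> diag_symmetries f" if "g \<in> G" for g using that G(2) by blast
  show "residue_pairing f G (x \<oplus>\<^bsub>Omega f G\<^esub> y) z = residue_pairing f G x z + residue_pairing f G y z"
    by (simp add: omega_of_add residue_pairing_omega_of sum.distrib[symmetric] distrib_right
        fix_res_additive[OF sym] distrib_left cong: sum.cong)
  show "residue_pairing f G z (x \<oplus>\<^bsub>Omega f G\<^esub> y) = residue_pairing f G z x + residue_pairing f G z y"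
    by (simp add: omega_of_add residue_pairing_omega_of sum.distrib[symmetric] distrib_left
        fix_res_additive[OF sym] cong: sum.cong)
qed

lemma residue_pairing_smult:
  assumes "x \<in> carrier (Omega f G)" "y \<in> carrier (Omega f G)"
  shows "residue_pairing f G (c \<odot>\<^bsub>Omega f G\<^esub> x) y = c * residue_pairing f G x y"
    and "residue_pairing f G x (c \<odot>\<^bsub>Omega f G\<^esub> y) = c * residue_pairing f G x y"
proof -
  obtain p q where [simp]: "x = omega_of f G p" "y = omega_of f G q"
    using assms by (metis Omega_carrierE)
  have sym: "g \<in> diag_symmetries f" if "g \<in> G" for g using that G(2) by blast
  show "residue_pairing f G (c \<odot>\<^bsub>Omega f G\<^esub> x) y = c * residue_pairing f G x y"
    "residue_pairing f G x (c \<odot>\<^bsub>Omega f G\<^esub> y) = c * residue_pairing f G x y"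
    by (simp_all add: omega_of_smult residue_pairing_omega_of sum_distrib_left mult.assoc
        mult.left_commute[of _ "cst c"] fix_res_additive[OF sym] mult.left_commute[of c] cong: sum.cong)
qed

text \<open>The two arguments contribute the square of the determinant of k on Fix(g), which cancels
  the factor of \<open>groth_res_diag_aut\<close>.\<close>

lemma fix_res_pull_coord:
  assumes g: "g \<in> diag_symmetries f" and k: "k \<in> diag_symmetries f"
  shows "fix_res f g (pull_coord k g p * pull_coord k g q) = fix_res f g (p * q)"
proof -
  let ?c = "\<Prod>i\<in>fix_coords g. k i"
  obtain M A where data: "residue_data (fix_coords g) (fix_grad f g) M A"
    using residue_data_exists[OF wh nd g] by blast
  have "pull_coord k g p * pull_coord k g q = cst (?c\<^sup>2) * diag_aut k (p * q)"
    by (simp add: pull_coord_def diag_aut_simps cst_simps power2_eq_square mult_ac)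
  then show ?thesis
    using groth_res_diag_aut[OF data, of k "p * q"] fix_grad_diag_aut[OF k]
      diag_symmetries_nonzero[OF k] fix_res_additive(2)[OF g] by simp
qed

lemma fix_res_test_monomial:
  assumes g: "g \<in> diag_symmetries f" and p: "p \<in> polys (fix_coords g)" "p \<notin> fix_ideal f g"
  obtains m where "keys m \<subseteq> fix_coords g" "fix_res f g (p * monom_of m) \<noteq> 0"
proof -
  obtain M A where data: "residue_data (fix_coords g) (fix_grad f g) M A"
    using residue_data_exists[OF wh nd g] by blast
  show thesis
    using groth_res_nondegenerate[OF data fix_grad_polys p(1)] p that by (auto simp: fix_ideal_def)
qed

text \<open>A monomial is an eigenvector of every diagonal pull-back. As the pairing is invariant, a
  monomial that pairs non-trivially with an invariant class is itself invariant, so no averaging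
  over the group is needed.\<close>

lemma fix_res_invariant_test_monomial:
  assumes g: "g \<in> diag_symmetries f" and p: "p \<in> polys (fix_coords g)" "p \<notin> fix_ideal f g"
    and inv: "\<And>k. k \<in> G \<Longrightarrow> pull_coord k g p - p \<in> fix_ideal f g"
  obtains m where "keys m \<subseteq> fix_coords g" "fix_res f g (p * monom_of m) \<noteq> 0"
    "\<And>k. k \<in> G \<Longrightarrow> pull_coord k g (monom_of m) = monom_of m"
proof -
  from fix_res_test_monomial[OF g p] obtain m
    where m: "keys m \<subseteq> fix_coords g" and nz: "fix_res f g (p * monom_of m) \<noteq> 0" by blast
  have "pull_coord k g (monom_of m) = monom_of m" if k: "k \<in> G" for k
  proof -
    have ksym: "k \<in> diag_symmetries f" using k G(2) by blast
    let ?c = "(\<Prod>i\<in>fix_coords g. k i) * character k m"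
    have eig: "pull_coord k g (monom_of m) = cst ?c * monom_of m"
      by (simp add: pull_coord_def monom_of_def diag_aut_single cst_def mult_single)
    have "fix_res f g (p * monom_of m) = fix_res f g (pull_coord k g p * (cst ?c * monom_of m))"
      using fix_res_pull_coord[OF g ksym, of p "monom_of m"] by (simp only: eig)
    also have "\<dots> = ?c * fix_res f g (pull_coord k g p * monom_of m)"
      by (simp only: mult.left_commute[of _ "cst ?c"] fix_res_additive(2)[OF g])
    also have "pull_coord k g p * monom_of m
        = p * monom_of m + monom_of m * (pull_coord k g p - p)"
      by (simp add: algebra_simps)
    also have "fix_res f g \<dots> = fix_res f g (p * monom_of m)"
    proof -
      have "monom_of m * (pull_coord k g p - p) \<in> gen_ideal (fix_coords g) (fix_grad f g)"
        using inv[OF k] is_idealD(3)[OF is_ideal_gen_ideal] by (auto simp: fix_ideal_def)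
      then show ?thesis by (simp add: fix_res_additive[OF g])
    qed
    finally have "?c = 1" using nz by simp
    then show ?thesis unfolding eig by (simp only: cst_simps(1) mult_1_left)
  qed
  with m nz show thesis by (rule that)
qed

end


section \<open>The orbifold Jacobian algebra\<close>

lemma complex_field_simps [simp]:
  "carrier complex_field = UNIV" "\<zero>\<^bsub>complex_field\<^esub> = 0" "\<one>\<^bsub>complex_field\<^esub> = 1"
  "a \<otimes>\<^bsub>complex_field\<^esub> b = a * b" "a \<oplus>\<^bsub>complex_field\<^esub> b = a + b"
  by (simp_all add: ring_of_type_algebra_def)

lemma pull_coord_0 [simp]: "pull_coord k g 0 = 0"
  by (simp add: pull_coord_def diag_aut_simps)

lemma pull_coord_cst_mult: "pull_coord k g (cst c * p) = cst c * pull_coord k g p"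
  by (simp add: pull_coord_def diag_aut_simps mult_ac)

lemma pull_coord_delta: "(\<lambda>h. pull_coord k h (delta g p h)) = delta g (pull_coord k g p)"
  by (auto simp: delta_def)

lemma (in abelian_monoid) finsum_induct:
  assumes "finite S" "\<And>s. s \<in> S \<Longrightarrow> F s \<in> carrier G" "\<And>s. s \<in> S \<Longrightarrow> Q (F s)" "Q \<zero>"
    and add: "\<And>a b. a \<in> carrier G \<Longrightarrow> b \<in> carrier G \<Longrightarrow> Q a \<Longrightarrow> Q b \<Longrightarrow> Q (a \<oplus> b)"
  shows "Q (finsum G F S)"
  using assms(1-3)
proof (induction S rule: finite_induct)
  case (insert s S)
  then have "finsum G F (insert s S) = F s \<oplus> finsum G F S"
    by (intro finsum_insert) auto
  moreover have "finsum G F S \<in> carrier G" using insert.prems by (intro finsum_closed) auto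
  ultimately show ?case using insert by (auto intro!: add)
qed (simp add: assms(4))

lemma ex1_eq: "\<exists>!x. P x \<Longrightarrow> P a \<Longrightarrow> P b \<Longrightarrow> a = b"
  by blast

context
  fixes f :: "'n::{finite,linorder} mpoly"
    and G :: "('n \<Rightarrow> complex) set"
    and A :: "('n, 'a) twisted_alg"
  assumes inv_f: "invertible_polynomial f"
    and G: "subgroup G torus"
    and G_SL: "G \<subseteq> diag_symmetries f \<inter> diag_SL"
    and ax_i: "axiom_i f G A" and ax_iii: "axiom_iii f G A"
    and ax_iv: "axiom_iv f G A" and ax_v: "axiom_v f G A"
begin

abbreviation (input) "\<Omega> \<equiv> Omega f G"
abbreviation (input) "\<Phi> U \<equiv> lact A U (vol f G)"
abbreviation (input) "\<alpha> k U \<equiv> alg_pull f G A (diag_aut k) U"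
abbreviation (input) "pull k x \<equiv> Omega_pull f G (diag_aut k) x"
abbreviation (input) "pairing x y \<equiv> residue_pairing f G x y"

lemma wh_nd: "weighted_homogeneous f" "nondegenerate f"
  using inv_f by (auto simp: invertible_polynomial_def)

lemma G_sym: "G \<subseteq> diag_symmetries f"
  using G_SL by blast

lemma finite_G: "finite G"
  using finite_subset[OF G_sym finite_diag_symmetries[OF inv_f]] .

lemma one_G: "(\<lambda>_. 1) \<in> G"
  using subgroup.one_closed[OF G] by (simp add: torus_simps)

lemma inv_G: "g \<in> G \<Longrightarrow> inv\<^bsub>torus\<^esub> g \<in> G"
  by (rule subgroup.m_inv_closed[OF G])

lemma G_torus: "G \<subseteq> carrier torus"
  by (rule subgroup.subset[OF G])

lemma graded_A: "Z2_graded_algebra A (parity_part G A)"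
  using ax_i by (simp add: axiom_i_def)

lemma algebra_A: "complex_algebra A"
  using graded_A by (simp add: Z2_graded_algebra_def)

lemma ring_A: "ring A"
  using algebra_A by (simp add: complex_algebra_def)

lemma module_A: "Module.module complex_field A"
  using algebra_A by (simp add: complex_algebra_def)

lemma smult_mult_A:
  "x \<in> carrier A \<Longrightarrow> y \<in> carrier A \<Longrightarrow> (c \<odot>\<^bsub>A\<^esub> x) \<otimes>\<^bsub>A\<^esub> y = c \<odot>\<^bsub>A\<^esub> (x \<otimes>\<^bsub>A\<^esub> y)"
  "x \<in> carrier A \<Longrightarrow> y \<in> carrier A \<Longrightarrow> x \<otimes>\<^bsub>A\<^esub> (c \<odot>\<^bsub>A\<^esub> y) = c \<odot>\<^bsub>A\<^esub> (x \<otimes>\<^bsub>A\<^esub> y)"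
  using algebra_A by (simp_all add: complex_algebra_def)

interpretation RA: ring A by (rule ring_A)
interpretation MA: Module.module complex_field A by (rule module_A)

lemma smult_closed_A [simp]: "x \<in> carrier A \<Longrightarrow> c \<odot>\<^bsub>A\<^esub> x \<in> carrier A"
  by (rule MA.smult_closed) simp_all


subsection \<open>The identification with the module of forms\<close>

lemma vol_closed: "vol f G \<in> carrier \<Omega>"
  unfolding vol_eq by (intro omega_of_closed poly_family_delta) (simp add: fix_coords_one)

lemma \<Phi>_bij: "bij_betw (\<lambda>U. \<Phi> U) (carrier A) (carrier \<Omega>)"
proof -
  have "\<forall>\<zeta>\<in>vol_classes f G. bij_betw (\<lambda>U. lact A U \<zeta>) (carrier A) (carrier \<Omega>)"
    using ax_iii unfolding axiom_iii_def Let_def by (elim conjE)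
  then show ?thesis using vol_in_vol_classes by (rule bspec)
qed

lemma \<Phi>_closed: "U \<in> carrier A \<Longrightarrow> \<Phi> U \<in> carrier \<Omega>"
  using \<Phi>_bij bij_betwE by blast

lemma \<Phi>_inject: "U \<in> carrier A \<Longrightarrow> V \<in> carrier A \<Longrightarrow> \<Phi> U = \<Phi> V \<Longrightarrow> U = V"
  using \<Phi>_bij by (auto simp: bij_betw_def inj_on_def)

lemma \<Phi>_surj:
  assumes "x \<in> carrier \<Omega>"
  obtains U where "U \<in> carrier A" "\<Phi> U = x"
proof -
  have "x \<in> (\<lambda>U. \<Phi> U) ` carrier A"
    using assms by (simp add: bij_betw_imp_surj_on[OF \<Phi>_bij])
  then show thesis using that by blast
qed

lemma \<Phi>_add: "U \<in> carrier A \<Longrightarrow> V \<in> carrier A \<Longrightarrow> \<Phi> (U \<oplus>\<^bsub>A\<^esub> V) = \<Phi> U \<oplus>\<^bsub>\<Omega>\<^esub> \<Phi> V"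
  using ax_iii vol_closed by (simp add: axiom_iii_def Let_def)

lemma \<Phi>_smult: "U \<in> carrier A \<Longrightarrow> \<Phi> (c \<odot>\<^bsub>A\<^esub> U) = c \<odot>\<^bsub>\<Omega>\<^esub> \<Phi> U"
  using ax_iii vol_closed by (simp add: axiom_iii_def Let_def)

lemma \<Phi>_mult: "U \<in> carrier A \<Longrightarrow> V \<in> carrier A \<Longrightarrow> \<Phi> (U \<otimes>\<^bsub>A\<^esub> V) = lact A U (\<Phi> V)"
  using ax_iii vol_closed by (simp add: axiom_iii_def Let_def)

lemma \<Phi>_one: "\<Phi> \<one>\<^bsub>A\<^esub> = vol f G"
  using ax_iii vol_closed by (simp add: axiom_iii_def Let_def)

lemma \<Phi>_zero: "\<Phi> \<zero>\<^bsub>A\<^esub> = omega_of f G (\<lambda>_. 0)"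
proof -
  obtain p where p: "\<Phi> \<zero>\<^bsub>A\<^esub> = omega_of f G p"
    using \<Phi>_closed[OF RA.zero_closed] by (rule Omega_carrierE)
  have "0 \<odot>\<^bsub>A\<^esub> \<zero>\<^bsub>A\<^esub> = \<zero>\<^bsub>A\<^esub>"
    using MA.smult_l_null[of "\<zero>\<^bsub>A\<^esub>"] by simp
  then have "\<Phi> \<zero>\<^bsub>A\<^esub> = 0 \<odot>\<^bsub>\<Omega>\<^esub> \<Phi> \<zero>\<^bsub>A\<^esub>"
    using \<Phi>_smult[of "\<zero>\<^bsub>A\<^esub>" 0] by simp
  also have "\<dots> = omega_of f G (\<lambda>_. 0)"
    by (simp add: p omega_of_smult cst_simps(4))
  finally show ?thesis .
qed

lemma pull_closed:
  assumes "k \<in> G" "x \<in> carrier \<Omega>"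
  shows "pull k x \<in> carrier \<Omega>"
proof -
  obtain p where p: "poly_family p" "x = omega_of f G p" using assms(2) by (rule Omega_carrierE)
  have "poly_family (\<lambda>g. pull_coord k g (p g))"
    using p(1) by (simp add: poly_family_def pull_coord_polys)
  then show ?thesis
    using assms(1) G_sym unfolding p(2) by (subst omega_of_pull[OF _ G_torus p(1)])
      (auto intro: omega_of_closed)
qed

lemma pull_linear:
  assumes k: "k \<in> G" and xy: "x \<in> carrier \<Omega>" "y \<in> carrier \<Omega>"
  shows "pull k (x \<oplus>\<^bsub>\<Omega>\<^esub> y) = pull k x \<oplus>\<^bsub>\<Omega>\<^esub> pull k y" "pull k (c \<odot>\<^bsub>\<Omega>\<^esub> x) = c \<odot>\<^bsub>\<Omega>\<^esub> pull k x"
proof -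
  obtain p where p: "poly_family p" "x = omega_of f G p" using xy(1) by (rule Omega_carrierE)
  obtain q where q: "poly_family q" "y = omega_of f G q" using xy(2) by (rule Omega_carrierE)
  have ksym: "k \<in> diag_symmetries f" using k G_sym by blast
  note pull = omega_of_pull[OF ksym G_torus]
  have "poly_family (\<lambda>g. p g + q g)" "poly_family (\<lambda>g. cst c * p g)"
    using p(1) q(1) by (simp_all add: poly_family_def polys_add polys_mult)
  then show "pull k (x \<oplus>\<^bsub>\<Omega>\<^esub> y) = pull k x \<oplus>\<^bsub>\<Omega>\<^esub> pull k y" "pull k (c \<odot>\<^bsub>\<Omega>\<^esub> x) = c \<odot>\<^bsub>\<Omega>\<^esub> pull k x"
    using p q by (simp_all add: omega_of_add omega_of_smult pull pull_coord_add pull_coord_cst_mult)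
qed

lemma pull_delta:
  assumes "k \<in> G" "p \<in> polys (fix_coords g)"
  shows "pull k (omega_of f G (delta g p)) = omega_of f G (delta g (pull_coord k g p))"
  using assms G_sym
  by (subst omega_of_pull[OF _ G_torus poly_family_delta]) (auto simp: pull_coord_delta)

text \<open>The pull-back of the volume form by k is det k times it; this is where the SL condition
  enters.\<close>

lemma pull_vol:
  assumes "k \<in> G"
  shows "pull k (vol f G) = vol f G"
proof -
  have "(\<Prod>i\<in>UNIV. k i) = 1" using assms G_SL by (auto simp: diag_SL_def)
  then have "pull_coord k (\<lambda>_. 1) 1 = 1"
    by (simp add: pull_coord_def fix_coords_one diag_aut_simps cst_simps)
  then show ?thesis
    unfolding vol_eq using pull_delta[OF assms, of 1 "\<lambda>_. 1"] by simp
qed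

text \<open>With an invariant volume class the defining equation of \<open>alg_pull\<close> says
  that \<Phi> intertwines the action on the algebra with the pull-back of forms.\<close>

lemma \<alpha>_eqI:
  assumes "k \<in> G" "V \<in> carrier A" "\<Phi> V = pull k (\<Phi> U)"
  shows "\<alpha> k U = V"
  unfolding alg_pull_def pull_vol[OF assms(1)]
  using assms \<Phi>_inject by (intro the_equality) auto

lemma \<alpha>_props:
  assumes "k \<in> G" "U \<in> carrier A"
  shows \<alpha>_closed: "\<alpha> k U \<in> carrier A" and \<Phi>_\<alpha>: "\<Phi> (\<alpha> k U) = pull k (\<Phi> U)"
proof -
  obtain V where V: "V \<in> carrier A" "\<Phi> V = pull k (\<Phi> U)"
    using pull_closed[OF assms(1) \<Phi>_closed[OF assms(2)]] by (rule \<Phi>_surj)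
  with \<alpha>_eqI[OF assms(1) V] show "\<alpha> k U \<in> carrier A" "\<Phi> (\<alpha> k U) = pull k (\<Phi> U)" by simp_all
qed

lemma \<alpha>_add:
  assumes "k \<in> G" "U \<in> carrier A" "V \<in> carrier A"
  shows "\<alpha> k (U \<oplus>\<^bsub>A\<^esub> V) = \<alpha> k U \<oplus>\<^bsub>A\<^esub> \<alpha> k V"
  using assms by (intro \<alpha>_eqI) (simp_all add: \<Phi>_add \<Phi>_\<alpha> \<alpha>_closed pull_linear \<Phi>_closed)

lemma \<alpha>_smult:
  assumes "k \<in> G" "U \<in> carrier A"
  shows "\<alpha> k (c \<odot>\<^bsub>A\<^esub> U) = c \<odot>\<^bsub>A\<^esub> \<alpha> k U"
  using assms pull_linear(2)[OF assms(1) \<Phi>_closed[OF assms(2)] \<Phi>_closed[OF assms(2)]]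
  by (intro \<alpha>_eqI) (simp_all add: \<Phi>_smult \<Phi>_\<alpha> \<alpha>_closed)

lemma \<alpha>_zero: "k \<in> G \<Longrightarrow> \<alpha> k \<zero>\<^bsub>A\<^esub> = \<zero>\<^bsub>A\<^esub>"
  using \<alpha>_smult[of k "\<zero>\<^bsub>A\<^esub>" 0] MA.smult_l_null[of "\<zero>\<^bsub>A\<^esub>"] MA.smult_l_null[of "\<alpha> k \<zero>\<^bsub>A\<^esub>"] \<alpha>_closed
  by simp

lemma \<alpha>_one: "k \<in> G \<Longrightarrow> \<alpha> k \<one>\<^bsub>A\<^esub> = \<one>\<^bsub>A\<^esub>"
  by (rule \<alpha>_eqI) (simp_all add: \<Phi>_one pull_vol)

text \<open>Conjugation by a diagonal automorphism fixes \<open>G\<close> elementwise. This makes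
  axiom (iv)(a) available for \<open>k\<close>.\<close>

lemma diag_aut_in_Aut:
  assumes "k \<in> G"
  shows "diag_aut k \<in> Aut f G"
proof -
  have k: "k \<in> diag_symmetries f" using assms G_sym by blast
  let ?k' = "\<lambda>i. inverse (k i)"
  have cancel: "diag_aut ?k' (diag_aut k q) = q" "diag_aut k (diag_aut ?k' q) = q" for q
    using diag_symmetries_nonzero[OF k] by (simp_all add: diag_aut_comp diag_aut_one)
  have bij: "bij (diag_aut k)" by (rule o_bij[of "diag_aut ?k'"]) (auto simp: cancel)
  have inv: "inv_into UNIV (diag_aut k) = diag_aut ?k'"
    using cancel by (intro inv_equality) auto
  have "diag_aut k \<circ> diag_aut g \<circ> diag_aut ?k' = diag_aut g" for g
  proof
    fix q
    have "(diag_aut k \<circ> diag_aut g \<circ> diag_aut ?k') q = diag_aut k (diag_aut ?k' (diag_aut g q))"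
      by (simp add: diag_aut_comp mult_ac)
    then show "(diag_aut k \<circ> diag_aut g \<circ> diag_aut ?k') q = diag_aut g q" by (simp add: cancel)
  qed
  then show ?thesis
    using bij k by (auto simp: Aut_def calg_automorphism_def diag_aut_simps diag_symmetries_def inv)
qed

lemma \<alpha>_mult:
  assumes "k \<in> G" "U \<in> carrier A" "V \<in> carrier A"
  shows "\<alpha> k (U \<otimes>\<^bsub>A\<^esub> V) = \<alpha> k U \<otimes>\<^bsub>A\<^esub> \<alpha> k V"
  using ax_iv diag_aut_in_Aut[OF assms(1)] assms(2,3) by (simp add: axiom_iv_def)

lemma \<alpha>_finsum:
  assumes "k \<in> G" "finite S" "\<And>g. g \<in> S \<Longrightarrow> x g \<in> carrier A"
  shows "\<alpha> k (finsum A x S) = finsum A (\<lambda>g. \<alpha> k (x g)) S"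
  using assms(2,3)
proof (induction S rule: finite_induct)
  case (insert g S)
  then have "finsum A x (insert g S) = x g \<oplus>\<^bsub>A\<^esub> finsum A x S"
    and "finsum A (\<lambda>g. \<alpha> k (x g)) (insert g S) = \<alpha> k (x g) \<oplus>\<^bsub>A\<^esub> finsum A (\<lambda>g. \<alpha> k (x g)) S"
    using \<alpha>_closed[OF assms(1)] by (auto intro!: RA.finsum_insert)
  moreover have "finsum A x S \<in> carrier A" using insert.prems by (intro RA.finsum_closed) auto
  ultimately show ?case using insert assms(1) by (simp add: \<alpha>_add)
qed (simp add: \<alpha>_zero assms(1))


subsection \<open>The summands\<close>

lemma part_submodule: "g \<in> G \<Longrightarrow> submodule (part A g) complex_field A"
  using ax_i by (simp add: axiom_i_def)

lemma part_carrier: "g \<in> G \<Longrightarrow> U \<in> part A g \<Longrightarrow> U \<in> carrier A"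
  using MA.submoduleE(1)[OF part_submodule] by blast

lemma zero_part: "g \<in> G \<Longrightarrow> \<zero>\<^bsub>A\<^esub> \<in> part A g"
  using subgroup.one_closed[OF submodule.axioms(1)[OF part_submodule]] by simp

lemma decomposition:
  assumes "U \<in> carrier A"
  shows "\<exists>!x. x \<in> (\<Pi>\<^sub>E g\<in>G. part A g) \<and> U = finsum A x G"
  using ax_i assms by (simp add: axiom_i_def)

text \<open>The volume class lies in the sector of the identity, so acting on it with
  \<open>U\<close> lands in the sector of \<open>g\<close>.\<close>

lemma \<Phi>_part:
  assumes "g \<in> G" "U \<in> part A g"
  obtains q where "q \<in> polys (fix_coords g)" "\<Phi> U = omega_of f G (delta g q)"
proof -
  have "vol f G \<in> Omega_sector f G (\<lambda>_. 1)"
    unfolding vol_eq by (intro omega_of_delta_sector) (simp add: fix_coords_one)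
  then have "\<Phi> U \<in> Omega_sector f G (g \<otimes>\<^bsub>torus\<^esub> (\<lambda>_. 1))"
    using ax_iii assms one_G by (simp add: axiom_iii_def Let_def)
  then show thesis using that by (auto simp: torus_simps elim: Omega_sectorE)
qed

lemma \<Phi>_finsum:
  assumes "finite S" "S \<subseteq> G"
    and "\<And>g. g \<in> S \<Longrightarrow> x g \<in> carrier A" "\<And>g. g \<in> S \<Longrightarrow> \<Phi> (x g) = omega_of f G (delta g (q g))"
  shows "\<Phi> (finsum A x S) = omega_of f G (\<lambda>g. if g \<in> S then q g else 0)"
  using assms
proof (induction S rule: finite_induct)
  case (insert g S)
  then have "finsum A x (insert g S) = x g \<oplus>\<^bsub>A\<^esub> finsum A x S"
    by (auto intro!: RA.finsum_insert)
  moreover have "finsum A x S \<in> carrier A" using insert.prems by (intro RA.finsum_closed) auto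
  ultimately have "\<Phi> (finsum A x (insert g S))
      = omega_of f G (\<lambda>h. delta g (q g) h + (if h \<in> S then q h else 0))"
    using insert by (simp add: \<Phi>_add omega_of_add)
  also have "(\<lambda>h. delta g (q g) h + (if h \<in> S then q h else 0))
      = (\<lambda>h. if h \<in> insert g S then q h else 0)"
    using insert.hyps by (auto simp: delta_def)
  finally show ?case .
qed (simp add: \<Phi>_zero)

text \<open>Converse to the preceding sector statement: comparing coordinates shows that
  \<open>U\<close> and its own g-summand have the same image under the injective \<Phi>.\<close>

lemma part_of_sector:
  assumes g: "g \<in> G" and U: "U \<in> carrier A" "\<Phi> U = omega_of f G (delta g r)"
  shows "U \<in> part A g"
proof -
  obtain x where x: "x \<in> (\<Pi>\<^sub>E g\<in>G. part A g)" "U = finsum A x G"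
    using decomposition[OF U(1)] by blast
  have xg: "x h \<in> part A h" if "h \<in> G" for h using x(1) that by auto
  have "\<exists>q. \<Phi> (x h) = omega_of f G (delta h q)" if "h \<in> G" for h
    using \<Phi>_part[OF that xg[OF that]] by metis
  then obtain q where q: "\<And>h. h \<in> G \<Longrightarrow> \<Phi> (x h) = omega_of f G (delta h (q h))" by metis
  have "\<Phi> U = omega_of f G (\<lambda>h. if h \<in> G then q h else 0)"
    unfolding x(2) using q xg part_carrier by (intro \<Phi>_finsum[OF finite_G]) auto
  then have eq: "delta g r h - q h \<in> fix_ideal f h" if "h \<in> G" for h
    using that U(2) by (auto simp: omega_of_eq_iff)
  have "delta g r h - delta g (q g) h \<in> fix_ideal f h" if "h \<in> G" for h
    using eq[OF that] fix_ideal_closed(1) by (auto simp: delta_def)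
  then have "\<Phi> U = \<Phi> (x g)" using q[OF g] U(2) by (simp add: omega_of_eq_iff)
  then have "U = x g" using U(1) xg[OF g] part_carrier[OF g] by (intro \<Phi>_inject) auto
  then show ?thesis using xg[OF g] by simp
qed

lemma \<alpha>_part:
  assumes k: "k \<in> G" and g: "g \<in> G" and U: "U \<in> part A g"
  shows "\<alpha> k U \<in> part A g"
proof -
  obtain q where "q \<in> polys (fix_coords g)" "\<Phi> U = omega_of f G (delta g q)"
    using \<Phi>_part[OF g U] .
  moreover have "U \<in> carrier A" by (rule part_carrier[OF g U])
  ultimately show ?thesis
    using k pull_delta[OF k] by (intro part_of_sector[OF g]) (auto simp: \<alpha>_closed \<Phi>_\<alpha>)
qed


subsection \<open>Invariants\<close>

definition invariants :: "'a set" where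
  "invariants = {U \<in> carrier A. \<forall>g\<in>G. \<alpha> g U = U}"

lemma invariants_carrier: "U \<in> invariants \<Longrightarrow> U \<in> carrier A"
  by (simp add: invariants_def)

lemma invariants_\<alpha>: "U \<in> invariants \<Longrightarrow> k \<in> G \<Longrightarrow> \<alpha> k U = U"
  by (simp add: invariants_def)

text \<open>The action preserves every summand, so uniqueness of the decomposition applies to the
  transformed sum.\<close>

lemma summands_invariant:
  assumes S: "S \<subseteq> G" and x: "\<And>g. g \<in> S \<Longrightarrow> x g \<in> part A g" and inv: "finsum A x S \<in> invariants"
    and g: "g \<in> S"
  shows "x g \<in> invariants"
proof -
  have finS: "finite S" by (rule finite_subset[OF S finite_G])
  have xc: "x h \<in> carrier A" if "h \<in> S" for h using x[OF that] S that part_carrier by blast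
  \<comment> \<open>Uniqueness is available only for families over all of \<open>G\<close>, hence
    the extension by zero.\<close>
  have extend: "finsum A y S = finsum A (\<lambda>h\<in>G. if h \<in> S then y h else \<zero>\<^bsub>A\<^esub>) G"
    "(\<lambda>h\<in>G. if h \<in> S then y h else \<zero>\<^bsub>A\<^esub>) \<in> (\<Pi>\<^sub>E g\<in>G. part A g)"
    if y: "\<And>h. h \<in> S \<Longrightarrow> y h \<in> part A h" for y
  proof -
    show "finsum A y S = finsum A (\<lambda>h\<in>G. if h \<in> S then y h else \<zero>\<^bsub>A\<^esub>) G"
      using S y part_carrier finite_G by (intro RA.add.finprod_mono_neutral_cong_left) auto
    show "(\<lambda>h\<in>G. if h \<in> S then y h else \<zero>\<^bsub>A\<^esub>) \<in> (\<Pi>\<^sub>E g\<in>G. part A g)"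
      using y zero_part by auto
  qed
  have "\<alpha> k (x g) = x g" if k: "k \<in> G" for k
  proof -
    have \<alpha>x: "\<alpha> k (x h) \<in> part A h" if "h \<in> S" for h
      using \<alpha>_part[OF k _ x[OF that]] S that by blast
    have "finsum A x S = finsum A (\<lambda>h. \<alpha> k (x h)) S"
      using \<alpha>_finsum[OF k finS xc] invariants_\<alpha>[OF inv k] by simp
    then have "(\<lambda>h\<in>G. if h \<in> S then x h else \<zero>\<^bsub>A\<^esub>) = (\<lambda>h\<in>G. if h \<in> S then \<alpha> k (x h) else \<zero>\<^bsub>A\<^esub>)"
      using extend[OF x] extend[OF \<alpha>x]
      by (intro ex1_eq[OF decomposition[OF invariants_carrier[OF inv]]]) simp_all
    from fun_cong[OF this, of g] show ?thesis using g S by auto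
  qed
  then show ?thesis using xc[OF g] by (simp add: invariants_def)
qed

lemma invariantE:
  assumes "U \<in> invariants"
  obtains x where "\<And>g. g \<in> G \<Longrightarrow> x g \<in> part A g" "\<And>g. g \<in> G \<Longrightarrow> x g \<in> invariants" "U = finsum A x G"
proof -
  obtain x where x: "x \<in> (\<Pi>\<^sub>E g\<in>G. part A g)" "U = finsum A x G"
    using decomposition[OF invariants_carrier[OF assms]] by blast
  then have "x g \<in> part A g" if "g \<in> G" for g using that by auto
  with summands_invariant[OF order_refl this] assms x(2) show thesis by (intro that) auto
qed

lemma one_invariant: "\<one>\<^bsub>A\<^esub> \<in> invariants"
  by (simp add: invariants_def \<alpha>_one)

lemma zero_invariant: "\<zero>\<^bsub>A\<^esub> \<in> invariants"
  by (simp add: invariants_def \<alpha>_zero)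

lemma add_invariant: "U \<in> invariants \<Longrightarrow> V \<in> invariants \<Longrightarrow> U \<oplus>\<^bsub>A\<^esub> V \<in> invariants"
  by (simp add: invariants_def \<alpha>_add)

lemma mult_invariant: "U \<in> invariants \<Longrightarrow> V \<in> invariants \<Longrightarrow> U \<otimes>\<^bsub>A\<^esub> V \<in> invariants"
  by (simp add: invariants_def \<alpha>_mult)

lemma smult_invariant: "U \<in> invariants \<Longrightarrow> c \<odot>\<^bsub>A\<^esub> U \<in> invariants"
  by (simp add: invariants_def \<alpha>_smult)

lemma minus_eq_smult: "U \<in> carrier A \<Longrightarrow> \<ominus>\<^bsub>A\<^esub> U = (- 1) \<odot>\<^bsub>A\<^esub> U"
proof -
  assume U: "U \<in> carrier A"
  have "(- 1) \<odot>\<^bsub>A\<^esub> U \<oplus>\<^bsub>A\<^esub> 1 \<odot>\<^bsub>A\<^esub> U = ((- 1) + 1) \<odot>\<^bsub>A\<^esub> U"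
    using MA.smult_l_distr[of "-1" 1 U] U by simp
  also have "\<dots> = \<zero>\<^bsub>A\<^esub>" using MA.smult_l_null[OF U] by simp
  also have "1 \<odot>\<^bsub>A\<^esub> U = U" using MA.smult_one[OF U] by simp
  finally show ?thesis using U by (intro RA.minus_equality) auto
qed

lemma minus_invariant: "U \<in> invariants \<Longrightarrow> \<ominus>\<^bsub>A\<^esub> U \<in> invariants"
  by (simp add: minus_eq_smult invariants_carrier smult_invariant)

lemma submodule_invariants: "submodule invariants complex_field A"
  by (rule MA.submoduleI)
    (auto simp: zero_invariant add_invariant minus_invariant smult_invariant invariants_carrier)

lemma complex_algebra_invariants: "complex_algebra (A\<lparr>carrier := invariants\<rparr>)"
proof -
  have "subring invariants A"
    by (rule RA.subringI) (auto simp: one_invariant add_invariant mult_invariant minus_invariant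
        invariants_carrier)
  then have "ring (A\<lparr>carrier := invariants\<rparr>)" by (rule RA.subring_is_ring)
  moreover have "Module.module complex_field (A\<lparr>carrier := invariants\<rparr>)"
    by (rule submodule.submodule_is_module[OF submodule_invariants module_A])
  ultimately show ?thesis
    by (simp add: complex_algebra_def smult_mult_A invariants_carrier)
qed


subsection \<open>Grading\<close>

lemma parity_submodule: "i < 2 \<Longrightarrow> submodule (parity_part G A i) complex_field A"
  using graded_A by (simp add: Z2_graded_algebra_def)

lemma parity_partE:
  assumes "U \<in> parity_part G A i" "U \<in> invariants"
  obtains S x where "S \<subseteq> G" "\<And>g. g \<in> S \<Longrightarrow> codim g mod 2 = i" "\<And>g. g \<in> S \<Longrightarrow> x g \<in> part A g"
    "\<And>g. g \<in> S \<Longrightarrow> x g \<in> invariants" "U = finsum A x S"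
proof -
  let ?S = "{g \<in> G. codim g mod 2 = i}"
  obtain x where x: "x \<in> (\<Pi> g\<in>?S. part A g)" "U = finsum A x ?S"
    using assms(1) by (auto simp: parity_part_def Let_def)
  have xg: "x g \<in> part A g" if "g \<in> ?S" for g using x(1) that by auto
  have "x g \<in> invariants" if "g \<in> ?S" for g
    using summands_invariant[of ?S x g] xg assms(2) x(2) that by blast
  with xg x(2) show thesis by (intro that[of ?S x]) auto
qed

lemma \<alpha>_parity:
  assumes "k \<in> G" "U \<in> parity_part G A i"
  shows "\<alpha> k U \<in> parity_part G A i"
proof -
  let ?S = "{g \<in> G. codim g mod 2 = i}"
  obtain x where x: "x \<in> (\<Pi> g\<in>?S. part A g)" "U = finsum A x ?S"
    using assms(2) by (auto simp: parity_part_def Let_def)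
  have xg: "x g \<in> part A g" if "g \<in> ?S" for g using x(1) that by auto
  have "\<alpha> k U = finsum A (\<lambda>g. \<alpha> k (x g)) ?S"
    unfolding x(2) using finite_G xg part_carrier by (intro \<alpha>_finsum assms(1)) auto
  moreover have "(\<lambda>g. \<alpha> k (x g)) \<in> (\<Pi> g\<in>?S. part A g)"
    using \<alpha>_part[OF assms(1)] xg by auto
  ultimately show ?thesis unfolding parity_part_def Let_def by blast
qed

lemma graded_invariants:
  "Z2_graded_algebra (A\<lparr>carrier := invariants\<rparr>) (\<lambda>i. parity_part G A i \<inter> invariants)"
  unfolding Z2_graded_algebra_def
proof (intro conjI allI impI ballI)
  show "complex_algebra (A\<lparr>carrier := invariants\<rparr>)" by (rule complex_algebra_invariants)
next
  fix i :: nat assume i: "i < 2"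
  let ?D = "parity_part G A i \<inter> invariants"
  have D: "submodule ?D complex_field A"
    using MA.submoduleE[OF parity_submodule[OF i]]
      subgroup.one_closed[OF submodule.axioms(1)[OF parity_submodule[OF i]]]
    by (intro MA.submoduleI)
      (auto simp: zero_invariant add_invariant minus_invariant smult_invariant)
  have "subgroup ?D (add_monoid A\<lparr>carrier := invariants\<rparr>)"
    by (rule group.subgroup_incl[OF RA.add.is_group submodule.axioms(1)[OF D]
          submodule.axioms(1)[OF submodule_invariants]]) simp
  moreover have "c \<odot>\<^bsub>A\<^esub> x \<in> ?D" if "x \<in> ?D" for c x
    using submodule.smult_closed[OF D] that by simp
  ultimately show "submodule ?D complex_field (A\<lparr>carrier := invariants\<rparr>)"
    by (intro submodule.intro) (simp_all add: submodule_axioms_def)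
next
  fix x assume "x \<in> carrier (A\<lparr>carrier := invariants\<rparr>)"
  then have x: "x \<in> invariants" by simp
  let ?D = "parity_part G A"
  have ex1: "\<exists>!p. p \<in> ?D 0 \<times> ?D 1 \<and> x = fst p \<oplus>\<^bsub>A\<^esub> snd p"
    using graded_A invariants_carrier[OF x] by (simp add: Z2_graded_algebra_def)
  from ex1_implies_ex[OF ex1] obtain p
    where p: "p \<in> ?D 0 \<times> ?D 1" "x = fst p \<oplus>\<^bsub>A\<^esub> snd p" by (elim exE conjE)
  define a where "a = fst p"
  define b where "b = snd p"
  have ab: "a \<in> ?D 0" "b \<in> ?D 1" "x = a \<oplus>\<^bsub>A\<^esub> b"
    using p by (simp_all add: a_def b_def mem_Times_iff)
  have carr: "a \<in> carrier A" "b \<in> carrier A"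
    using MA.submoduleE(1)[OF parity_submodule, of 0] MA.submoduleE(1)[OF parity_submodule, of 1] ab
    by auto
  \<comment> \<open>The action preserves both parities, so the even and odd components of an
    invariant element are invariant by uniqueness.\<close>
  have "\<alpha> k a = a \<and> \<alpha> k b = b" if k: "k \<in> G" for k
  proof -
    have "x = \<alpha> k a \<oplus>\<^bsub>A\<^esub> \<alpha> k b" using invariants_\<alpha>[OF x k] ab(3) \<alpha>_add[OF k carr] by simp
    then have "(\<alpha> k a, \<alpha> k b) = (a, b)"
      using \<alpha>_parity[OF k] ab by (intro ex1_eq[OF ex1]) simp_all
    then show ?thesis by simp
  qed
  then have inv: "a \<in> invariants" "b \<in> invariants" using carr by (auto simp: invariants_def)
  show "\<exists>!p. p \<in> (?D 0 \<inter> invariants) \<times> (?D 1 \<inter> invariants)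
      \<and> x = fst p \<oplus>\<^bsub>A\<lparr>carrier := invariants\<rparr>\<^esub> snd p"
  proof (rule ex1I[of _ "(a, b)"])
    fix p assume "p \<in> (?D 0 \<inter> invariants) \<times> (?D 1 \<inter> invariants)
      \<and> x = fst p \<oplus>\<^bsub>A\<lparr>carrier := invariants\<rparr>\<^esub> snd p"
    then have "p \<in> ?D 0 \<times> ?D 1 \<and> x = fst p \<oplus>\<^bsub>A\<^esub> snd p" by auto
    then show "p = (a, b)" by (rule ex1_eq[OF ex1]) (use ab in simp)
  qed (use ab inv in simp)
next
  fix i j :: nat and x y
  assume "i < 2" "j < 2" "x \<in> parity_part G A i \<inter> invariants" "y \<in> parity_part G A j \<inter> invariants"
  then show "x \<otimes>\<^bsub>A\<lparr>carrier := invariants\<rparr>\<^esub> y \<in> parity_part G A ((i + j) mod 2) \<inter> invariants"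
    using graded_A mult_invariant by (simp add: Z2_graded_algebra_def)
qed


subsection \<open>Graded commutativity\<close>

lemma part_commute:
  assumes g: "g \<in> G" and h: "h \<in> G" and U: "U \<in> part A g" and V: "V \<in> part A h" "V \<in> invariants"
  shows "U \<otimes>\<^bsub>A\<^esub> V = (- 1) ^ (codim g * codim h) \<odot>\<^bsub>A\<^esub> (V \<otimes>\<^bsub>A\<^esub> U)"
  using ax_iv g h U V invariants_\<alpha>[OF V(2) g] by (simp add: axiom_iv_def)

lemma commute_closed:
  assumes "U \<in> carrier A" "V \<in> carrier A" "W \<in> carrier A"
    and "U \<otimes>\<^bsub>A\<^esub> W = c \<odot>\<^bsub>A\<^esub> (W \<otimes>\<^bsub>A\<^esub> U)" "V \<otimes>\<^bsub>A\<^esub> W = c \<odot>\<^bsub>A\<^esub> (W \<otimes>\<^bsub>A\<^esub> V)"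
  shows "(U \<oplus>\<^bsub>A\<^esub> V) \<otimes>\<^bsub>A\<^esub> W = c \<odot>\<^bsub>A\<^esub> (W \<otimes>\<^bsub>A\<^esub> (U \<oplus>\<^bsub>A\<^esub> V))"
  using assms MA.smult_r_distr[of c "W \<otimes>\<^bsub>A\<^esub> U" "W \<otimes>\<^bsub>A\<^esub> V"] by (simp add: RA.l_distr RA.r_distr)

lemma commute_closed':
  assumes "U \<in> carrier A" "V \<in> carrier A" "W \<in> carrier A"
    and "W \<otimes>\<^bsub>A\<^esub> U = c \<odot>\<^bsub>A\<^esub> (U \<otimes>\<^bsub>A\<^esub> W)" "W \<otimes>\<^bsub>A\<^esub> V = c \<odot>\<^bsub>A\<^esub> (V \<otimes>\<^bsub>A\<^esub> W)"
  shows "W \<otimes>\<^bsub>A\<^esub> (U \<oplus>\<^bsub>A\<^esub> V) = c \<odot>\<^bsub>A\<^esub> ((U \<oplus>\<^bsub>A\<^esub> V) \<otimes>\<^bsub>A\<^esub> W)"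
  using assms MA.smult_r_distr[of c "U \<otimes>\<^bsub>A\<^esub> W" "V \<otimes>\<^bsub>A\<^esub> W"] by (simp add: RA.l_distr RA.r_distr)

lemma smult_zero_A: "c \<odot>\<^bsub>A\<^esub> \<zero>\<^bsub>A\<^esub> = \<zero>\<^bsub>A\<^esub>"
  by (rule MA.smult_r_null) simp

text \<open>Expanding both factors into sector components reduces the claim to axiom (iv)(b). Its
  twist acts trivially on the invariant second component, and its sign depends only on the parities
  of the codimensions.\<close>

lemma commutative_invariants:
  "Z2_graded_commutative (A\<lparr>carrier := invariants\<rparr>) (\<lambda>i. parity_part G A i \<inter> invariants)"
  unfolding Z2_graded_commutative_def
proof (intro allI impI ballI)
  fix i j :: nat and x y
  assume ij: "i < 2" "j < 2"
    and "x \<in> parity_part G A i \<inter> invariants" "y \<in> parity_part G A j \<inter> invariants"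
  then have x: "x \<in> parity_part G A i" "x \<in> invariants"
    and y: "y \<in> parity_part G A j" "y \<in> invariants" by auto
  let ?c = "(- 1) ^ (i * j) :: complex"
  obtain S xs where S: "S \<subseteq> G" "\<And>g. g \<in> S \<Longrightarrow> codim g mod 2 = i"
    and xs: "\<And>g. g \<in> S \<Longrightarrow> xs g \<in> part A g" "x = finsum A xs S"
    using parity_partE[OF x] by metis
  obtain T ys where T: "T \<subseteq> G" "\<And>g. g \<in> T \<Longrightarrow> codim g mod 2 = j"
    and ys: "\<And>g. g \<in> T \<Longrightarrow> ys g \<in> part A g" "\<And>g. g \<in> T \<Longrightarrow> ys g \<in> invariants" "y = finsum A ys T"
    using parity_partE[OF y] by metis
  have fin: "finite S" "finite T" using finite_subset[OF _ finite_G] S(1) T(1) by auto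
  have carr: "\<And>g. g \<in> S \<Longrightarrow> xs g \<in> carrier A" "\<And>h. h \<in> T \<Longrightarrow> ys h \<in> carrier A"
    using xs(1) ys(1) S(1) T(1) part_carrier by blast+
  have y_carr: "y \<in> carrier A" by (rule invariants_carrier[OF y(2)])
  have "xs g \<otimes>\<^bsub>A\<^esub> ys h = ?c \<odot>\<^bsub>A\<^esub> (ys h \<otimes>\<^bsub>A\<^esub> xs g)" if g: "g \<in> S" and h: "h \<in> T" for g h
  proof -
    have "even (codim g) = even i" "even (codim h) = even j"
      using S(2)[OF g] T(2)[OF h] by auto
    then have "(- 1) ^ (codim g * codim h) = ?c" by (simp add: minus_one_power_iff)
    moreover have "g \<in> G" "h \<in> G" using g h S(1) T(1) by blast+
    ultimately show ?thesis using part_commute[OF _ _ xs(1)[OF g] ys(1,2)[OF h]] by simp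
  qed
  then have "xs g \<otimes>\<^bsub>A\<^esub> y = ?c \<odot>\<^bsub>A\<^esub> (y \<otimes>\<^bsub>A\<^esub> xs g)" if "g \<in> S" for g
    unfolding ys(3) using that carr(1)[OF that]
    by (intro RA.finsum_induct[OF fin(2) carr(2),
          where Q = "\<lambda>y. xs g \<otimes>\<^bsub>A\<^esub> y = ?c \<odot>\<^bsub>A\<^esub> (y \<otimes>\<^bsub>A\<^esub> xs g)"])
      (simp_all add: smult_zero_A commute_closed')
  then have "x \<otimes>\<^bsub>A\<^esub> y = ?c \<odot>\<^bsub>A\<^esub> (y \<otimes>\<^bsub>A\<^esub> x)"
    unfolding xs(2) using y_carr
    by (intro RA.finsum_induct[OF fin(1) carr(1),
          where Q = "\<lambda>x. x \<otimes>\<^bsub>A\<^esub> y = ?c \<odot>\<^bsub>A\<^esub> (y \<otimes>\<^bsub>A\<^esub> x)"])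
      (simp_all add: smult_zero_A commute_closed)
  then show "x \<otimes>\<^bsub>A\<lparr>carrier := invariants\<rparr>\<^esub> y
      = ?c \<odot>\<^bsub>A\<lparr>carrier := invariants\<rparr>\<^esub> (y \<otimes>\<^bsub>A\<lparr>carrier := invariants\<rparr>\<^esub> x)" by simp
qed


subsection \<open>The Frobenius form\<close>

abbreviation (input) "\<eta> U V \<equiv> pairing (\<Phi> U) (\<Phi> V)"

lemma \<eta>_add:
  assumes "U \<in> carrier A" "V \<in> carrier A" "W \<in> carrier A"
  shows "\<eta> (U \<oplus>\<^bsub>A\<^esub> V) W = \<eta> U W + \<eta> V W" "\<eta> W (U \<oplus>\<^bsub>A\<^esub> V) = \<eta> W U + \<eta> W V"
  using assms residue_pairing_add[OF wh_nd G G_sym \<Phi>_closed \<Phi>_closed \<Phi>_closed]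
  by (simp_all add: \<Phi>_add)

lemma \<eta>_smult:
  assumes "U \<in> carrier A" "V \<in> carrier A"
  shows "\<eta> (c \<odot>\<^bsub>A\<^esub> U) V = c * \<eta> U V" "\<eta> U (c \<odot>\<^bsub>A\<^esub> V) = c * \<eta> U V"
  using assms residue_pairing_smult[OF wh_nd G G_sym \<Phi>_closed \<Phi>_closed]
  by (simp_all add: \<Phi>_smult)

lemma \<eta>_zero: "V \<in> carrier A \<Longrightarrow> \<eta> \<zero>\<^bsub>A\<^esub> V = 0" "V \<in> carrier A \<Longrightarrow> \<eta> V \<zero>\<^bsub>A\<^esub> = 0"
  using \<eta>_smult[of "\<zero>\<^bsub>A\<^esub>" V 0] \<eta>_smult[of V "\<zero>\<^bsub>A\<^esub>" 0] by (simp_all add: smult_zero_A)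

lemma \<eta>_part_invariant:
  assumes g: "g \<in> G" and h: "h \<in> G" and U: "U \<in> part A g" and V: "V \<in> part A h" "V \<in> invariants"
    and W: "W \<in> carrier A"
  shows "\<eta> (U \<otimes>\<^bsub>A\<^esub> V) W = \<eta> U (V \<otimes>\<^bsub>A\<^esub> W)"
proof -
  let ?s = "(- 1) ^ (codim g * codim h) :: complex"
  have carr: "U \<in> carrier A" "V \<in> carrier A" using part_carrier g h U V by auto
  obtain q where q: "q \<in> polys (fix_coords g)" "\<Phi> U = omega_of f G (delta g q)"
    using \<Phi>_part[OF g U] .
  then have sector: "\<Phi> U \<in> Omega_sector f G g" by (simp add: omega_of_delta_sector)
  \<comment> \<open>Axiom (v) moves the outermost operator to the other argument. Exchanging the
    factors first makes \<open>V\<close> that operator, acting on the class \<Phi> U of the sector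
    of g.\<close>
  have "\<eta> (U \<otimes>\<^bsub>A\<^esub> V) W = ?s * pairing (lact A V (\<Phi> U)) (\<Phi> W)"
    using carr W by (simp add: part_commute[OF g h U V] \<eta>_smult \<Phi>_mult[symmetric])
  also have "pairing (lact A V (\<Phi> U)) (\<Phi> W)
      = (- 1) ^ (codim h * codim g) * pairing (\<Phi> U) (lact A (\<alpha> (inv\<^bsub>torus\<^esub> g) V) (\<Phi> W))"
    using ax_v g h V(1) sector \<Phi>_closed[OF W] by (simp add: axiom_v_def)
  \<comment> \<open>The twist by the inverse of g in axiom (v) is trivial on the invariant
    \<open>V\<close>.\<close>
  also have "lact A (\<alpha> (inv\<^bsub>torus\<^esub> g) V) (\<Phi> W) = \<Phi> (V \<otimes>\<^bsub>A\<^esub> W)"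
    using invariants_\<alpha>[OF V(2) inv_G[OF g]] carr(2) W by (simp add: \<Phi>_mult)
  finally show ?thesis
    by (simp add: mult.commute[of "codim h"] mult.assoc[symmetric] power_mult_distrib[symmetric])
qed

lemma \<eta>_invariant:
  assumes U: "U \<in> invariants" and V: "V \<in> invariants" and W: "W \<in> carrier A"
  shows "\<eta> (U \<otimes>\<^bsub>A\<^esub> V) W = \<eta> U (V \<otimes>\<^bsub>A\<^esub> W)"
proof -
  obtain xs where xs: "\<And>g. g \<in> G \<Longrightarrow> xs g \<in> part A g" "U = finsum A xs G"
    using invariantE[OF U] by metis
  obtain ys where ys: "\<And>g. g \<in> G \<Longrightarrow> ys g \<in> part A g" "\<And>g. g \<in> G \<Longrightarrow> ys g \<in> invariants"
    "V = finsum A ys G"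
    using invariantE[OF V] by metis
  have carr: "\<And>g. g \<in> G \<Longrightarrow> xs g \<in> carrier A" "\<And>g. g \<in> G \<Longrightarrow> ys g \<in> carrier A"
    using xs(1) ys(1) part_carrier by blast+
  have V_carr: "V \<in> carrier A" by (rule invariants_carrier[OF V])
  have "\<eta> (xs g \<otimes>\<^bsub>A\<^esub> V) W = \<eta> (xs g) (V \<otimes>\<^bsub>A\<^esub> W)" if g: "g \<in> G" for g
    unfolding ys(3)
  proof (rule RA.finsum_induct[OF finite_G carr(2)])
    show "\<eta> (xs g \<otimes>\<^bsub>A\<^esub> ys h) W = \<eta> (xs g) (ys h \<otimes>\<^bsub>A\<^esub> W)" if "h \<in> G" for h
      by (rule \<eta>_part_invariant[OF g that xs(1)[OF g] ys(1,2)[OF that] W])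
  qed (use carr(1)[OF g] W in \<open>simp_all add: \<eta>_zero RA.r_distr RA.l_distr \<eta>_add\<close>)
  then show ?thesis
    unfolding xs(2)
    using V_carr W
    by (intro RA.finsum_induct[OF finite_G carr(1),
          where Q = "\<lambda>U. \<eta> (U \<otimes>\<^bsub>A\<^esub> V) W = \<eta> U (V \<otimes>\<^bsub>A\<^esub> W)"])
      (simp_all add: \<eta>_zero RA.l_distr \<eta>_add)
qed

text \<open>A non-zero element has a sector component outside the Jacobian ideal of f^g. This
  component inherits invariance modulo the ideal, which is what the invariant test monomial
  requires.\<close>

lemma invariant_coordinates:
  assumes U: "U \<in> invariants" "U \<noteq> \<zero>\<^bsub>A\<^esub>"
  obtains p g m where "poly_family p" "\<Phi> U = omega_of f G p" "g \<in> G" "keys m \<subseteq> fix_coords g"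
    "fix_res f g (p g * monom_of m) \<noteq> 0"
    "\<And>k. k \<in> G \<Longrightarrow> pull_coord k g (monom_of m) = monom_of m"
proof -
  have carr: "U \<in> carrier A" by (rule invariants_carrier[OF U(1)])
  obtain p where p: "poly_family p" "\<Phi> U = omega_of f G p"
    using \<Phi>_closed[OF carr] by (rule Omega_carrierE)
  have "\<Phi> U \<noteq> \<Phi> \<zero>\<^bsub>A\<^esub>" using \<Phi>_inject[OF carr] U(2) by auto
  then obtain g where g: "g \<in> G" "p g \<notin> fix_ideal f g"
    by (auto simp: p(2) \<Phi>_zero omega_of_eq_iff)
  have "pull_coord k g (p g) - p g \<in> fix_ideal f g" if k: "k \<in> G" for k
  proof -
    have "k \<in> diag_symmetries f" using k G_sym by blast
    then have "omega_of f G (\<lambda>g. pull_coord k g (p g)) = omega_of f G p"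
      using \<Phi>_\<alpha>[OF k carr] invariants_\<alpha>[OF U(1) k] p omega_of_pull[OF _ G_torus p(1)] by simp
    then show ?thesis using g(1) by (simp add: omega_of_eq_iff)
  qed
  moreover have "g \<in> diag_symmetries f" "p g \<in> polys (fix_coords g)"
    using g(1) G_sym p(1) by (auto simp: poly_family_def)
  ultimately show thesis
    using fix_res_invariant_test_monomial[OF wh_nd G G_sym _ _ g(2)] p g(1) that by metis
qed

text \<open>Placed in the sector of the inverse because the pairing couples \<open>g\<close> with
  it; both have the same fixed coordinates, so invariance of the monomial carries over.\<close>

lemma invariant_test_element:
  assumes g: "g \<in> G" and m: "keys m \<subseteq> fix_coords g"
    and inv: "\<And>k. k \<in> G \<Longrightarrow> pull_coord k g (monom_of m) = monom_of m"
  obtains V where "V \<in> invariants" "\<Phi> V = omega_of f G (delta (inv\<^bsub>torus\<^esub> g) (monom_of m))"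
proof -
  let ?h = "inv\<^bsub>torus\<^esub> g"
  have fix_h: "fix_coords ?h = fix_coords g"
    using g G_torus by (simp add: inv_torus subset_eq fix_coords_inverse)
  have pol: "monom_of m \<in> polys (fix_coords ?h)" by (simp add: fix_h monom_of_def polys_single m)
  obtain V where V: "V \<in> carrier A" "\<Phi> V = omega_of f G (delta ?h (monom_of m))"
    using omega_of_closed[OF poly_family_delta[OF pol]] by (rule \<Phi>_surj)
  have "\<alpha> k V = V" if k: "k \<in> G" for k
  proof (rule \<alpha>_eqI[OF k V(1)])
    have "pull_coord k ?h (monom_of m) = monom_of m"
      using inv[OF k] by (simp add: pull_coord_def fix_h)
    then show "\<Phi> V = pull k (\<Phi> V)" by (simp add: V(2) pull_delta[OF k pol])
  qed
  with V show thesis by (intro that[of V]) (simp_all add: invariants_def)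
qed

lemma inv_inv_G: "g \<in> G \<Longrightarrow> inv\<^bsub>torus\<^esub> (inv\<^bsub>torus\<^esub> g) = g"
  using group.inv_inv[OF group_torus] G_torus by blast

text \<open>The test element lives in one sector, so the sum over \<open>G\<close> collapses to a
  single non-zero residue times a non-zero constant.\<close>

lemma \<eta>_nondegenerate_left:
  assumes U: "U \<in> invariants" and zero: "\<And>V. V \<in> invariants \<Longrightarrow> \<eta> U V = 0"
  shows "U = \<zero>\<^bsub>A\<^esub>"
proof (rule ccontr)
  assume "U \<noteq> \<zero>\<^bsub>A\<^esub>"
  from invariant_coordinates[OF U this] obtain p g m where p: "poly_family p" "\<Phi> U = omega_of f G p"
    and g: "g \<in> G" and m: "keys m \<subseteq> fix_coords g" and nz: "fix_res f g (p g * monom_of m) \<noteq> 0"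
    and inv: "\<And>k. k \<in> G \<Longrightarrow> pull_coord k g (monom_of m) = monom_of m"
    by blast
  obtain V where V: "V \<in> invariants" "\<Phi> V = omega_of f G (delta (inv\<^bsub>torus\<^esub> g) (monom_of m))"
    using invariant_test_element[OF g m inv] .
  have res0: "fix_res f h 0 = 0" if "h \<in> G" for h
    using fix_res_additive(1)[OF wh_nd G G_sym, of h 0 0] that G_sym by auto
  have "\<eta> U V = (\<Sum>h\<in>G. pairing_const G h
      * fix_res f h (p h * delta (inv\<^bsub>torus\<^esub> g) (monom_of m) (inv\<^bsub>torus\<^esub> h)))"
    unfolding p(2) V(2) by (rule residue_pairing_omega_of[OF wh_nd G G_sym])
  also have "\<dots> = (\<Sum>h\<in>G. if h = g then pairing_const G g * fix_res f g (p g * monom_of m) else 0)"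
  proof (rule sum.cong[OF refl])
    fix h assume h: "h \<in> G"
    have "inv\<^bsub>torus\<^esub> h = inv\<^bsub>torus\<^esub> g \<longleftrightarrow> h = g" using inv_inv_G g h by metis
    then show "pairing_const G h * fix_res f h (p h * delta (inv\<^bsub>torus\<^esub> g) (monom_of m) (inv\<^bsub>torus\<^esub> h))
        = (if h = g then pairing_const G g * fix_res f g (p g * monom_of m) else 0)"
      using res0[OF h] by (auto simp: delta_def)
  qed
  also have "\<dots> = pairing_const G g * fix_res f g (p g * monom_of m)"
    using g finite_G by simp
  finally show False using zero[OF V(1)] nz pairing_const_nonzero[OF finite_G g] by simp
qed

text \<open>The constants at \<open>g\<close> and at its inverse involve different ages, so symmetry
  of the form is not at hand. The residues agree, as \<open>f^g\<close> is the same for both, and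
  each constant is non-zero.\<close>

lemma \<eta>_nondegenerate_right:
  assumes U: "U \<in> invariants" and zero: "\<And>V. V \<in> invariants \<Longrightarrow> \<eta> V U = 0"
  shows "U = \<zero>\<^bsub>A\<^esub>"
proof (rule ccontr)
  assume "U \<noteq> \<zero>\<^bsub>A\<^esub>"
  from invariant_coordinates[OF U this] obtain p g m where p: "poly_family p" "\<Phi> U = omega_of f G p"
    and g: "g \<in> G" and m: "keys m \<subseteq> fix_coords g" and nz: "fix_res f g (p g * monom_of m) \<noteq> 0"
    and inv: "\<And>k. k \<in> G \<Longrightarrow> pull_coord k g (monom_of m) = monom_of m"
    by blast
  obtain V where V: "V \<in> invariants" "\<Phi> V = omega_of f G (delta (inv\<^bsub>torus\<^esub> g) (monom_of m))"
    using invariant_test_element[OF g m inv] .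
  let ?i = "inv\<^bsub>torus\<^esub> g"
  have res0: "fix_res f h 0 = 0" if "h \<in> G" for h
    using fix_res_additive(1)[OF wh_nd G G_sym, of h 0 0] that G_sym by auto
  have res_i: "fix_res f ?i = fix_res f g"
    using g G_torus by (simp add: inv_torus subset_eq fix_coords_inverse restrict_fix_inverse)
  have "\<eta> V U = (\<Sum>h\<in>G. pairing_const G h
      * fix_res f h (delta ?i (monom_of m) h * p (inv\<^bsub>torus\<^esub> h)))"
    unfolding p(2) V(2) by (rule residue_pairing_omega_of[OF wh_nd G G_sym])
  also have "\<dots> = (\<Sum>h\<in>G. if h = ?i then pairing_const G ?i * fix_res f g (p g * monom_of m) else 0)"
    by (rule sum.cong[OF refl])
      (auto simp: delta_def res0 res_i inv_inv_G[OF g] mult.commute[of "monom_of m"])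
  also have "\<dots> = pairing_const G ?i * fix_res f g (p g * monom_of m)"
    using inv_G[OF g] finite_G by simp
  finally show False using zero[OF V(1)] nz pairing_const_nonzero[OF finite_G inv_G[OF g]] by simp
qed

lemma frobenius_invariants:
  "frobenius_algebra (A\<lparr>carrier := invariants\<rparr>) (orbifold_form f G A)"
  unfolding frobenius_algebra_def orbifold_form_def
  using complex_algebra_invariants \<eta>_nondegenerate_left \<eta>_nondegenerate_right
  by (simp add: \<eta>_add \<eta>_smult \<eta>_invariant invariants_carrier)

lemma orbifold_jacobian_algebra_eq: "orbifold_jacobian_algebra f G A = A\<lparr>carrier := invariants\<rparr>"
  by (simp add: orbifold_jacobian_algebra_def invariants_def)

lemma orbifold_parity_part_eq: "orbifold_parity_part f G A = (\<lambda>i. parity_part G A i \<inter> invariants)"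
  by (simp add: orbifold_parity_part_def orbifold_jacobian_algebra_eq fun_eq_iff)

lemmas orbifold_jacobian_algebra_frobenius =
  graded_invariants commutative_invariants frobenius_invariants

end

theorem mainTheorem3:
  fixes f :: "'n::{finite,linorder} mpoly"
    and G :: "('n \<Rightarrow> complex) set"
    and A :: "('n, 'a) twisted_alg"
  assumes "invertible_polynomial f"
    and "subgroup G torus"
    and "G \<subseteq> diag_symmetries f \<inter> diag_SL"
    and "twisted_jacobian_algebra f G A"
  shows "Z2_graded_algebra (orbifold_jacobian_algebra f G A) (orbifold_parity_part f G A) \<and>
         Z2_graded_commutative (orbifold_jacobian_algebra f G A) (orbifold_parity_part f G A) \<and>
         frobenius_algebra (orbifold_jacobian_algebra f G A) (orbifold_form f G A)"
proof -
  have axioms: "axiom_i f G A" "axiom_iii f G A" "axiom_iv f G A" "axiom_v f G A"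
    using assms(4) by (auto elim: twisted_jacobian_algebra.cases)
  note setting = assms(1-3) axioms
  show ?thesis
    unfolding orbifold_jacobian_algebra_eq[OF setting] orbifold_parity_part_eq[OF setting]
    using orbifold_jacobian_algebra_frobenius[OF setting] by simp
qed

end
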